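(* Let $p^*=(x^*,\lambda^*,\mu^* )$ be a KKT point of the central NLP such that Assumptions 1, 2, 3 and 4 (listed in the context) hold at $p^*$, and let $\beta>0$. Then there exist an upper bound $\bar\alpha>0$ on the step size and a radius $r>0$ such that if $\alpha<\bar\alpha$ (with $\alpha\in(0,1)$) and $p^0\in\mathcal B_r(p^* )$, the sequence $\{p^q\}$ generated by Algorithm 1, i.e. $p^{q+1}=T(p^q)$ for $q=0,1,\dots$, is bounded and converges to $p^*$. Moreover, for any symmetric $Q\succ 0$ the discrete-time Lyapunov equation $$(I-\alpha A(p^* ))^\top \bar P\,(I-\alpha A(p^* ))-\bar P=-Q$$ admits a positive-definite solution $\bar P\succ0$ such that Algorithm 1 converges Q-linearly with respect to the norm $\|\cdot\|_{\bar P}$, i.e. for $q=1,2,\dots$ and $C=\|I-\alpha A(p^* )\|_{\bar P}\in(0,1)$, $$\|p^q-p^*\|_{\bar P}\le C\,\|p^{q-1}-p^*\|_{\bar P}.$$ Equivalently, the iterates converge R-linearly with respect to the Euclidean norm, i.e. there exist constants $C_0>0$ and $C_1\in(0,1)$ such that $$\|p^q-p^*\|\le C_0C_1^q\|p^0-p^*\|.$$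
   Context: **Central NLP.** $\mathcal G=(\mathcal V,\mathcal E)$ is an undirected connected graph, $\mathcal V=\{1,\dots,M\}$, and $\mathcal N_i=\{j\in\mathcal V: (i,j)\in\mathcal E,\ j\ne i\}$. Each $i\in\mathcal V$ has a variable $x_i\in\mathbb R^{n_i}$; $x_{\mathcal N_i}=[x_j]_{j\in\mathcal N_i}$ is the stacked vector of neighbor variables. The central NLP is $$\min_{x_1,\dots,x_M}\ \sum_{i\in\mathcal V} f_i(x_i,x_{\mathcal N_i})\quad\text{s.t.}\quad g_i(x_i,x_{\mathcal N_i})=0,\quad h_i(x_i,x_{\mathcal N_i})\le 0,\quad i\in\mathcal V,$$ with multipliers $\lambda_i\in\mathbb R^{n_{gi}}$ for $g_i$ and $\mu_i\in\mathbb R^{n_{hi}}$ for $h_i$; $f_i$ is scalar valued, $g_i,h_i$ take values in $\mathbb R^{n_{gi}},\mathbb R^{n_{hi}}$; all functions are at least three times continuously differentiable. Local Lagrangians: $L_i(x_i,\lambda_i,\mu_i,x_{\mathcal N_i})=f_i+\lambda_i^\top g_i+\mu_i^\top h_i$; central Lagrangian: $L(x,\lambda,\mu)=\sum_{i}L_i$. Stacked quantities: $x=[x_i]_i\in\mathbb R^n$, $\lambda=[\lambda_i]_i\in\mathbb R^{n_g}$, $\mu=[\mu_i]_i\in\mathbb R^{n_h}$, $p=(x,\lambda,\mu)\in\mathbb R^{m}$ with $m=n+n_g+n_h$, $p_i=(x_i,\lambda_i,\mu_i)$, $g(x)=[g_i(x_i,x_{\mathcal N_i})]_i$, $h(x)=[h_i(x_i,x_{\mathcal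 N_i})]_i$. For vector functions, $\nabla$ denotes the Jacobian (rows are transposed gradients); $\|\cdot\|$ is the Euclidean/spectral norm; $\mathcal B_r(p^* )$ is the open Euclidean ball; $\|v\|_{\bar P}=\sqrt{v^\top\bar Pv}$, with the induced matrix norm. A KKT point is $p=(x,\lambda,\mu)$ with $\nabla_{x}L(x,\lambda,\mu)=0$, $g(x)=0$, $h(x)\le0$, $\mu\ge0$, $\mathrm{diag}(\mu)h(x)=0$. Active set: $\mathcal A(x)=\{k\in\{1,\dots,n_h\}:[h(x)]_k=0\}$. **Local NLPs.** For given $p$ and $\rho_i\ge0$, the local NLP of agent $i$ is $\min_{s_i\in\mathbb R^{n_i}}\bar f_i(s_i)$ s.t. $\bar g_i(s_i)=0$ (multiplier $\nu_i$), $\bar h_i(s_i)\le0$ (multiplier $\kappa_i$), where $$\bar f_i(s_i)=f_i(x_i+s_i,x_{\mathcal N_i})+\tfrac{\rho_i}{2}\|s_i\|^2+\sum_{j\in\mathcal N_i}\nabla_{x_i}L_j(x_j,\lambda_j,\mu_j,x_{\mathcal N_j})^\top s_i,$$ $\bar g_i(s_i)=g_i(x_i+s_i,x_{\mathcal N_i})$, $\bar h_i(s_i)=h_i(x_i+s_i,x_{\mathcal N_i})$ (all depending on $p$). Let $y_i=(s_i,\nu_i,\kappa_i)$ and $\bar L_i(y_i)=\bar f_i(s_i)+\nu_i^\top\bar g_i(s_i)+\kappa_i^\top\bar h_i(s_i)$. The local KKT conditions are $\nabla_{s_i}\bar L_i(y_i)=0$, $\bar g_i(s_i)=0$, $\bar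 h_i(s_i)\le0$, $\kappa_i\ge0$, $\mathrm{diag}(\kappa_i)\bar h_i(s_i)=0$. $\Phi(p)=(s(p),\nu(p),\kappa(p))$ denotes the stacked solution of all local KKT systems for given $p$; near $p^*$ it is the locally unique solution with $\Phi(p^* )=(0,\lambda^*,\mu^* )$, and $y=\Phi(p)$ is what the algorithm computes. **Algorithm 1 (SBDP+).** With step size $\alpha\in(0,1)$, dual step size $\beta>0$, in iteration $q$ each agent computes $y_i^q$ from $y^q=\Phi(p^q)$ and sets $$p_i^{q+1}=p_i^q+\alpha P_i^q(y_i^q)\,(y_i^q-d_i(p_i^q)),\qquad d_i(p_i)=(0,\lambda_i,\mu_i),$$ $$P_i^q(y_i)=\begin{bmatrix}\nabla^2_{s_is_i}\bar L_i(y_i)&\nabla_{s_i}\bar g_i(s_i)^\top&\nabla_{s_i}\bar h_i(s_i)^\top\\-\beta\nabla_{s_i}\bar g_i(s_i)&0&0\\-\beta\,\mathrm{diag}(\kappa_i)\nabla_{s_i}\bar h_i(s_i)&0&-\beta\,\mathrm{diag}(\bar h_i(s_i))\end{bmatrix},$$ with barred functions formed at $p=p^q$. The stacked map $p^q\mapsto p^{q+1}$ is denoted $T$. **Matrix $A$.** With $J_g(x)=\nabla_xg(x)$, $J_h(x)=\nabla_xh(x)$, $U=\mathrm{diag}(\mu)$, $H(x)=\mathrm{diag}(h(x))$, $$A(p)=\begin{bmatrix}\nabla^2_{xx}L(x,\lambda,\mu)&J_g(x)^\top&J_h(x)^\top\\-\beta J_g(x)&0&0\\-\beta UJ_h(x)&0&-\beta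 H(x)\end{bmatrix}.$$ **Assumptions at $p^*$.** 1. Strict complementarity: $[\mu^*]_k>0$ for $k\in\mathcal A(x^* )$; and LICQ: the matrix $[\nabla_xg(x^* )^\top,\ [\nabla_xh(x^* )]_{\mathcal A(x^* )}^\top]$ has full column rank ($[\cdot]_{\mathcal A}$ selects rows). 2. Uniform SOSC: $\nabla^2_{xx}L(x^*,\lambda^*,\mu^* )\succ0$. 3. $\rho_i\ge0$ is such that $\nabla^2_{x_ix_i}L_i(x_i^*,\lambda_i^*,\mu_i^*,x^*_{\mathcal N_i})+\rho_iI\succ0$ for all $i\in\mathcal V$. 4. Constraint compatible decomposition: for each $i$ the matrix $[\nabla_{x_i}g_i(x_i^*,x^*_{\mathcal N_i})^\top,\ [\nabla_{x_i}h_i(x_i^*,x^*_{\mathcal N_i})]_{\mathcal A_i^*}^\top]$ has full column rank, where $\mathcal A_i^*=\{k:[h_i(x_i^*,x^*_{\mathcal N_i})]_k=0\}$.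
   Formalization: The Q-linear bound with exact C fails (M=1, f=x²/2+x³, ρ=1, p*=0). Instead, the bound on the ball of radius r has an added term K‖p^{q-1}−p*‖²_P̄ with K depending on α, Q; without it, the bound holds with any c in (C,1) in place of C on a smaller ball depending on c, α, Q. *)

theory Defs
  imports "HOL-Analysis.Analysis"
begin

text \<open>
  All stacked quantities $p = (x,\lambda,\mu)$ and $y = (s,\nu,\kappa)$ live in one space
  \<open>real^'m\<close> with $m = n + n_g + n_h$.  Every coordinate carries an owner (its agent) and a kind:
  primal, multiplier of an equality, or multiplier of an inequality.  The dimensions $n_i$,
  $n_{gi}$, $n_{hi}$ are the numbers of coordinates with owner $i$ and the given kind, so they may
  differ between agents, and any of them may be 0.  The scalar components of $g_i$ and
  $h_i$ are indexed by the coordinates of their multipliers.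
\<close>

subsection \<open>Calculus and matrices\<close>

definition partial :: "'m::finite \<Rightarrow> (real^'m \<Rightarrow> real) \<Rightarrow> real^'m \<Rightarrow> real" where
  "partial k F p = frechet_derivative F (at p) (axis k 1)"

primrec times_cont_diff :: "nat \<Rightarrow> (real^'m::finite \<Rightarrow> real) \<Rightarrow> bool" where
  "times_cont_diff 0 F \<longleftrightarrow> continuous_on UNIV F"
| "times_cont_diff (Suc r) F \<longleftrightarrow>
     (\<forall>p. F differentiable (at p)) \<and> (\<forall>k. times_cont_diff r (partial k F))"

definition hessian :: "(real^'m::finite \<Rightarrow> real) \<Rightarrow> real^'m \<Rightarrow> real^'m^'m" where
  "hessian F p = (\<chi> k l. partial k (partial l F) p)"

text \<open>The principal submatrix of \<open>M\<close> with index set \<open>S\<close> is symmetric and positive definite.\<close>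

definition pos_def_on :: "'m::finite set \<Rightarrow> real^'m^'m \<Rightarrow> bool" where
  "pos_def_on S M \<longleftrightarrow>
     (\<forall>k\<in>S. \<forall>l\<in>S. M $ k $ l = M $ l $ k) \<and>
     (\<forall>v. v \<noteq> 0 \<longrightarrow> (\<forall>k. k \<notin> S \<longrightarrow> v $ k = 0) \<longrightarrow> v \<bullet> (M *v v) > 0)"

abbreviation pos_def :: "real^'m::finite^'m \<Rightarrow> bool" where
  "pos_def \<equiv> pos_def_on UNIV"

definition wnorm :: "real^'m::finite^'m \<Rightarrow> real^'m \<Rightarrow> real" where
  "wnorm P v = sqrt (v \<bullet> (P *v v))"

definition wmatnorm :: "real^'m::finite^'m \<Rightarrow> real^'m^'m \<Rightarrow> real" where
  "wmatnorm P M = (SUP v\<in>-{0}. wnorm P (M *v v) / wnorm P v)"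

subsection \<open>The central problem\<close>

datatype kind = Primal | EqMult | IneqMult

text \<open>
  \<open>con k\<close> is the component of $g_i$ or $h_i$ whose multiplier is coordinate \<open>k\<close> (it is meaningless
  for primal \<open>k\<close>).  Costs and constraints are functions on the whole space which, by
  \<open>valid_nlp\<close> below, depend only on the primal coordinates of the agent and its neighbors.
\<close>

record ('v, 'm::finite) nlp =
  edges :: "('v \<times> 'v) set"
  owner :: "'m \<Rightarrow> 'v"
  kind_of :: "'m \<Rightarrow> kind"
  cost :: "'v \<Rightarrow> real^'m \<Rightarrow> real"
  con :: "'m \<Rightarrow> real^'m \<Rightarrow> real"

definition neighbors :: "('v, 'm::finite) nlp \<Rightarrow> 'v \<Rightarrow> 'v set" where
  "neighbors D i = {j. (i, j) \<in> edges D \<and> j \<noteq> i}"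

definition coords :: "('v, 'm::finite) nlp \<Rightarrow> kind \<Rightarrow> 'm set" where
  "coords D c = {k. kind_of D k = c}"

definition coords_of :: "('v, 'm::finite) nlp \<Rightarrow> kind \<Rightarrow> 'v \<Rightarrow> 'm set" where
  "coords_of D c i = {k. kind_of D k = c \<and> owner D k = i}"

definition depends_locally :: "('v, 'm::finite) nlp \<Rightarrow> 'v \<Rightarrow> (real^'m \<Rightarrow> real) \<Rightarrow> bool" where
  "depends_locally D i F \<longleftrightarrow>
     (\<forall>p p'. (\<forall>j\<in>insert i (neighbors D i). \<forall>k\<in>coords_of D Primal j. p $ k = p' $ k)
        \<longrightarrow> F p = F p')"

definition valid_nlp :: "('v::finite, 'm::finite) nlp \<Rightarrow> bool" where
  "valid_nlp D \<longleftrightarrow>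
     sym (edges D) \<and> (\<forall>i j. (i, j) \<in> (edges D)\<^sup>*) \<and>
     (\<forall>i. depends_locally D i (cost D i) \<and> times_cont_diff 3 (cost D i)) \<and>
     (\<forall>k. kind_of D k \<noteq> Primal \<longrightarrow>
        depends_locally D (owner D k) (con D k) \<and> times_cont_diff 3 (con D k))"

definition local_lagrangian :: "('v, 'm::finite) nlp \<Rightarrow> 'v \<Rightarrow> real^'m \<Rightarrow> real" where
  "local_lagrangian D i p = cost D i p
     + (\<Sum>k\<in>coords_of D EqMult i. p $ k * con D k p)
     + (\<Sum>k\<in>coords_of D IneqMult i. p $ k * con D k p)"

definition lagrangian :: "('v::finite, 'm::finite) nlp \<Rightarrow> real^'m \<Rightarrow> real" where
  "lagrangian D p = (\<Sum>i\<in>UNIV. local_lagrangian D i p)"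

definition kkt_point :: "('v::finite, 'm::finite) nlp \<Rightarrow> real^'m \<Rightarrow> bool" where
  "kkt_point D p \<longleftrightarrow>
     (\<forall>k\<in>coords D Primal. partial k (lagrangian D) p = 0) \<and>
     (\<forall>k\<in>coords D EqMult. con D k p = 0) \<and>
     (\<forall>k\<in>coords D IneqMult. con D k p \<le> 0 \<and> p $ k \<ge> 0 \<and> p $ k * con D k p = 0)"

definition active :: "('v, 'm::finite) nlp \<Rightarrow> real^'m \<Rightarrow> 'm set" where
  "active D p = {k \<in> coords D IneqMult. con D k p = 0}"

subsection \<open>Assumptions at a KKT point\<close>

text \<open>
  The matrix whose columns are the gradients, with respect to the primal coordinates in \<open>R\<close>, of
  the constraints in \<open>S\<close>.  It is padded with zero rows and columns to square format, which does
  not affect its rank; it has full column rank iff its rank is \<open>card S\<close>.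
\<close>

definition constraint_gradients ::
    "('v, 'm::finite) nlp \<Rightarrow> real^'m \<Rightarrow> 'm set \<Rightarrow> 'm set \<Rightarrow> real^'m^'m" where
  "constraint_gradients D p R S =
     (\<chi> l k. if l \<in> R \<and> k \<in> S then partial l (con D k) p else 0)"

definition strict_complementarity :: "('v, 'm::finite) nlp \<Rightarrow> real^'m \<Rightarrow> bool" where
  "strict_complementarity D p \<longleftrightarrow> (\<forall>k\<in>active D p. p $ k > 0)"

definition licq :: "('v, 'm::finite) nlp \<Rightarrow> real^'m \<Rightarrow> bool" where
  "licq D p \<longleftrightarrow>
     (let S = coords D EqMult \<union> active D p
      in rank (constraint_gradients D p (coords D Primal) S) = card S)"

definition uniform_sosc :: "('v::finite, 'm::finite) nlp \<Rightarrow> real^'m \<Rightarrow> bool" where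
  "uniform_sosc D p \<longleftrightarrow> pos_def_on (coords D Primal) (hessian (lagrangian D) p)"

definition local_convexity :: "('v, 'm::finite) nlp \<Rightarrow> ('v \<Rightarrow> real) \<Rightarrow> real^'m \<Rightarrow> bool" where
  "local_convexity D \<rho> p \<longleftrightarrow>
     (\<forall>i. \<rho> i \<ge> 0 \<and>
        pos_def_on (coords_of D Primal i) (hessian (local_lagrangian D i) p + \<rho> i *\<^sub>R mat 1))"

definition constraint_compatible :: "('v, 'm::finite) nlp \<Rightarrow> real^'m \<Rightarrow> bool" where
  "constraint_compatible D p \<longleftrightarrow>
     (\<forall>i. let S = coords_of D EqMult i \<union> (coords_of D IneqMult i \<inter> active D p)
          in rank (constraint_gradients D p (coords_of D Primal i) S) = card S)"

subsection \<open>Local problems\<close>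

text \<open>\<open>shift D i p y\<close> replaces $x_i$ by $x_i + s_i$ and keeps everything else.\<close>

definition shift :: "('v, 'm::finite) nlp \<Rightarrow> 'v \<Rightarrow> real^'m \<Rightarrow> real^'m \<Rightarrow> real^'m" where
  "shift D i p y = (\<chi> k. if k \<in> coords_of D Primal i then p $ k + y $ k else p $ k)"

definition bar_cost ::
    "('v, 'm::finite) nlp \<Rightarrow> ('v \<Rightarrow> real) \<Rightarrow> 'v \<Rightarrow> real^'m \<Rightarrow> real^'m \<Rightarrow> real" where
  "bar_cost D \<rho> i p y = cost D i (shift D i p y)
     + \<rho> i / 2 * (\<Sum>k\<in>coords_of D Primal i. (y $ k)\<^sup>2)
     + (\<Sum>j\<in>neighbors D i. \<Sum>k\<in>coords_of D Primal i. partial k (local_lagrangian D j) p * y $ k)"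

definition bar_con :: "('v, 'm::finite) nlp \<Rightarrow> 'm \<Rightarrow> real^'m \<Rightarrow> real^'m \<Rightarrow> real" where
  "bar_con D k p y = con D k (shift D (owner D k) p y)"

definition bar_lagrangian ::
    "('v, 'm::finite) nlp \<Rightarrow> ('v \<Rightarrow> real) \<Rightarrow> 'v \<Rightarrow> real^'m \<Rightarrow> real^'m \<Rightarrow> real" where
  "bar_lagrangian D \<rho> i p y = bar_cost D \<rho> i p y
     + (\<Sum>k\<in>coords_of D EqMult i. y $ k * bar_con D k p y)
     + (\<Sum>k\<in>coords_of D IneqMult i. y $ k * bar_con D k p y)"

definition local_kkt ::
    "('v, 'm::finite) nlp \<Rightarrow> ('v \<Rightarrow> real) \<Rightarrow> 'v \<Rightarrow> real^'m \<Rightarrow> real^'m \<Rightarrow> bool" where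
  "local_kkt D \<rho> i p y \<longleftrightarrow>
     (\<forall>k\<in>coords_of D Primal i. partial k (bar_lagrangian D \<rho> i p) y = 0) \<and>
     (\<forall>k\<in>coords_of D EqMult i. bar_con D k p y = 0) \<and>
     (\<forall>k\<in>coords_of D IneqMult i.
        bar_con D k p y \<le> 0 \<and> y $ k \<ge> 0 \<and> y $ k * bar_con D k p y = 0)"

definition dual_part :: "('v, 'm::finite) nlp \<Rightarrow> real^'m \<Rightarrow> real^'m" where
  "dual_part D p = (\<chi> k. if kind_of D k = Primal then 0 else p $ k)"

text \<open>
  The map $\Phi$ is determined only near $p^*$: there \<open>\<Phi> p\<close> is the only solution of all local KKT
  systems near $(0,\lambda^*,\mu^*)$.  Any two such maps agree on a neighborhood of $p^*$,
  so \<open>\<Phi>\<close> may be taken to be an arbitrary one of them.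
\<close>

definition locally_unique_solution_map ::
    "('v, 'm::finite) nlp \<Rightarrow> ('v \<Rightarrow> real) \<Rightarrow> real^'m \<Rightarrow> (real^'m \<Rightarrow> real^'m) \<Rightarrow> bool" where
  "locally_unique_solution_map D \<rho> ps \<Phi> \<longleftrightarrow>
     \<Phi> ps = dual_part D ps \<and>
     (\<exists>\<delta>>0. \<exists>\<epsilon>>0. \<forall>p\<in>ball ps \<delta>.
        \<Phi> p \<in> ball (dual_part D ps) \<epsilon> \<and> (\<forall>i. local_kkt D \<rho> i p (\<Phi> p)) \<and>
        (\<forall>y\<in>ball (dual_part D ps) \<epsilon>. (\<forall>i. local_kkt D \<rho> i p y) \<longrightarrow> y = \<Phi> p))"

definition solution_map ::
    "('v, 'm::finite) nlp \<Rightarrow> ('v \<Rightarrow> real) \<Rightarrow> real^'m \<Rightarrow> real^'m \<Rightarrow> real^'m" where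
  "solution_map D \<rho> ps = (SOME \<Phi>. locally_unique_solution_map D \<rho> ps \<Phi>)"

subsection \<open>The algorithm\<close>

text \<open>The block-diagonal matrix with blocks $P_i(y_i)$, where \<open>k\<close> is the row index.\<close>

definition P_matrix ::
    "('v, 'm::finite) nlp \<Rightarrow> ('v \<Rightarrow> real) \<Rightarrow> real \<Rightarrow> real^'m \<Rightarrow> real^'m \<Rightarrow> real^'m^'m" where
  "P_matrix D \<rho> \<beta> p y = (\<chi> k l.
     if owner D k \<noteq> owner D l then 0
     else case (kind_of D k, kind_of D l) of
       (Primal, Primal) \<Rightarrow> hessian (bar_lagrangian D \<rho> (owner D k) p) y $ k $ l
     | (Primal, _) \<Rightarrow> partial k (bar_con D l p) y
     | (EqMult, Primal) \<Rightarrow> - \<beta> * partial l (bar_con D k p) y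
     | (IneqMult, Primal) \<Rightarrow> - \<beta> * y $ k * partial l (bar_con D k p) y
     | (IneqMult, IneqMult) \<Rightarrow> if k = l then - \<beta> * bar_con D k p y else 0
     | _ \<Rightarrow> 0)"

definition sbdp_step ::
    "('v, 'm::finite) nlp \<Rightarrow> ('v \<Rightarrow> real) \<Rightarrow> real \<Rightarrow> real \<Rightarrow> real^'m \<Rightarrow> real^'m \<Rightarrow> real^'m" where
  "sbdp_step D \<rho> \<beta> \<alpha> ps p =
     (let y = solution_map D \<rho> ps p
      in p + \<alpha> *\<^sub>R (P_matrix D \<rho> \<beta> p y *v (y - dual_part D p)))"

definition A_matrix ::
    "('v::finite, 'm::finite) nlp \<Rightarrow> real \<Rightarrow> real^'m \<Rightarrow> real^'m^'m" where
  "A_matrix D \<beta> p = (\<chi> k l.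
     case (kind_of D k, kind_of D l) of
       (Primal, Primal) \<Rightarrow> hessian (lagrangian D) p $ k $ l
     | (Primal, _) \<Rightarrow> partial k (con D l) p
     | (EqMult, Primal) \<Rightarrow> - \<beta> * partial l (con D k) p
     | (IneqMult, Primal) \<Rightarrow> - \<beta> * p $ k * partial l (con D k) p
     | (IneqMult, IneqMult) \<Rightarrow> if k = l then - \<beta> * con D k p else 0
     | _ \<Rightarrow> 0)"

end

theory Submission
  imports Defs
begin

text \<open>
  The local solution \<open>y\<close> differs from the starting guess \<open>d = dual_part D p\<close> by a Newton step
  for the local systems, up to second order; multiplying by the matrix \<open>P\<close> undoes the inverse in
  that step and leaves the residual of the central KKT system.  In detail, the local KKT systems are
  equations \<open>F p y = 0\<close> near the solution, with \<open>F = local_residual D \<rho> \<beta>\<close>: strict complementarity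
  fixes the signs there, so the inequalities take care of themselves
  (\<open>local_kkt_iff_residual_zero\<close>).  The rows of \<open>F\<close> carry the scaling by \<open>- \<beta>\<close> of the algorithm,
  so that \<open>P\<close> is the Jacobian of \<open>F p\<close> at the solution.  Expanding \<open>F p y = 0\<close> around \<open>d\<close>
  gives \<open>P (y - d) = - F p d\<close> up to second order.  But \<open>F p d\<close> is the residual \<open>G p\<close> of the
  central KKT system (\<open>local_residual_at_dual_part\<close>): the sensitivities that the agents exchange
  are exactly what the local gradients lack.  So no derivative of the solution map is needed, and
  \<open>T p = p - \<alpha> G p + \<alpha> O(|p - ps|\<^sup>2)\<close>, whose linear part is \<open>I - \<alpha> A\<close> because \<open>A\<close> is the
  derivative of \<open>G\<close> (\<open>sbdp_step_linearization\<close>).  The estimate \<open>|y - d| = O(|p - ps|)\<close> that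
  controls the error comes from a contraction argument (\<open>parametric_equation_locally_solvable\<close>).

  Both \<open>A\<close> and the Jacobian of the local systems are saddle-point matrices: positive definite in the
  primal block, skew up to a positive scaling in the coupling with the multipliers of equalities and
  active inequalities, and positive diagonal in the remaining multipliers.  Such a matrix \<open>S\<close> has a
  quadratic Lyapunov function \<open>W\<close> (\<open>saddle_matrix_lyapunov\<close>).  For \<open>A\<close> this makes \<open>I - \<alpha> A\<close> a
  contraction in the norm of \<open>W\<close> for all small \<open>\<alpha>\<close>; for the local Jacobian it gives invertibility.

  The rest is linear stability theory (\<open>locally_linear_iteration_converges\<close>).  Contraction margin
  and perturbation are both proportional to \<open>\<alpha>\<close>, so one ball works for all step sizes.  The norm of
  \<open>W\<close> also shows that the powers of \<open>I - \<alpha> A\<close> vanish, which makes the discrete Lyapunov equation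
  solvable for each \<open>Q\<close>.
\<close>

section \<open>Quadratic forms\<close>

lemma sqrt_quadratic_triangle: fixes a b c :: real
  assumes "b\<^sup>2 \<le> a * c" "0 \<le> a" "0 \<le> c"
  shows "sqrt (a + 2 * b + c) \<le> sqrt a + sqrt c"
proof (rule real_le_lsqrt)
  have "\<bar>b\<bar> \<le> sqrt (a * c)" using assms(1) real_le_rsqrt[of "\<bar>b\<bar>" "a*c"] by simp
  then have "b \<le> sqrt a * sqrt c" by (simp add: real_sqrt_mult)
  then show "a + 2 * b + c \<le> (sqrt a + sqrt c)\<^sup>2"
    using assms by (simp add: power2_sum)
  show "0 \<le> sqrt a + sqrt c" using assms by simp
qed

lemma inner_matrix_symmetric:
  fixes P :: "real^'m^'m"
  assumes "\<And>k l. P $ k $ l = P $ l $ k"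
  shows "u \<bullet> (P *v v) = v \<bullet> (P *v u)"
proof -
  have "transpose P = P" using assms by (simp add: transpose_def vec_eq_iff)
  then show ?thesis by (metis dot_lmul_matrix inner_commute transpose_matrix_vector)
qed

lemma matrix_mult_add_left:
  fixes A B :: "real^'n^'m"
  shows "(A + B) ** C = A ** C + B ** C"
  by (simp add: vec_eq_iff matrix_matrix_mult_def distrib_right sum.distrib)

lemma pos_def_symmetric: "pos_def P \<Longrightarrow> P $ k $ l = P $ l $ k"
  by (simp add: pos_def_on_def)

lemma pos_def_pos: "pos_def P \<Longrightarrow> v \<noteq> 0 \<Longrightarrow> v \<bullet> (P *v v) > 0"
  by (simp add: pos_def_on_def)

lemma pos_def_nonneg: "pos_def P \<Longrightarrow> v \<bullet> (P *v v) \<ge> 0"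
  by (cases "v = 0") (auto dest: pos_def_pos[of P v])

lemma pos_defI:
  assumes "\<And>k l. P $ k $ l = P $ l $ k" "\<And>v. v \<noteq> 0 \<Longrightarrow> v \<bullet> (P *v v) > 0"
  shows "pos_def P"
  using assms by (auto simp: pos_def_on_def)

lemma wnorm_nonneg: "pos_def P \<Longrightarrow> wnorm P v \<ge> 0"
  by (simp add: wnorm_def pos_def_nonneg)

lemma wnorm_pos: "pos_def P \<Longrightarrow> v \<noteq> 0 \<Longrightarrow> wnorm P v > 0"
  by (simp add: wnorm_def pos_def_pos)

lemma pos_def_Cauchy_Schwarz:
  assumes P: "pos_def P"
  shows "(u \<bullet> (P *v v))\<^sup>2 \<le> (u \<bullet> (P *v u)) * (v \<bullet> (P *v v))"
proof (cases "v = 0")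
  case False
  let ?a = "v \<bullet> (P *v v)" and ?b = "u \<bullet> (P *v v)" and ?c = "u \<bullet> (P *v u)"
  have a: "?a > 0" using pos_def_pos[OF P False] .
  have sym: "v \<bullet> (P *v u) = ?b" by (rule inner_matrix_symmetric) (rule pos_def_symmetric[OF P])
  let ?w = "?a *\<^sub>R u - ?b *\<^sub>R v"
  have "0 \<le> ?w \<bullet> (P *v ?w)" by (rule pos_def_nonneg[OF P])
  also have "\<dots> = ?a * (?a * ?c - ?b\<^sup>2)"
    by (simp add: matrix_vector_mult_diff_distrib matrix_vector_mult_scaleR inner_diff_left
        inner_diff_right sym power2_eq_square algebra_simps)
  finally show ?thesis using a by (simp add: zero_le_mult_iff mult.commute)
qed simp

lemma wnorm_triangle:
  assumes P: "pos_def P"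
  shows "wnorm P (u + v) \<le> wnorm P u + wnorm P v"
proof -
  have sym: "v \<bullet> (P *v u) = u \<bullet> (P *v v)"
    by (rule inner_matrix_symmetric) (rule pos_def_symmetric[OF P])
  have "wnorm P (u + v) = sqrt (u \<bullet> (P *v u) + 2 * (u \<bullet> (P *v v)) + v \<bullet> (P *v v))"
    by (simp add: wnorm_def matrix_vector_right_distrib inner_add_left inner_add_right sym)
  also have "\<dots> \<le> wnorm P u + wnorm P v"
    unfolding wnorm_def by (rule sqrt_quadratic_triangle)
      (use pos_def_Cauchy_Schwarz[OF P] pos_def_nonneg[OF P] in auto)
  finally show ?thesis .
qed

lemma continuous_on_quadratic_form: "continuous_on S (\<lambda>v. v \<bullet> (A *v v))"
  for A :: "real^'m^'m"
  by (intro continuous_intros linear_continuous_on matrix_vector_mul_bounded_linear)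

lemma quadratic_form_scaleR: "(c *\<^sub>R v) \<bullet> (A *v (c *\<^sub>R v)) = c\<^sup>2 * (v \<bullet> (A *v v))"
  for A :: "real^'m^'m"
  by (simp add: matrix_vector_mult_scaleR power2_eq_square)

lemma positive_form_lower_bound:
  fixes A :: "real^'m^'m"
  assumes "\<And>v. v \<noteq> 0 \<Longrightarrow> v \<bullet> (A *v v) > 0"
  shows "\<exists>c>0. \<forall>v. c * (norm v)\<^sup>2 \<le> v \<bullet> (A *v v)"
proof -
  let ?S = "sphere (0::real^'m) 1"
  have "compact ?S" "?S \<noteq> {}" by auto
  then obtain w where w: "w \<in> ?S" "\<And>v. v \<in> ?S \<Longrightarrow> w \<bullet> (A *v w) \<le> v \<bullet> (A *v v)"
    using continuous_attains_inf[OF _ _ continuous_on_quadratic_form] by metis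
  have "w \<bullet> (A *v w) * (norm v)\<^sup>2 \<le> v \<bullet> (A *v v)" for v
  proof (cases "v = 0")
    case False
    have "w \<bullet> (A *v w) \<le> ((1 / norm v) *\<^sub>R v) \<bullet> (A *v ((1 / norm v) *\<^sub>R v))"
      by (rule w(2)) (use False in simp)
    then show ?thesis
      unfolding quadratic_form_scaleR using False by (simp add: field_simps)
  qed simp
  moreover have "w \<bullet> (A *v w) > 0" using w(1) by (intro assms) auto
  ultimately show ?thesis by blast
qed

lemma quadratic_form_upper_bound:
  fixes A :: "real^'m^'m"
  shows "\<exists>c>0. \<forall>v. v \<bullet> (A *v v) \<le> c * (norm v)\<^sup>2"
proof -
  obtain K where K: "K > 0" "\<And>v. norm (A *v v) \<le> norm v * K"
    using bounded_linear.pos_bounded[OF matrix_vector_mul_bounded_linear[of A]] by blast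
  have "v \<bullet> (A *v v) \<le> K * (norm v)\<^sup>2" for v
    using Cauchy_Schwarz_ineq2[of v "A *v v"] mult_left_mono[OF K(2), of "norm v" v]
    by (simp add: power2_eq_square algebra_simps)
  with K(1) show ?thesis by blast
qed

lemma wnorm_equivalent_norm:
  assumes P: "pos_def P"
  shows "\<exists>a>0. \<exists>b>0. \<forall>v. a * norm v \<le> wnorm P v \<and> wnorm P v \<le> b * norm v"
proof -
  obtain a where a: "a > 0" "\<And>v. a * (norm v)\<^sup>2 \<le> v \<bullet> (P *v v)"
    using positive_form_lower_bound[OF pos_def_pos[OF P]] by metis
  obtain b where b: "b > 0" "\<And>v. v \<bullet> (P *v v) \<le> b * (norm v)\<^sup>2"
    using quadratic_form_upper_bound[of P] by metis
  have "sqrt a * norm v \<le> wnorm P v \<and> wnorm P v \<le> sqrt b * norm v" for v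
    using real_sqrt_le_mono[OF a(2)[of v]] real_sqrt_le_mono[OF b(2)[of v]]
    by (simp add: wnorm_def real_sqrt_mult)
  with a(1) b(1) show ?thesis by (metis real_sqrt_gt_zero)
qed

text \<open>
  On the compact set where the second function is not positive the first one has a positive
  minimum, which a small multiple of the second function cannot cancel.  This is how a
  semidefinite form is made definite by a small correction (a lemma of Finsler).
\<close>

lemma positive_perturbation_compact:
  fixes f g :: "'a::topological_space \<Rightarrow> real"
  assumes S: "compact S" and f: "continuous_on S f" and g: "continuous_on S g"
    and nonneg: "\<And>v. v \<in> S \<Longrightarrow> f v \<ge> 0" and pos: "\<And>v. v \<in> S \<Longrightarrow> f v = 0 \<Longrightarrow> g v > 0"
  shows "\<exists>e0>0. \<forall>e. 0 < e \<and> e \<le> e0 \<longrightarrow> (\<forall>v\<in>S. f v + e * g v > 0)"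
proof -
  let ?Z = "S \<inter> g -` {..0}"
  have Z: "compact ?Z"
    by (rule closedin_compact[OF S continuous_closedin_preimage[OF g]]) simp
  obtain m where m: "m > 0" "\<And>v. v \<in> ?Z \<Longrightarrow> m \<le> f v"
  proof (cases "?Z = {}")
    case False
    obtain w where w: "w \<in> ?Z" "\<And>v. v \<in> ?Z \<Longrightarrow> f w \<le> f v"
      using continuous_attains_inf[OF Z False continuous_on_subset[OF f]] by blast
    have "f w > 0" using nonneg[of w] pos[of w] w(1) by force
    then show ?thesis using that w(2) by blast
  qed (use that[of 1] in auto)
  obtain B where B: "B > 0" "\<And>v. v \<in> S \<Longrightarrow> \<bar>g v\<bar> \<le> B"
    using compact_imp_bounded[OF compact_continuous_image[OF g S]]
    unfolding bounded_pos by (auto simp: real_norm_def)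
  have "f v + e * g v > 0" if e: "0 < e" "e \<le> m / (2 * B)" and v: "v \<in> S" for e v
  proof (cases "g v \<le> 0")
    case True
    have "e * \<bar>g v\<bar> \<le> m / (2 * B) * B" using e B(1) B(2)[OF v] by (intro mult_mono) auto
    also have "\<dots> = m / 2" using B(1) by simp
    finally have "e * g v \<ge> - (m / 2)" using True by (simp add: abs_if split: if_splits)
    moreover have "m \<le> f v" using m(2)[of v] True v by simp
    ultimately show ?thesis using m(1) by linarith
  next
    case False
    then show ?thesis using nonneg[OF v] e(1) by (simp add: add_nonneg_pos)
  qed
  moreover have "m / (2 * B) > 0" using m(1) B(1) by simp
  ultimately show ?thesis by blast
qed

text \<open>
  By homogeneity the form only matters on the unit sphere, which turns the previous lemma into one
  about quadratic forms on a coordinate subspace.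
\<close>

lemma positive_form_perturbation:
  fixes A B :: "real^'m^'m"
  assumes nonneg: "\<And>v. (\<And>k. k \<in> I \<Longrightarrow> v $ k = 0) \<Longrightarrow> v \<bullet> (A *v v) \<ge> 0"
    and pos: "\<And>v. (\<And>k. k \<in> I \<Longrightarrow> v $ k = 0) \<Longrightarrow> v \<noteq> 0 \<Longrightarrow> v \<bullet> (A *v v) = 0
        \<Longrightarrow> v \<bullet> (B *v v) > 0"
  shows "\<exists>e0>0. \<forall>e. 0 < e \<and> e \<le> e0 \<longrightarrow>
    (\<forall>v. v \<noteq> 0 \<longrightarrow> (\<forall>k\<in>I. v $ k = 0) \<longrightarrow> v \<bullet> ((A + e *\<^sub>R B) *v v) > 0)"
proof -
  let ?S = "sphere (0::real^'m) 1 \<inter> (\<Inter>k\<in>I. {v. v $ k = 0})"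
  have "closed (\<Inter>k\<in>I. {v::real^'m. v $ k = 0})"
    by (intro closed_INT ballI closed_Collect_eq continuous_intros)
  then have S: "compact ?S" by (intro compact_Int_closed) auto
  obtain e0 where e0: "e0 > 0"
    "\<And>e v. 0 < e \<Longrightarrow> e \<le> e0 \<Longrightarrow> v \<in> ?S \<Longrightarrow> v \<bullet> (A *v v) + e * (v \<bullet> (B *v v)) > 0"
  proof -
    have "\<exists>e0>0. \<forall>e. 0 < e \<and> e \<le> e0 \<longrightarrow> (\<forall>v\<in>?S. v \<bullet> (A *v v) + e * (v \<bullet> (B *v v)) > 0)"
      by (rule positive_perturbation_compact[OF S])
        (auto intro!: continuous_on_quadratic_form nonneg pos)
    then show thesis using that by blast
  qed
  have "v \<bullet> ((A + e *\<^sub>R B) *v v) > 0"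
    if e: "0 < e" "e \<le> e0" and v: "v \<noteq> 0" "\<forall>k\<in>I. v $ k = 0" for e v
  proof -
    have split: "(A + e *\<^sub>R B) *v w = A *v w + e *\<^sub>R (B *v w)" for w
      by (simp add: matrix_vector_mult_add_rdistrib scaleR_matrix_vector_assoc)
    let ?w = "(1 / norm v) *\<^sub>R v"
    have "?w \<bullet> (A *v ?w) + e * (?w \<bullet> (B *v ?w)) > 0"
      by (rule e0(2)) (use e v in auto)
    then have "(1 / norm v)\<^sup>2 * (v \<bullet> (A *v v) + e * (v \<bullet> (B *v v))) > 0"
      unfolding quadratic_form_scaleR by (simp add: algebra_simps)
    then show ?thesis by (simp add: split inner_add_right zero_less_mult_iff)
  qed
  with e0(1) show ?thesis by blast
qed

section \<open>Saddle-point matrices\<close>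

text \<open>
  The columns outside \<open>S\<close> are padding, so the \<open>card S\<close> others span a space of that dimension and
  must be distinct and independent.
\<close>

lemma full_column_rank_injective:
  fixes C :: "real^'m^'m"
  assumes zero: "\<And>l k. k \<notin> S \<Longrightarrow> C $ l $ k = 0" and rank: "rank C = card S"
    and v: "\<And>k. k \<notin> S \<Longrightarrow> v $ k = 0" and Cv: "C *v v = 0"
  shows "v = 0"
proof -
  let ?B = "(\<lambda>k. column k C) ` S"
  have "column k C \<in> span ?B" for k
  proof (cases "k \<in> S")
    case False
    then have "column k C = 0" by (simp add: column_def vec_eq_iff zero)
    then show ?thesis by (simp add: span_zero)
  qed (simp add: span_base)
  then have sub: "columns C \<subseteq> span ?B" by (auto simp: columns_def)
  have "card S = dim (columns C)" using rank by (simp add: column_rank_def)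
  also have "\<dots> \<le> dim ?B" using sub by (metis dim_span dim_subset)
  finally have le: "card S \<le> dim ?B" .
  have "card S \<le> card ?B" using le dim_le_card'[of ?B] by simp
  then have inj: "inj_on (\<lambda>k. column k C) S"
    by (intro eq_card_imp_inj_on) (auto intro: antisym[OF card_image_le])
  have ind: "independent ?B"
    by (rule card_le_dim_spanning[of ?B ?B])
      (use le card_image_le[of S "\<lambda>k. column k C"] in \<open>auto intro: span_base\<close>)
  have "0 = (\<Sum>k\<in>UNIV. v $ k *\<^sub>R column k C)"
    using Cv by (simp add: matrix_mult_sum scalar_mult_eq_scaleR)
  also have "\<dots> = (\<Sum>k\<in>S. v $ k *\<^sub>R column k C)"
    by (rule sum.mono_neutral_right) (auto simp: v)
  also have "\<dots> = (\<Sum>b\<in>?B. v $ the_inv_into S (\<lambda>k. column k C) b *\<^sub>R b)"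
    by (subst sum.reindex[OF inj]) (simp add: the_inv_into_f_f[OF inj])
  finally have "v $ the_inv_into S (\<lambda>k. column k C) b = 0" if "b \<in> ?B" for b
    using independentD[OF ind, of ?B "\<lambda>b. v $ the_inv_into S (\<lambda>k. column k C) b" b] that by simp
  then have "v $ k = 0" if "k \<in> S" for k
    using that by (metis image_eqI inj the_inv_into_f_f)
  with v show ?thesis by (auto simp: vec_eq_iff)
qed

lemma inner_matrix_sum:
  fixes S :: "real^'m^'m"
  shows "u \<bullet> (S *v v) = (\<Sum>k\<in>UNIV. \<Sum>l\<in>UNIV. u $ k * S $ k $ l * v $ l)"
  by (simp add: inner_vec_def matrix_vector_mult_def sum_distrib_left mult.assoc)

text \<open>
  Here \<open>X\<close> holds the primal coordinates, \<open>E\<close> the multipliers coupled to them, and the rest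
  decays on its own.  The Lyapunov function is built in three layers, each making up for the
  degeneracy of the one before.  A weight on the decoupled coordinates controls these alone.  The
  diagonal weights \<open>1 / \<tau>\<close> make the coupling skew, so that what they leave is the positive primal
  block.  Finally a small cross term \<open>T\<close> between primal and dual coordinates sees the multipliers
  through the injective coupling.
\<close>

lemma saddle_matrix_lyapunov:
  fixes S :: "real^'m^'m"
  assumes disj: "X \<inter> E = {}"
    and lower: "\<And>k l. k \<notin> X \<Longrightarrow> l \<in> X \<Longrightarrow> S $ k $ l = - \<tau> k * S $ l $ k"
    and diag: "\<And>k l. k \<notin> X \<Longrightarrow> l \<notin> X \<Longrightarrow> k \<noteq> l \<Longrightarrow> S $ k $ l = 0"
    and E: "\<And>k. k \<in> E \<Longrightarrow> \<tau> k > 0 \<and> S $ k $ k = 0"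
    and I: "\<And>k. k \<notin> X \<Longrightarrow> k \<notin> E \<Longrightarrow> \<tau> k = 0 \<and> S $ k $ k > 0"
    and pos: "\<And>v. v \<noteq> 0 \<Longrightarrow> (\<And>k. k \<notin> X \<Longrightarrow> v $ k = 0) \<Longrightarrow> v \<bullet> (S *v v) > 0"
    and inj: "\<And>v. (\<And>k. k \<notin> E \<Longrightarrow> v $ k = 0) \<Longrightarrow> (\<And>k. k \<in> X \<Longrightarrow> (S *v v) $ k = 0) \<Longrightarrow> v = 0"
  shows "\<exists>W. pos_def W \<and> (\<forall>v. v \<noteq> 0 \<longrightarrow> v \<bullet> (W *v (S *v v)) > 0)"
proof -
  define I where "I = - (X \<union> E)"
  define w where "w k = (if k \<in> E then 1 / \<tau> k else 1)" for k
  define D1 :: "real^'m^'m" where "D1 = (\<chi> k l. if k = l then of_bool (k \<in> I) else 0)"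
  define D2 :: "real^'m^'m" where "D2 = (\<chi> k l. if k = l then w k else 0)"
  define T :: "real^'m^'m" where
    "T = (\<chi> k l. if k \<in> X \<and> l \<in> E then S $ k $ l else if k \<in> E \<and> l \<in> X then S $ l $ k else 0)"
  have w_pos: "w k > 0" for k using E by (simp add: w_def)
  have D1: "(D1 *v u) $ k = of_bool (k \<in> I) * u $ k" for u k
    by (simp add: D1_def matrix_vector_mult_def mult_delta_left)
  have D2: "(D2 *v u) $ k = w k * u $ k" for u k
    by (simp add: D2_def matrix_vector_mult_def mult_delta_left)
  have S_I: "(S *v v) $ k = S $ k $ k * v $ k" if "k \<in> I" for v k
  proof -
    have "(\<Sum>l\<in>UNIV. S $ k $ l * v $ l) = (\<Sum>l\<in>UNIV. if k = l then S $ k $ k * v $ k else 0)"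
      using lower[of k] diag[of k] I[of k] that by (intro sum.cong) (auto simp: I_def)
    then show ?thesis by (simp add: matrix_vector_mult_def)
  qed
  have q1: "v \<bullet> (D1 *v (S *v v)) = (\<Sum>k\<in>I. S $ k $ k * (v $ k)\<^sup>2)" for v
  proof -
    have "v \<bullet> (D1 *v (S *v v)) = (\<Sum>k\<in>UNIV. if k \<in> I then S $ k $ k * (v $ k)\<^sup>2 else 0)"
      by (auto simp: inner_vec_def D1 S_I power2_eq_square intro!: sum.cong)
    then show ?thesis by (simp add: sum.If_cases)
  qed
  have SI_pos: "S $ k $ k > 0" if "k \<in> I" for k using I[of k] that by (auto simp: I_def)
  have q1_nonneg: "v \<bullet> (D1 *v (S *v v)) \<ge> 0" for v
    unfolding q1 by (intro sum_nonneg) (simp add: SI_pos less_imp_le)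
  have q1_zero: "v $ k = 0" if "v \<bullet> (D1 *v (S *v v)) = 0" "k \<in> I" for v k
  proof -
    have "\<forall>k\<in>I. S $ k $ k * (v $ k)\<^sup>2 = 0"
      using that(1) unfolding q1
      by (subst (asm) sum_nonneg_eq_0_iff) (auto simp: SI_pos less_imp_le)
    then show ?thesis using SI_pos[OF that(2)] that(2) by auto
  qed
  define px :: "real^'m \<Rightarrow> real^'m" where "px v = (\<chi> k. if k \<in> X then v $ k else 0)" for v
  \<comment> \<open>With the weights of \<open>D2\<close> the coupling of primal and dual coordinates is skew.\<close>
  have q2: "v \<bullet> (D2 *v (S *v v)) = px v \<bullet> (S *v px v)" if v: "\<And>k. k \<in> I \<Longrightarrow> v $ k = 0" for v
  proof -
    define c where "c k l = w k * v $ k * S $ k $ l * v $ l" for k l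
    have dbl: "v \<bullet> (D2 *v (S *v v)) = (\<Sum>k\<in>UNIV. \<Sum>l\<in>UNIV. c k l)"
      unfolding inner_vec_def D2
      by (simp add: matrix_vector_mult_def sum_distrib_left c_def ac_simps)
    define d where "d k l = px v $ k * S $ k $ l * px v $ l" for k l
    have sym: "c k l + c l k = d k l + d l k" for k l
    proof -
      consider "k \<in> I" | "l \<in> I" | "k \<in> X" "l \<in> X" | "k \<in> X" "l \<in> E" | "k \<in> E" "l \<in> X"
        | "k \<in> E" "l \<in> E" by (auto simp: I_def)
      then show ?thesis
      proof cases
        case 3
        then show ?thesis using disj by (auto simp: c_def d_def w_def px_def algebra_simps)
      next
        case 4
        then show ?thesis using disj lower[of l k] E[of l]
          by (auto simp: c_def d_def w_def px_def)
      next
        case 5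
        then show ?thesis using disj lower[of k l] E[of k]
          by (auto simp: c_def d_def w_def px_def)
      next
        case 6
        then show ?thesis using disj diag[of k l] diag[of l k] E[of k]
          by (cases "k = l") (auto simp: c_def d_def px_def)
      qed (use disj v in \<open>auto simp: c_def d_def px_def I_def\<close>)
    qed
    have dbl_sum: "2 * (\<Sum>k\<in>UNIV. \<Sum>l\<in>UNIV. h k l) = (\<Sum>k\<in>UNIV. \<Sum>l\<in>UNIV. h k l + h l k)"
      for h :: "'m \<Rightarrow> 'm \<Rightarrow> real"
      by (simp add: sum.distrib) (rule sum.swap)
    have "(\<Sum>k\<in>UNIV. \<Sum>l\<in>UNIV. c k l) = (\<Sum>k\<in>UNIV. \<Sum>l\<in>UNIV. d k l)"
      using dbl_sum[of c] dbl_sum[of d] by (simp add: sym)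
    then show ?thesis using dbl by (simp add: inner_matrix_sum[of "px v"] d_def)
  qed
  have q2_nonneg: "v \<bullet> (D2 *v (S *v v)) \<ge> 0" if v: "\<And>k. k \<in> I \<Longrightarrow> v $ k = 0" for v
  proof (cases "px v = 0")
    case False
    then have "px v \<bullet> (S *v px v) > 0" by (rule pos) (simp add: px_def)
    then show ?thesis using q2[OF v] by simp
  qed (use q2[OF v] in simp)
  have T_sym: "T $ k $ l = T $ l $ k" for k l using disj by (auto simp: T_def)
  have q3: "v \<bullet> (T *v (S *v v)) > 0"
    if v: "\<And>k. k \<in> I \<Longrightarrow> v $ k = 0" "v \<noteq> 0" "v \<bullet> (D2 *v (S *v v)) = 0" for v
  proof -
    have "px v = 0"
    proof (rule ccontr)
      assume "px v \<noteq> 0"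
      then have "px v \<bullet> (S *v px v) > 0" by (rule pos) (simp add: px_def)
      then show False using q2[OF v(1)] v(3) by simp
    qed
    moreover have "px v $ k = v $ k" if "k \<in> X" for k using that by (simp add: px_def)
    ultimately have vX: "v $ k = 0" if "k \<in> X" for k using that by fastforce
    then have vE: "v $ k = 0" if "k \<notin> E" for k using that v(1) by (auto simp: I_def)
    have Sv: "(S *v v) $ k = 0" if "k \<notin> X" for k
    proof -
      have "S $ k $ l * v $ l = 0" for l
        using vE[of l] diag[of k l] E[of k] disj that by (cases "k = l") auto
      then have "(\<Sum>l\<in>UNIV. S $ k $ l * v $ l) = 0" by (intro sum.neutral) blast
      then show ?thesis by (simp add: matrix_vector_mult_def)
    qed
    have Tv: "(T *v v) $ k = (S *v v) $ k" if "k \<in> X" for k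
      unfolding matrix_vector_mult_def using that disj vE by (auto simp: T_def intro!: sum.cong)
    have "v \<bullet> (T *v (S *v v)) = (S *v v) \<bullet> (T *v v)"
      by (rule inner_matrix_symmetric) (rule T_sym)
    also have "\<dots> = (S *v v) \<bullet> (S *v v)"
      unfolding inner_vec_def by (intro sum.cong refl) (metis Sv Tv inner_zero_left)
    finally have *: "v \<bullet> (T *v (S *v v)) = (S *v v) \<bullet> (S *v v)" .
    have "S *v v \<noteq> 0" using inj[of v] vE v(2) by fastforce
    then show ?thesis unfolding * by simp
  qed
  have assoc: "v \<bullet> ((M ** S) *v v) = v \<bullet> (M *v (S *v v))" for M :: "real^'m^'m" and v
    by (simp add: matrix_vector_mul_assoc)
  obtain e1 where e1: "e1 > 0" "\<And>e v. 0 < e \<Longrightarrow> e \<le> e1 \<Longrightarrow> v \<noteq> 0 \<Longrightarrow> \<forall>k\<in>I. v $ k = 0 \<Longrightarrow>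
      v \<bullet> ((D2 ** S + e *\<^sub>R (T ** S)) *v v) > 0"
    using positive_form_perturbation[of I "D2 ** S" "T ** S"] q2_nonneg q3 unfolding assoc by blast
  have D2_pos: "v \<bullet> (D2 *v v) > 0" if "v \<noteq> 0" for v
  proof -
    obtain k where k: "v $ k \<noteq> 0" using \<open>v \<noteq> 0\<close> by (auto simp: vec_eq_iff)
    have "v \<bullet> (D2 *v v) = (\<Sum>k\<in>UNIV. w k * (v $ k)\<^sup>2)"
      by (simp add: inner_vec_def D2 power2_eq_square ac_simps)
    also have "\<dots> > 0"
      by (rule sum_pos2[of _ k]) (use k w_pos in \<open>auto simp: less_imp_le\<close>)
    finally show ?thesis .
  qed
  have D2_nonneg: "v \<bullet> (D2 *v v) \<ge> 0" for v
    using D2_pos[of v] by (cases "v = 0") auto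
  obtain e2 where e2: "e2 > 0" "\<And>e v. 0 < e \<Longrightarrow> e \<le> e2 \<Longrightarrow> v \<noteq> 0 \<Longrightarrow>
      v \<bullet> ((D2 + e *\<^sub>R T) *v v) > 0"
  proof -
    have "\<exists>e0>0. \<forall>e. 0 < e \<and> e \<le> e0 \<longrightarrow>
        (\<forall>v. v \<noteq> 0 \<longrightarrow> (\<forall>k\<in>{}. v $ k = 0) \<longrightarrow> v \<bullet> ((D2 + e *\<^sub>R T) *v v) > 0)"
      by (rule positive_form_perturbation[OF D2_nonneg]) (metis D2_pos less_irrefl)
    then show ?thesis using that by auto
  qed
  \<comment> \<open>small enough both for the layered decay and for positivity of the form itself\<close>
  define e where "e = min e1 e2"
  have e: "0 < e" "e \<le> e1" "e \<le> e2" using e1(1) e2(1) by (auto simp: e_def)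
  define V where "V = D2 + e *\<^sub>R T"
  have VS: "V ** S = D2 ** S + e *\<^sub>R (T ** S)"
    by (simp add: V_def matrix_mult_add_left scalar_matrix_assoc)
  have V_pos: "v \<bullet> (V *v v) > 0" if "v \<noteq> 0" for v
    unfolding V_def by (rule e2(2)[OF e(1,3) that])
  have VS_pos: "v \<bullet> (V *v (S *v v)) > 0" if "v \<noteq> 0" "v \<bullet> (D1 *v (S *v v)) = 0" for v
    using e1(2)[OF e(1,2) that(1)] q1_zero[OF that(2)] unfolding VS[symmetric] assoc by blast
  obtain e3 where e3: "e3 > 0"
    "\<And>v. v \<noteq> 0 \<Longrightarrow> v \<bullet> ((D1 ** S + e3 *\<^sub>R (V ** S)) *v v) > 0"
  proof -
    have "\<exists>e0>0. \<forall>e. 0 < e \<and> e \<le> e0 \<longrightarrow> (\<forall>v. v \<noteq> 0 \<longrightarrow> (\<forall>k\<in>{}. v $ k = 0) \<longrightarrow>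
        v \<bullet> ((D1 ** S + e *\<^sub>R (V ** S)) *v v) > 0)"
      by (rule positive_form_perturbation) (unfold assoc, rule q1_nonneg, rule VS_pos)
    then show ?thesis using that by auto
  qed
  define W where "W = D1 + e3 *\<^sub>R V"
  have "v \<bullet> (W *v v) > 0" if "v \<noteq> 0" for v
  proof -
    have "v \<bullet> (D1 *v v) \<ge> 0" by (simp add: inner_vec_def D1 sum_nonneg)
    moreover have "v \<bullet> (W *v v) = v \<bullet> (D1 *v v) + e3 * (v \<bullet> (V *v v))"
      by (simp add: W_def matrix_vector_mult_add_rdistrib inner_add_right
          flip: scaleR_matrix_vector_assoc)
    ultimately show ?thesis using V_pos[OF that] e3(1) by (simp add: add_nonneg_pos)
  qed
  then have "pos_def W"
    by (intro pos_defI) (auto simp: W_def V_def D1_def D2_def T_sym)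
  moreover have "W ** S = D1 ** S + e3 *\<^sub>R (V ** S)"
    by (simp add: W_def matrix_mult_add_left scalar_matrix_assoc)
  then have "v \<bullet> (W *v (S *v v)) > 0" if "v \<noteq> 0" for v
    using e3(2)[OF that] assoc[of v W] by simp
  ultimately show ?thesis by blast
qed

section \<open>Stability of the linearized iteration\<close>

lemma inner_transpose_conjugate:
  fixes N X :: "real^'m^'m"
  shows "u \<bullet> ((transpose N ** X ** N) *v v) = (N *v u) \<bullet> (X *v (N *v v))"
proof -
  have "u \<bullet> (transpose N *v w) = (N *v u) \<bullet> w" for w
    by (metis dot_lmul_matrix inner_commute transpose_matrix_vector)
  then show ?thesis by (simp flip: matrix_vector_mul_assoc)
qed

text \<open>
  Since the powers of \<open>N\<close> tend to \<open>0\<close>, the linear operator \<open>X \<mapsto> X - N\<^sup>T X N\<close> has trivial kernel, so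
  it is onto; its preimage of \<open>Q\<close> is symmetric by uniqueness, and positive because the form of
  \<open>P\<close> exceeds the form of \<open>Q\<close> by its values along the orbit of \<open>N\<close>, which vanish in the limit.
\<close>

lemma discrete_lyapunov_equation:
  fixes N Q :: "real^'m^'m"
  assumes W: "pos_def W" and c: "0 \<le> c" "c < 1"
    and contr: "\<And>v. wnorm W (N *v v) \<le> c * wnorm W v" and Q: "pos_def Q"
  shows "\<exists>P. pos_def P \<and> transpose N ** P ** N - P = - Q"
proof -
  define f where "f n v = (((*v) N) ^^ n) v" for n v
  have f_Suc: "f (Suc n) v = N *v f n v" and f_0: "f 0 v = v" for n v by (auto simp: f_def)
  obtain a where a: "a > 0" "\<And>v. a * norm v \<le> wnorm W v"
    using wnorm_equivalent_norm[OF W] by blast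
  have f_lim: "(\<lambda>n. f n v) \<longlonglongrightarrow> 0" for v
  proof -
    have f_bound: "wnorm W (f n v) \<le> c ^ n * wnorm W v" for n
    proof (induction n)
      case (Suc n)
      show ?case
        using contr[of "f n v"] mult_left_mono[OF Suc.IH c(1)] by (simp add: f_Suc mult.assoc)
    qed (simp add: f_0)
    have "norm (f n v) \<le> c ^ n * (wnorm W v / a)" for n
      using a(2)[of "f n v"] f_bound[of n] a(1) by (simp add: field_simps)
    moreover have "(\<lambda>n. c ^ n * (wnorm W v / a)) \<longlonglongrightarrow> 0"
      using tendsto_mult_left_zero[OF LIMSEQ_realpow_zero[OF c]] .
    ultimately show ?thesis
      by (rule Lim_null_comparison[OF always_eventually[OF allI]])
  qed
  have form_lim: "(\<lambda>n. f n u \<bullet> (X *v f n v)) \<longlonglongrightarrow> 0" for X :: "real^'m^'m" and u v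
  proof -
    have "(\<lambda>n. X *v f n v) \<longlonglongrightarrow> X *v 0"
      by (rule bounded_linear.tendsto[OF matrix_vector_mul_bounded_linear f_lim])
    from tendsto_inner[OF f_lim this] show ?thesis by simp
  qed
  let ?F = "\<lambda>X. X - transpose N ** X ** N"
  have lin: "linear ?F"
    by (rule linearI)
      (simp_all add: matrix_add_ldistrib matrix_mult_add_left matrix_scalar_ac
        scaleR_diff_right flip: scalar_matrix_assoc)
  have inj0: "X = 0" if "?F X = 0" for X
  proof -
    have "transpose N ** X ** N = X" using that by simp
    then have step: "(N *v u) \<bullet> (X *v (N *v v)) = u \<bullet> (X *v v)" for u v
      using inner_transpose_conjugate[of u N X v] by simp
    have "f n u \<bullet> (X *v f n v) = u \<bullet> (X *v v)" for n u v
      by (induction n) (simp_all add: f_0 f_Suc step)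
    then have zero: "u \<bullet> (X *v v) = 0" for u v
      using form_lim[of u X v] by (simp add: LIMSEQ_const_iff)
    have "X *v v = 0" for v using zero[of "X *v v" v] by simp
    then show ?thesis by (subst matrix_eq) simp
  qed
  then have "inj ?F" using linear_injective_0[OF lin] by blast
  then have "surj ?F" using linear_injective_imp_surjective[OF lin] by simp
  from surjD[OF this, of Q] obtain P where P: "Q = ?F P" by blast
  have "transpose (transpose N ** P ** N) = transpose N ** transpose P ** N"
    by (simp add: matrix_transpose_mul matrix_mul_assoc)
  moreover have "transpose Q = Q"
    using pos_def_symmetric[OF Q] by (simp add: transpose_def vec_eq_iff)
  moreover have "transpose (X - Y) = transpose X - transpose Y" for X Y :: "real^'m^'m"
    by (simp add: transpose_def vec_eq_iff)
  ultimately have "?F (transpose P) = Q" unfolding P by simp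
  then have "?F (transpose P - P) = 0" using P linear_diff[OF lin, of "transpose P" P] by simp
  then have "transpose P = P" using inj0 by fastforce
  then have sym: "P $ k $ l = P $ l $ k" for k l by (metis transpose_def vec_lambda_beta)
  have step: "v \<bullet> (P *v v) = v \<bullet> (Q *v v) + (N *v v) \<bullet> (P *v (N *v v))" for v
  proof -
    have "P = Q + transpose N ** P ** N" using P by simp
    then have "v \<bullet> (P *v v) = v \<bullet> ((Q + transpose N ** P ** N) *v v)" by simp
    then show ?thesis
      by (simp add: matrix_vector_mult_add_rdistrib inner_add_right inner_transpose_conjugate)
  qed
  have pos: "v \<bullet> (P *v v) > 0" if "v \<noteq> 0" for v
  proof -
    have "v \<bullet> (Q *v v) + f (Suc n) v \<bullet> (P *v f (Suc n) v) \<le> v \<bullet> (P *v v)" for n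
    proof (induction n)
      case (Suc n)
      then show ?case
        using step[of "f (Suc n) v"] pos_def_nonneg[OF Q, of "f (Suc n) v"]
        by (simp add: f_Suc[of "Suc n"])
    qed (use step[of v] in \<open>simp add: f_0 f_Suc\<close>)
    moreover have "(\<lambda>n. v \<bullet> (Q *v v) + f (Suc n) v \<bullet> (P *v f (Suc n) v))
        \<longlonglongrightarrow> v \<bullet> (Q *v v) + 0"
      by (intro tendsto_add tendsto_const LIMSEQ_Suc form_lim)
    ultimately have "v \<bullet> (Q *v v) + 0 \<le> v \<bullet> (P *v v)"
      by (intro LIMSEQ_le_const2) auto
    then show ?thesis using pos_def_pos[OF Q that] by simp
  qed
  have "pos_def P" by (rule pos_defI[OF sym pos])
  moreover have "transpose N ** P ** N - P = - Q" using P by simp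
  ultimately show ?thesis by blast
qed

text \<open>
  Along a step the form of \<open>P\<close> drops by that of \<open>Q\<close>, hence by a fixed fraction of itself.
\<close>

lemma lyapunov_solution_contracts:
  fixes N P Q :: "real^'m^'m"
  assumes P: "pos_def P" and Q: "pos_def Q" and eq: "transpose N ** P ** N - P = - Q"
  shows "\<exists>c. 0 \<le> c \<and> c < 1 \<and> (\<forall>v. wnorm P (N *v v) \<le> c * wnorm P v)"
proof -
  obtain m where m: "m > 0" "\<And>v. m * (norm v)\<^sup>2 \<le> v \<bullet> (Q *v v)"
    using positive_form_lower_bound[OF pos_def_pos[OF Q]] by metis
  obtain b where b: "b > 0" "\<And>v. v \<bullet> (P *v v) \<le> b * (norm v)\<^sup>2"
    using quadratic_form_upper_bound[of P] by metis
  define t where "t = min 1 (m / b)"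
  have t: "0 < t" "t \<le> 1" "t * b \<le> m" using m(1) b(1) by (auto simp: t_def min_def field_simps)
  have "wnorm P (N *v v) \<le> sqrt (1 - t) * wnorm P v" for v
  proof -
    have "(N *v v) \<bullet> (P *v (N *v v)) = v \<bullet> ((P - Q) *v v)"
      using eq inner_transpose_conjugate[of v N P v] by (metis add_diff_cancel_left' diff_add_cancel uminus_add_conv_diff)
    also have "\<dots> = v \<bullet> (P *v v) - v \<bullet> (Q *v v)"
      by (simp add: matrix_vector_mult_diff_rdistrib inner_diff_right)
    also have "t * (v \<bullet> (P *v v)) \<le> t * (b * (norm v)\<^sup>2)"
      using b(2) t(1) by (intro mult_left_mono) auto
    then have "t * (v \<bullet> (P *v v)) \<le> m * (norm v)\<^sup>2"
      using mult_right_mono[OF t(3), of "(norm v)\<^sup>2"] by (simp add: mult.assoc)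
    then have "v \<bullet> (P *v v) - v \<bullet> (Q *v v) \<le> (1 - t) * (v \<bullet> (P *v v))"
      using m(2)[of v] by (simp add: algebra_simps)
    finally show ?thesis unfolding wnorm_def by (simp flip: real_sqrt_mult)
  qed
  moreover have "0 \<le> sqrt (1 - t)" "sqrt (1 - t) < 1" using t by auto
  ultimately show ?thesis by blast
qed

lemma wmatnorm_bounds:
  fixes N P :: "real^'m^'m"
  assumes P: "pos_def P" and c: "\<And>v. wnorm P (N *v v) \<le> c * wnorm P v"
  shows "wnorm P (N *v v) \<le> wmatnorm P N * wnorm P v" "wmatnorm P N \<le> c"
proof -
  have ratio: "wnorm P (N *v v) / wnorm P v \<le> c" if "v \<noteq> 0" for v
    using c[of v] wnorm_pos[OF P that] by (simp add: field_simps)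
  have ne: "- {0::real^'m} \<noteq> {}" using axis_eq_0_iff[of _ "1::real"] by (metis ComplI empty_iff singletonD zero_neq_one)
  have bdd: "bdd_above ((\<lambda>v. wnorm P (N *v v) / wnorm P v) ` (- {0}))"
    using ratio by (intro bdd_aboveI2[of _ _ c]) auto
  show "wmatnorm P N \<le> c"
    unfolding wmatnorm_def using ratio by (intro cSUP_least[OF ne]) auto
  show "wnorm P (N *v v) \<le> wmatnorm P N * wnorm P v"
  proof (cases "v = 0")
    case False
    then have "wnorm P (N *v v) / wnorm P v \<le> wmatnorm P N"
      unfolding wmatnorm_def by (intro cSUP_upper2[OF bdd]) auto
    then show ?thesis using wnorm_pos[OF P False] by (simp add: field_simps)
  qed (simp add: wnorm_def)
qed

text \<open>
  A step of length \<open>\<alpha>\<close> lowers the form of \<open>W\<close> by a term linear in \<open>\<alpha>\<close>, and the quadratic term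
  is dominated once \<open>\<alpha>\<close> is small.  Injectivity of the step keeps its induced norm from being zero.
\<close>

lemma explicit_step_contracts:
  fixes A W :: "real^'m^'m"
  assumes W: "pos_def W" and decay: "\<And>v. v \<noteq> 0 \<Longrightarrow> v \<bullet> (W *v (A *v v)) > 0"
  shows "\<exists>\<alpha>max>0. \<exists>\<eta>>0. \<forall>\<alpha>. 0 < \<alpha> \<and> \<alpha> < \<alpha>max \<longrightarrow> \<alpha> * \<eta> < 1 \<and>
    (\<forall>v. wnorm W ((mat 1 - \<alpha> *\<^sub>R A) *v v) \<le> (1 - \<alpha> * \<eta>) * wnorm W v) \<and>
    (\<forall>v. v \<noteq> 0 \<longrightarrow> (mat 1 - \<alpha> *\<^sub>R A) *v v \<noteq> 0)"
proof -
  obtain b where b: "b > 0" "\<And>v. v \<bullet> (W *v v) \<le> b * (norm v)\<^sup>2"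
    using quadratic_form_upper_bound[of W] by metis
  have decay': "v \<bullet> ((W ** A) *v v) > 0" if "v \<noteq> 0" for v
    using decay[OF that] by (simp add: matrix_vector_mul_assoc)
  obtain c1 where c1: "c1 > 0" "\<And>v. c1 * (norm v)\<^sup>2 \<le> v \<bullet> (W *v (A *v v))"
    using positive_form_lower_bound[OF decay'] unfolding matrix_vector_mul_assoc by blast
  obtain c2 where c2: "c2 > 0" "\<And>v. (A *v v) \<bullet> (W *v (A *v v)) \<le> c2 * (norm v)\<^sup>2"
    using quadratic_form_upper_bound[of "transpose A ** W ** A"]
    unfolding inner_transpose_conjugate by blast
  obtain KA where KA: "KA > 0" "\<And>v. norm (A *v v) \<le> norm v * KA"
    using bounded_linear.pos_bounded[OF matrix_vector_mul_bounded_linear[of A]] by blast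
  define \<eta> where "\<eta> = c1 / (2 * b)"
  have \<eta>: "\<eta> > 0" using b(1) c1(1) by (simp add: \<eta>_def)
  define amax where "amax = Min {c1 / c2, 1 / \<eta>, 1 / KA}"
  have amax: "amax > 0" using \<eta> c1(1) c2(1) KA(1) by (simp add: amax_def)
  have "\<alpha> * \<eta> < 1 \<and> (\<forall>v. wnorm W ((mat 1 - \<alpha> *\<^sub>R A) *v v) \<le> (1 - \<alpha> * \<eta>) * wnorm W v) \<and>
      (\<forall>v. v \<noteq> 0 \<longrightarrow> (mat 1 - \<alpha> *\<^sub>R A) *v v \<noteq> 0)" if \<alpha>: "0 < \<alpha>" "\<alpha> < amax" for \<alpha>
  proof (intro conjI allI impI)
    have small: "\<alpha> * c2 < c1" "\<alpha> * KA < 1" and 1: "\<alpha> * \<eta> < 1"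
      using \<alpha> c2(1) KA(1) \<eta> by (auto simp: amax_def field_simps)
    show "\<alpha> * \<eta> < 1" by (rule 1)
    have N: "(mat 1 - \<alpha> *\<^sub>R A) *v v = v - \<alpha> *\<^sub>R (A *v v)" for v
      by (simp add: matrix_vector_mult_diff_rdistrib flip: scaleR_matrix_vector_assoc)
    show "(mat 1 - \<alpha> *\<^sub>R A) *v v \<noteq> 0" if "v \<noteq> 0" for v
    proof
      assume "(mat 1 - \<alpha> *\<^sub>R A) *v v = 0"
      then have "norm v = \<alpha> * norm (A *v v)" using \<alpha>(1) by (metis N abs_of_pos eq_iff_diff_eq_0 norm_scaleR)
      also have "\<dots> \<le> \<alpha> * KA * norm v" using mult_left_mono[OF KA(2)[of v], of \<alpha>] \<alpha>(1) by (simp add: ac_simps)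
      also have "\<dots> < norm v" using small(2) that by simp
      finally show False by simp
    qed
    show "wnorm W ((mat 1 - \<alpha> *\<^sub>R A) *v v) \<le> (1 - \<alpha> * \<eta>) * wnorm W v" for v
    proof -
      let ?q = "v \<bullet> (W *v v)"
      have sym: "(A *v v) \<bullet> (W *v v) = v \<bullet> (W *v (A *v v))"
        by (rule inner_matrix_symmetric) (rule pos_def_symmetric[OF W])
      have "(v - \<alpha> *\<^sub>R (A *v v)) \<bullet> (W *v (v - \<alpha> *\<^sub>R (A *v v)))
          = ?q - 2 * \<alpha> * (v \<bullet> (W *v (A *v v))) + \<alpha> * (\<alpha> * ((A *v v) \<bullet> (W *v (A *v v))))"
        by (simp add: matrix_vector_mult_diff_distrib matrix_vector_mult_scaleR inner_diff_left
            inner_diff_right sym algebra_simps)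
      also have "\<dots> \<le> ?q - 2 * \<alpha> * (c1 * (norm v)\<^sup>2) + \<alpha> * (c1 * (norm v)\<^sup>2)"
      proof -
        have "\<alpha> * ((A *v v) \<bullet> (W *v (A *v v))) \<le> \<alpha> * (c2 * (norm v)\<^sup>2)"
          using c2(2) \<alpha>(1) by (intro mult_left_mono) auto
        also have "\<dots> \<le> c1 * (norm v)\<^sup>2"
          using mult_right_mono[of "\<alpha> * c2" c1 "(norm v)\<^sup>2"] small(1) by (simp add: mult.assoc)
        finally have "\<alpha> * (\<alpha> * ((A *v v) \<bullet> (W *v (A *v v)))) \<le> \<alpha> * (c1 * (norm v)\<^sup>2)"
          using \<alpha>(1) by (intro mult_left_mono) auto
        moreover have "2 * \<alpha> * (c1 * (norm v)\<^sup>2) \<le> 2 * \<alpha> * (v \<bullet> (W *v (A *v v)))"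
          using c1(2) \<alpha>(1) by (intro mult_left_mono) auto
        ultimately show ?thesis by linarith
      qed
      also have "\<dots> = ?q - 2 * \<alpha> * \<eta> * (b * (norm v)\<^sup>2)"
        using b(1) by (simp add: \<eta>_def field_simps)
      also have "\<dots> \<le> ?q - 2 * \<alpha> * \<eta> * ?q"
        using mult_left_mono[OF b(2)[of v], of "2 * \<alpha> * \<eta>"] \<alpha>(1) \<eta> by simp
      also have "\<dots> = (1 - 2 * (\<alpha> * \<eta>)) * ?q" by (simp add: algebra_simps)
      also have "\<dots> \<le> (1 - \<alpha> * \<eta>)\<^sup>2 * ?q"
        by (intro mult_right_mono pos_def_nonneg[OF W]) (simp add: power2_diff)
      finally have "wnorm W ((mat 1 - \<alpha> *\<^sub>R A) *v v) \<le> sqrt ((1 - \<alpha> * \<eta>)\<^sup>2 * ?q)"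
        unfolding N wnorm_def by (rule real_sqrt_le_mono)
      then show ?thesis using 1 by (simp add: real_sqrt_mult wnorm_def)
    qed
  qed
  with amax \<eta> show ?thesis by blast
qed

text \<open>
  The ball of radius \<open>R\<close> in the \<open>W\<close>-norm is invariant, which Euclidean balls need not be; the
  start is taken from a Euclidean ball inside it.
\<close>

lemma perturbed_contraction_iterates:
  fixes T :: "real^'m \<Rightarrow> real^'m"
  assumes W: "pos_def W" and a: "a > 0" and b: "b > 0"
    and ab: "\<And>v. a * norm v \<le> wnorm W v" "\<And>v. wnorm W v \<le> b * norm v"
    and c: "0 \<le> c"
    and step: "\<And>p. wnorm W (p - ps) \<le> R \<Longrightarrow> wnorm W (T p - ps) \<le> c * wnorm W (p - ps)"
    and c1: "c < 1" and p0: "norm (p0 - ps) \<le> R / b"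
  shows "wnorm W ((T ^^ q) p0 - ps) \<le> R"
    and "norm ((T ^^ q) p0 - ps) \<le> b / a * c ^ q * norm (p0 - ps)"
proof -
  have start: "wnorm W (p0 - ps) \<le> R"
    using ab(2)[of "p0 - ps"] p0 b by (simp add: field_simps)
  have R: "R \<ge> 0" using start wnorm_nonneg[OF W, of "p0 - ps"] by linarith
  have main: "wnorm W ((T ^^ q) p0 - ps) \<le> c ^ q * wnorm W (p0 - ps)
      \<and> wnorm W ((T ^^ q) p0 - ps) \<le> R" for q
  proof (induction q)
    case (Suc q)
    let ?w = "wnorm W ((T ^^ q) p0 - ps)"
    have s: "wnorm W ((T ^^ Suc q) p0 - ps) \<le> c * ?w" using step Suc.IH by simp
    have "c * ?w \<le> c * (c ^ q * wnorm W (p0 - ps))" using Suc.IH c by (intro mult_left_mono) auto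
    moreover have "c * ?w \<le> 1 * R"
      using Suc.IH c c1 wnorm_nonneg[OF W] R by (intro mult_mono) auto
    ultimately show ?case using s by (simp add: mult.assoc)
  qed (use start in simp)
  show "wnorm W ((T ^^ q) p0 - ps) \<le> R" using main by blast
  have "a * norm ((T ^^ q) p0 - ps) \<le> c ^ q * wnorm W (p0 - ps)"
    using ab(1)[of "(T ^^ q) p0 - ps"] main[of q] by linarith
  also have "\<dots> \<le> c ^ q * (b * norm (p0 - ps))"
    using ab(2) c by (intro mult_left_mono) auto
  finally show "norm ((T ^^ q) p0 - ps) \<le> b / a * c ^ q * norm (p0 - ps)"
    using a by (simp add: field_simps)
qed

text \<open>
  One ball serves all step sizes because the contraction margin \<open>\<alpha> \<eta>\<close> and the perturbation
  \<open>\<alpha> K\<close> are both proportional to \<open>\<alpha>\<close>.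
\<close>

lemma locally_linear_iteration_converges:
  fixes A W :: "real^'m^'m" and T :: "real \<Rightarrow> real^'m \<Rightarrow> real^'m"
  assumes W: "pos_def W" and decay: "\<And>v. v \<noteq> 0 \<Longrightarrow> v \<bullet> (W *v (A *v v)) > 0"
    and K: "K \<ge> 0" and \<delta>: "\<delta> > 0"
    and approx: "\<And>\<alpha> p. 0 < \<alpha> \<Longrightarrow> p \<in> ball ps \<delta> \<Longrightarrow>
      norm (T \<alpha> p - ps - (mat 1 - \<alpha> *\<^sub>R A) *v (p - ps)) \<le> \<alpha> * K * (norm (p - ps))\<^sup>2"
  shows "\<exists>\<alpha>max>0. \<exists>r>0. \<forall>\<alpha>. 0 < \<alpha> \<and> \<alpha> < 1 \<and> \<alpha> < \<alpha>max \<longrightarrow>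
    (let N = mat 1 - \<alpha> *\<^sub>R A in
      (\<forall>p0\<in>ball ps r. bounded (range (\<lambda>q. (T \<alpha> ^^ q) p0)) \<and> (\<lambda>q. (T \<alpha> ^^ q) p0) \<longlonglongrightarrow> ps) \<and>
      (\<forall>Q. pos_def Q \<longrightarrow>
        (\<exists>P. pos_def P \<and> transpose N ** P ** N - P = - Q \<and>
          (let C = wmatnorm P N in
            0 < C \<and> C < 1 \<and>
            (\<exists>K\<ge>0. \<forall>p0\<in>ball ps r. \<forall>q\<ge>1.
               wnorm P ((T \<alpha> ^^ q) p0 - ps) \<le>
                 C * wnorm P ((T \<alpha> ^^ (q - 1)) p0 - ps) + K * (wnorm P ((T \<alpha> ^^ (q - 1)) p0 - ps))\<^sup>2) \<and>
            (\<forall>c. C < c \<and> c < 1 \<longrightarrow>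
              (\<exists>r'>0. r' \<le> r \<and> (\<forall>p0\<in>ball ps r'. \<forall>q\<ge>1.
                 wnorm P ((T \<alpha> ^^ q) p0 - ps) \<le> c * wnorm P ((T \<alpha> ^^ (q - 1)) p0 - ps))))))) \<and>
      (\<exists>C0>0. \<exists>C1>0. C1 < 1 \<and> (\<forall>p0\<in>ball ps r. \<forall>q.
         norm ((T \<alpha> ^^ q) p0 - ps) \<le> C0 * C1 ^ q * norm (p0 - ps))))"
proof -
  obtain a b where a: "a > 0" and b: "b > 0"
    and ab: "\<And>v. a * norm v \<le> wnorm W v" "\<And>v. wnorm W v \<le> b * norm v"
    using wnorm_equivalent_norm[OF W] by blast
  obtain amax \<eta> where amax: "amax > 0" and \<eta>: "\<eta> > 0"
    and contr: "\<And>\<alpha>. 0 < \<alpha> \<Longrightarrow> \<alpha> < amax \<Longrightarrow> \<alpha> * \<eta> < 1"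
      "\<And>\<alpha> v. 0 < \<alpha> \<Longrightarrow> \<alpha> < amax \<Longrightarrow>
        wnorm W ((mat 1 - \<alpha> *\<^sub>R A) *v v) \<le> (1 - \<alpha> * \<eta>) * wnorm W v"
      "\<And>\<alpha> v. 0 < \<alpha> \<Longrightarrow> \<alpha> < amax \<Longrightarrow> v \<noteq> 0 \<Longrightarrow> (mat 1 - \<alpha> *\<^sub>R A) *v v \<noteq> 0"
    using explicit_step_contracts[OF W decay] by metis
  define L where "L = b * K / a\<^sup>2 + 1"
  have L: "L > 0" using a b K by (simp add: L_def add_nonneg_pos)
  \<comment> \<open>first bound: the approximation holds; second: the perturbation costs at most half of the margin\<close>
  define R where "R = min (a * \<delta> / 2) (\<eta> / (2 * L))"
  have R: "R > 0" using a \<delta> \<eta> L by (simp add: R_def)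
  define r where "r = R / b"
  have r: "r > 0" using R b by (simp add: r_def)
  have in_ball: "p \<in> ball ps \<delta>" if "wnorm W (p - ps) \<le> R" for p
  proof -
    have "a * norm (p - ps) \<le> a * \<delta> / 2" using ab(1)[of "p - ps"] that by (simp add: R_def)
    then have "norm (p - ps) \<le> \<delta> / 2" using a by simp
    then show ?thesis using \<delta> by (simp add: dist_norm norm_minus_commute)
  qed
  have W_step: "wnorm W (T \<alpha> p - ps) \<le> (1 - \<alpha> * \<eta> / 2) * wnorm W (p - ps)"
    if \<alpha>: "0 < \<alpha>" "\<alpha> < amax" and p: "wnorm W (p - ps) \<le> R" for \<alpha> p
  proof -
    let ?w = "wnorm W (p - ps)" and ?N = "mat 1 - \<alpha> *\<^sub>R A"
    let ?e = "T \<alpha> p - ps - ?N *v (p - ps)"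
    have w0: "?w \<ge> 0" by (rule wnorm_nonneg[OF W])
    have "T \<alpha> p - ps = ?N *v (p - ps) + ?e" by simp
    then have "wnorm W (T \<alpha> p - ps) \<le> wnorm W (?N *v (p - ps)) + wnorm W ?e"
      by (metis wnorm_triangle[OF W])
    also have "wnorm W (?N *v (p - ps)) \<le> (1 - \<alpha> * \<eta>) * ?w" by (rule contr(2)[OF \<alpha>])
    also have "wnorm W ?e \<le> b * (\<alpha> * K * (norm (p - ps))\<^sup>2)"
      using ab(2)[of ?e] mult_left_mono[OF approx[OF \<alpha>(1) in_ball[OF p]], of b] b by linarith
    also have "\<dots> \<le> b * (\<alpha> * K * (?w / a)\<^sup>2)"
      using ab(1)[of "p - ps"] a b \<alpha>(1) K by (intro mult_left_mono power_mono) (auto simp: field_simps)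
    also have "\<dots> = \<alpha> * ((b * K / a\<^sup>2) * ?w) * ?w" by (simp add: power2_eq_square field_simps)
    also have "\<dots> \<le> \<alpha> * (\<eta> / 2) * ?w"
    proof -
      have "(b * K / a\<^sup>2) * ?w \<le> L * R"
        using p w0 L a b K by (intro mult_mono) (auto simp: L_def)
      also have "\<dots> \<le> L * (\<eta> / (2 * L))" using L by (intro mult_left_mono) (auto simp: R_def)
      also have "\<dots> = \<eta> / 2" using L by simp
      finally show ?thesis using \<alpha>(1) w0 by (intro mult_right_mono mult_left_mono) auto
    qed
    finally show ?thesis by (simp add: algebra_simps)
  qed
  have "let N = mat 1 - \<alpha> *\<^sub>R A in
      (\<forall>p0\<in>ball ps r. bounded (range (\<lambda>q. (T \<alpha> ^^ q) p0)) \<and> (\<lambda>q. (T \<alpha> ^^ q) p0) \<longlonglongrightarrow> ps) \<and>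
      (\<forall>Q. pos_def Q \<longrightarrow>
        (\<exists>P. pos_def P \<and> transpose N ** P ** N - P = - Q \<and>
          (let C = wmatnorm P N in
            0 < C \<and> C < 1 \<and>
            (\<exists>K\<ge>0. \<forall>p0\<in>ball ps r. \<forall>q\<ge>1.
               wnorm P ((T \<alpha> ^^ q) p0 - ps) \<le>
                 C * wnorm P ((T \<alpha> ^^ (q - 1)) p0 - ps) + K * (wnorm P ((T \<alpha> ^^ (q - 1)) p0 - ps))\<^sup>2) \<and>
            (\<forall>c. C < c \<and> c < 1 \<longrightarrow>
              (\<exists>r'>0. r' \<le> r \<and> (\<forall>p0\<in>ball ps r'. \<forall>q\<ge>1.
                 wnorm P ((T \<alpha> ^^ q) p0 - ps) \<le> c * wnorm P ((T \<alpha> ^^ (q - 1)) p0 - ps))))))) \<and>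
      (\<exists>C0>0. \<exists>C1>0. C1 < 1 \<and> (\<forall>p0\<in>ball ps r. \<forall>q.
         norm ((T \<alpha> ^^ q) p0 - ps) \<le> C0 * C1 ^ q * norm (p0 - ps)))"
    if \<alpha>: "0 < \<alpha>" "\<alpha> < amax" for \<alpha>
    unfolding Let_def
  proof (intro conjI allI impI)
    let ?N = "mat 1 - \<alpha> *\<^sub>R A"
    \<comment> \<open>half of the contraction margin is spent on the perturbation\<close>
    define \<gamma> where "\<gamma> = 1 - \<alpha> * \<eta> / 2"
    have "\<alpha> * \<eta> > 0" using \<alpha>(1) \<eta> by simp
    then have \<gamma>: "0 < \<gamma>" "\<gamma> < 1" using contr(1)[OF \<alpha>] by (auto simp: \<gamma>_def)
    have iter: "wnorm W ((T \<alpha> ^^ q) p0 - ps) \<le> R"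
      "norm ((T \<alpha> ^^ q) p0 - ps) \<le> b / a * \<gamma> ^ q * norm (p0 - ps)" if "p0 \<in> ball ps r" for p0 q
    proof -
      have "norm (p0 - ps) \<le> R / b" using that by (simp add: r_def dist_norm norm_minus_commute)
      note * = perturbed_contraction_iterates[OF W a b ab less_imp_le[OF \<gamma>(1)]
          W_step[OF \<alpha>, folded \<gamma>_def] \<gamma>(2) this]
      show "wnorm W ((T \<alpha> ^^ q) p0 - ps) \<le> R" using *(1) .
      show "norm ((T \<alpha> ^^ q) p0 - ps) \<le> b / a * \<gamma> ^ q * norm (p0 - ps)" using *(2) .
    qed
    show "\<exists>C0>0. \<exists>C1>0. C1 < 1 \<and> (\<forall>p0\<in>ball ps r. \<forall>q.
         norm ((T \<alpha> ^^ q) p0 - ps) \<le> C0 * C1 ^ q * norm (p0 - ps))"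
      using iter(2) \<gamma> a b by (intro exI[of _ "b / a"] exI[of _ \<gamma>] conjI ballI allI) auto
    show "\<forall>p0\<in>ball ps r. bounded (range (\<lambda>q. (T \<alpha> ^^ q) p0)) \<and> (\<lambda>q. (T \<alpha> ^^ q) p0) \<longlonglongrightarrow> ps"
    proof
      fix p0 assume p0: "p0 \<in> ball ps r"
      have "(\<lambda>q. \<gamma> ^ q * (b / a * norm (p0 - ps))) \<longlonglongrightarrow> 0"
        by (rule tendsto_mult_left_zero[OF LIMSEQ_realpow_zero]) (use \<gamma> in auto)
      moreover have "norm ((T \<alpha> ^^ q) p0 - ps) \<le> \<gamma> ^ q * (b / a * norm (p0 - ps))" for q
        using iter(2)[OF p0, of q] by (simp add: ac_simps)
      ultimately have "(\<lambda>q. (T \<alpha> ^^ q) p0 - ps) \<longlonglongrightarrow> 0"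
        by (rule Lim_null_comparison[OF always_eventually[OF allI], rotated])
      then have lim: "(\<lambda>q. (T \<alpha> ^^ q) p0) \<longlonglongrightarrow> ps" by (rule LIM_zero_cancel)
      then show "bounded (range (\<lambda>q. (T \<alpha> ^^ q) p0)) \<and> (\<lambda>q. (T \<alpha> ^^ q) p0) \<longlonglongrightarrow> ps"
        using convergent_imp_bounded by blast
    qed
    fix Q :: "real^'m^'m" assume Q: "pos_def Q"
    obtain P where P: "pos_def P" and eq: "transpose ?N ** P ** ?N - P = - Q"
      using discrete_lyapunov_equation[OF W _ _ contr(2)[OF \<alpha>] Q] contr(1)[OF \<alpha>] \<open>\<alpha> * \<eta> > 0\<close>
      by auto
    obtain c0 where c0: "0 \<le> c0" "c0 < 1" "\<And>v. wnorm P (?N *v v) \<le> c0 * wnorm P v"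
      using lyapunov_solution_contracts[OF P Q eq] by blast
    define C where "C = wmatnorm P ?N"
    have C: "wnorm P (?N *v v) \<le> C * wnorm P v" "C \<le> c0" for v
      unfolding C_def using wmatnorm_bounds[OF P c0(3)] by auto
    have C1: "C < 1" using C(2) c0(2) by simp
    have C0: "C > 0"
    proof -
      obtain k :: 'm where True by blast
      let ?v = "axis k 1 :: real^'m"
      have "?v \<noteq> 0" by (simp add: axis_eq_0_iff)
      then have "0 < wnorm P (?N *v ?v)" "0 < wnorm P ?v"
        by (rule wnorm_pos[OF P contr(3)[OF \<alpha>]], rule wnorm_pos[OF P])
      moreover from this have "0 < C * wnorm P ?v" using C(1)[of ?v] by linarith
      ultimately show ?thesis using zero_less_mult_pos2 by blast
    qed
    obtain Pa Pb where Pa: "Pa > 0" and Pb: "Pb > 0"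
      and Pab: "\<And>v. Pa * norm v \<le> wnorm P v" "\<And>v. wnorm P v \<le> Pb * norm v"
      using wnorm_equivalent_norm[OF P] by blast
    define K' where "K' = Pb * \<alpha> * K / Pa\<^sup>2"
    have K': "K' \<ge> 0" using Pa Pb \<alpha>(1) K by (simp add: K'_def)
    have step: "wnorm P ((T \<alpha> ^^ q) p0 - ps) \<le>
        C * wnorm P ((T \<alpha> ^^ (q - 1)) p0 - ps) + K' * (wnorm P ((T \<alpha> ^^ (q - 1)) p0 - ps))\<^sup>2"
      if p0: "p0 \<in> ball ps r" and q: "q \<ge> 1" for p0 q
    proof -
      define p where "p = (T \<alpha> ^^ (q - 1)) p0"
      have Tp: "(T \<alpha> ^^ q) p0 = T \<alpha> p"
        using q by (cases q) (simp_all add: p_def)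
      let ?e = "T \<alpha> p - ps - ?N *v (p - ps)"
      have pb: "p \<in> ball ps \<delta>" unfolding p_def by (rule in_ball[OF iter(1)[OF p0]])
      have "T \<alpha> p - ps = ?N *v (p - ps) + ?e" by simp
      then have "wnorm P (T \<alpha> p - ps) \<le> wnorm P (?N *v (p - ps)) + wnorm P ?e"
        by (metis wnorm_triangle[OF P])
      also have "wnorm P (?N *v (p - ps)) \<le> C * wnorm P (p - ps)" by (rule C(1))
      also have "wnorm P ?e \<le> Pb * (\<alpha> * K * (norm (p - ps))\<^sup>2)"
        using Pab(2)[of ?e] mult_left_mono[OF approx[OF \<alpha>(1) pb], of Pb] Pb by linarith
      also have "\<dots> \<le> Pb * (\<alpha> * K * (wnorm P (p - ps) / Pa)\<^sup>2)"
        using Pab(1)[of "p - ps"] Pa Pb \<alpha>(1) K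
        by (intro mult_left_mono power_mono) (auto simp: field_simps)
      also have "\<dots> = K' * (wnorm P (p - ps))\<^sup>2" by (simp add: K'_def field_simps)
      finally show ?thesis unfolding Tp p_def[symmetric] by simp
    qed
    have local_rate: "\<exists>r'>0. r' \<le> r \<and> (\<forall>p0\<in>ball ps r'. \<forall>q\<ge>1.
        wnorm P ((T \<alpha> ^^ q) p0 - ps) \<le> c * wnorm P ((T \<alpha> ^^ (q - 1)) p0 - ps))"
      if c: "C < c" for c
    proof -
      define M where "M = (K' + 1) * (Pb * (b / a))"
      have M: "M > 0" using K' Pb a b by (simp add: M_def)
      define r' where "r' = min r ((c - C) / M)"
      have r': "r' > 0" "r' \<le> r" using r c M by (auto simp: r'_def)
      have "wnorm P ((T \<alpha> ^^ q) p0 - ps) \<le> c * wnorm P ((T \<alpha> ^^ (q - 1)) p0 - ps)"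
        if p0: "p0 \<in> ball ps r'" and q: "q \<ge> 1" for p0 q
      proof -
        let ?v = "(T \<alpha> ^^ (q - 1)) p0 - ps"
        have p0r: "p0 \<in> ball ps r" using p0 r'(2) by simp
        have n0: "norm (p0 - ps) \<le> (c - C) / M"
          using p0 by (simp add: r'_def dist_norm norm_minus_commute)
        have "norm ?v \<le> b / a * \<gamma> ^ (q - 1) * norm (p0 - ps)" by (rule iter(2)[OF p0r])
        also have "\<dots> \<le> b / a * 1 * norm (p0 - ps)"
          using \<gamma> a b by (intro mult_right_mono mult_left_mono power_le_one) auto
        finally have "norm ?v \<le> b / a * norm (p0 - ps)" by simp
        then have "wnorm P ?v \<le> Pb * (b / a * norm (p0 - ps))"
          using Pab(2)[of ?v] mult_left_mono[of "norm ?v" "b / a * norm (p0 - ps)" Pb] Pb by linarith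
        then have "(K' + 1) * wnorm P ?v \<le> (K' + 1) * (Pb * (b / a * norm (p0 - ps)))"
          using K' by (intro mult_left_mono) auto
        also have "\<dots> = M * norm (p0 - ps)" by (simp add: M_def)
        also have "\<dots> \<le> c - C" using n0 M by (simp add: field_simps)
        finally have "K' * wnorm P ?v \<le> c - C"
          using wnorm_nonneg[OF P, of ?v] by (simp add: algebra_simps)
        then have "K' * wnorm P ?v * wnorm P ?v \<le> (c - C) * wnorm P ?v"
          by (intro mult_right_mono wnorm_nonneg[OF P])
        then show ?thesis using step[OF p0r q] by (simp add: power2_eq_square algebra_simps)
      qed
      with r' show ?thesis by blast
    qed
    show "\<exists>P. pos_def P \<and> transpose ?N ** P ** ?N - P = - Q \<and>
            0 < wmatnorm P ?N \<and> wmatnorm P ?N < 1 \<and>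
            (\<exists>K\<ge>0. \<forall>p0\<in>ball ps r. \<forall>q\<ge>1.
               wnorm P ((T \<alpha> ^^ q) p0 - ps) \<le>
                 wmatnorm P ?N * wnorm P ((T \<alpha> ^^ (q - 1)) p0 - ps)
                   + K * (wnorm P ((T \<alpha> ^^ (q - 1)) p0 - ps))\<^sup>2) \<and>
            (\<forall>c. wmatnorm P ?N < c \<and> c < 1 \<longrightarrow>
              (\<exists>r'>0. r' \<le> r \<and> (\<forall>p0\<in>ball ps r'. \<forall>q\<ge>1.
                 wnorm P ((T \<alpha> ^^ q) p0 - ps) \<le> c * wnorm P ((T \<alpha> ^^ (q - 1)) p0 - ps))))"
      using P eq C0 C1 K' step local_rate unfolding C_def by (intro exI[of _ P] conjI) blast+
  qed
  with amax r show ?thesis by blast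
qed

section \<open>Partial derivatives and strict differentiability\<close>

lemma partial_eqI: "(F has_derivative F') (at p) \<Longrightarrow> partial k F p = F' (axis k 1)"
  unfolding partial_def by (simp add: frechet_derivative_at[symmetric])

definition gradient :: "(real^'m::finite \<Rightarrow> real) \<Rightarrow> real^'m \<Rightarrow> real^'m" where
  "gradient F p = (\<chi> k. partial k F p)"

lemma has_derivative_gradient:
  assumes "F differentiable (at p)"
  shows "(F has_derivative (\<lambda>v. gradient F p \<bullet> v)) (at p)"
proof -
  obtain F' where F': "(F has_derivative F') (at p)" using assms by (auto simp: differentiable_def)
  interpret linear F' using F' by (rule has_derivative_linear)
  have "F' v = gradient F p \<bullet> v" for v
  proof -
    have "F' v = F' (\<Sum>k\<in>UNIV. v $ k *\<^sub>R axis k 1)"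
      using basis_expansion[of v] by (simp add: scalar_mult_eq_scaleR)
    also have "\<dots> = gradient F p \<bullet> v"
      by (simp add: sum scaleR gradient_def inner_vec_def partial_eqI[OF F'] mult.commute)
    finally show ?thesis .
  qed
  with F' show ?thesis by (metis (no_types, lifting) ext)
qed

lemma gradient_inner_axis: "gradient F p \<bullet> axis k 1 = partial k F p"
  by (simp add: gradient_def inner_axis)

lemma partial_const: "partial k (\<lambda>p. c) = (\<lambda>p. 0)"
  by (rule ext, rule partial_eqI[THEN trans]) (auto intro!: derivative_eq_intros)

lemma has_derivative_coordinate: "((\<lambda>p::real^'m. p $ l) has_derivative (\<lambda>v. v $ l)) (at p)"
  by (rule bounded_linear.has_derivative[OF bounded_linear_vec_nth has_derivative_ident])

lemma partial_coordinate: "partial k (\<lambda>p. p $ l) = (\<lambda>p. of_bool (k = l))"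
  by (rule ext, rule partial_eqI[THEN trans, OF has_derivative_coordinate]) (auto simp: axis_def)

lemma partial_add:
  assumes "F differentiable (at p)" "G differentiable (at p)"
  shows "partial k (\<lambda>p. F p + G p) p = partial k F p + partial k G p"
  by (rule partial_eqI[THEN trans, OF has_derivative_add[OF
      assms[THEN has_derivative_gradient]]]) (simp add: gradient_def inner_axis)

lemma partial_mult:
  assumes "F differentiable (at p)" "G differentiable (at p)"
  shows "partial k (\<lambda>p. F p * G p) p = partial k F p * G p + F p * partial k G p"
  by (rule partial_eqI[THEN trans, OF has_derivative_mult[OF
      assms[THEN has_derivative_gradient]]]) (simp add: gradient_def inner_axis)

lemma partial_sum:
  assumes "\<And>i. i \<in> I \<Longrightarrow> F i differentiable (at p)"
  shows "partial k (\<lambda>p. \<Sum>i\<in>I. F i p) p = (\<Sum>i\<in>I. partial k (F i) p)"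
  by (rule partial_eqI[THEN trans, OF has_derivative_sum[OF
      assms[THEN has_derivative_gradient]]]) (simp_all add: gradient_def inner_axis)

lemma times_cont_diff_differentiable:
  "times_cont_diff r F \<Longrightarrow> 0 < r \<Longrightarrow> F differentiable (at p)"
  by (cases r) auto

lemma times_cont_diff_SucD: "times_cont_diff (Suc r) F \<Longrightarrow> times_cont_diff r F"
proof (induction r arbitrary: F)
  case 0
  then show ?case
    by (auto intro!: continuous_at_imp_continuous_on differentiable_imp_continuous_within)
qed auto

lemma times_cont_diff_const: "times_cont_diff r (\<lambda>p. c)"
  by (induction r arbitrary: c) (auto simp: partial_const)

lemma times_cont_diff_coordinate: "times_cont_diff r (\<lambda>p. p $ l)"
proof (cases r)
  case (Suc n)
  have "(\<lambda>p. p $ l) differentiable (at p)" for p :: "real^'a"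
    using has_derivative_coordinate differentiable_def by blast
  then show ?thesis by (simp add: Suc partial_coordinate times_cont_diff_const)
qed (auto intro!: continuous_intros)

lemma times_cont_diff_add:
  "times_cont_diff r F \<Longrightarrow> times_cont_diff r G \<Longrightarrow> times_cont_diff r (\<lambda>p. F p + G p)"
proof (induction r arbitrary: F G)
  case (Suc r)
  then have "partial k (\<lambda>p. F p + G p) = (\<lambda>p. partial k F p + partial k G p)" for k
    by (intro ext partial_add) auto
  with Suc show ?case by auto
qed (auto intro!: continuous_intros)

lemma times_cont_diff_mult:
  "times_cont_diff r F \<Longrightarrow> times_cont_diff r G \<Longrightarrow> times_cont_diff r (\<lambda>p. F p * G p)"
proof (induction r arbitrary: F G)
  case (Suc r)
  then have "partial k (\<lambda>p. F p * G p) = (\<lambda>p. partial k F p * G p + F p * partial k G p)" for k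
    by (intro ext partial_mult) auto
  moreover have "times_cont_diff r F" "times_cont_diff r G"
    using Suc.prems by (auto intro: times_cont_diff_SucD)
  ultimately show ?case
    using Suc by (auto intro!: times_cont_diff_add)
qed (auto intro!: continuous_intros)

lemma times_cont_diff_sum:
  assumes "\<And>i. i \<in> I \<Longrightarrow> times_cont_diff r (F i)"
  shows "times_cont_diff r (\<lambda>p. \<Sum>i\<in>I. F i p)"
  using assms
  by (induction I rule: infinite_finite_induct)
    (auto simp: times_cont_diff_const intro!: times_cont_diff_add)

text \<open>
  The next two facts express locality: functions that ignore a coordinate have partial derivatives
  that ignore it as well, and a zero partial derivative in its direction.
\<close>

lemma partial_translation_invariant:
  assumes F: "\<And>p. F differentiable (at p)" and inv: "\<And>p. F (p + c) = F p"
  shows "partial k F (p + c) = partial k F p"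
proof -
  have "((\<lambda>p. p + c) has_derivative (\<lambda>v. v)) (at p)" by (auto intro!: derivative_eq_intros)
  from has_derivative_compose[OF this has_derivative_gradient[OF F]]
  have "(F has_derivative (\<lambda>v. gradient F (p + c) \<bullet> v)) (at p)" by (simp add: inv)
  then show ?thesis by (simp add: partial_eqI gradient_def inner_axis)
qed

lemma partial_zero_if_invariant:
  assumes F: "\<And>p. F differentiable (at p)" and inv: "\<And>p t. F (p + t *\<^sub>R axis k 1) = F p"
  shows "partial k F p = 0"
proof -
  have "((\<lambda>t::real. p + t *\<^sub>R axis k 1) has_derivative (\<lambda>t. t *\<^sub>R axis k 1)) (at 0)"
    by (auto intro!: derivative_eq_intros)
  from has_derivative_compose[OF this has_derivative_gradient[OF F]]
  have "((\<lambda>t::real. F p) has_derivative (\<lambda>t. gradient F p \<bullet> (t *\<^sub>R axis k 1))) (at 0)"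
    by (simp add: inv)
  from has_derivative_unique[OF this has_derivative_const]
  have "gradient F p \<bullet> ((1::real) *\<^sub>R axis k 1) = 0" by metis
  then show ?thesis by (simp add: gradient_def inner_axis)
qed

text \<open>
  Vector-valued estimates are assembled from finitely many scalar ones, each valid near the base
  point with its own constants; \<open>d\<close> measures the distance from the base point.
\<close>

lemma uniform_local_constants:
  fixes Q :: "'k::finite \<Rightarrow> 'x \<Rightarrow> real"
  assumes "\<And>k. \<exists>K\<ge>0. \<exists>\<delta>>0. \<forall>x. d x < \<delta> \<longrightarrow> Q k x \<le> K * R x" and R: "\<And>x. R x \<ge> 0"
  shows "\<exists>K\<ge>0. \<exists>\<delta>>0. \<forall>k x. d x < (\<delta>::real) \<longrightarrow> Q k x \<le> K * R x"
proof -
  obtain K \<delta> where K: "\<And>k. K k \<ge> 0" and \<delta>: "\<And>k. \<delta> k > (0::real)"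
    and bound: "\<And>k x. d x < \<delta> k \<Longrightarrow> Q k x \<le> K k * R x"
    using assms(1) by metis
  have "Q k x \<le> sum K UNIV * R x" if "d x < Min (range \<delta>)" for k x
  proof -
    have "d x < \<delta> k" using that by simp
    then have "Q k x \<le> K k * R x" by (rule bound)
    also have "\<dots> \<le> sum K UNIV * R x"
      by (intro mult_right_mono R member_le_sum) (auto simp: K)
    finally show ?thesis .
  qed
  moreover have "sum K UNIV \<ge> 0" "Min (range \<delta>) > 0" by (auto simp: K \<delta> sum_nonneg)
  ultimately show ?thesis by blast
qed

lemma differentiable_imp_Lipschitz_at:
  fixes f :: "'a::real_normed_vector \<Rightarrow> 'b::real_normed_vector"
  assumes "f differentiable (at a)"
  shows "\<exists>K\<ge>0. \<exists>\<delta>>0. \<forall>z. norm (z - a) < \<delta> \<longrightarrow> norm (f z - f a) \<le> K * norm (z - a)"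
proof -
  obtain f' where f': "(f has_derivative f') (at a)" using assms by (auto simp: differentiable_def)
  obtain K where K: "K \<ge> 0" "\<And>v. norm (f' v) \<le> norm v * K"
    using bounded_linear.nonneg_bounded[OF has_derivative_bounded_linear[OF f']] by blast
  obtain \<delta> where \<delta>: "\<delta> > 0"
    "\<And>z. norm (z - a) < \<delta> \<Longrightarrow> norm (f z - f a - f' (z - a)) \<le> 1 * norm (z - a)"
    using f' zero_less_one unfolding has_derivative_at_alt by metis
  have "norm (f z - f a) \<le> (K + 1) * norm (z - a)" if "norm (z - a) < \<delta>" for z
  proof -
    have "norm (f z - f a) \<le> norm (f z - f a - f' (z - a)) + norm (f' (z - a))"
      by (metis diff_add_cancel norm_triangle_ineq)
    then show ?thesis using \<delta>(2)[OF that] K(2)[of "z - a"] by (simp add: algebra_simps)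
  qed
  with K(1) \<delta>(1) show ?thesis by (metis add_nonneg_nonneg zero_le_one)
qed

text \<open>
  The derivative of a twice differentiable function is Lipschitz at \<open>a\<close>, so by the mean value
  inequality the derivative at \<open>a\<close> predicts the difference of two values with a relative error that
  is linear in the distances of the two points from \<open>a\<close>.
\<close>

lemma linearization_error:
  fixes F :: "real^'m \<Rightarrow> real"
  assumes F: "times_cont_diff 2 F"
  shows "\<exists>K\<ge>0. \<exists>\<delta>>0. \<forall>z z'. norm (z - a) < \<delta> \<longrightarrow> norm (z' - a) < \<delta> \<longrightarrow>
    \<bar>F z - F z' - gradient F a \<bullet> (z - z')\<bar> \<le> K * ((norm (z - a) + norm (z' - a)) * norm (z - z'))"
proof -
  have diff: "F differentiable (at p)" "partial k F differentiable (at p)" for k p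
    using F by (auto simp: numeral_2_eq_2)
  have "\<exists>K\<ge>0. \<exists>\<delta>>0. \<forall>z. norm (z - a) < \<delta> \<longrightarrow> norm (partial k F z - partial k F a) \<le> K * norm (z - a)" for k
    by (rule differentiable_imp_Lipschitz_at[OF diff(2)])
  from uniform_local_constants[where d = "\<lambda>z. norm (z - a)" and R = "\<lambda>z. norm (z - a)"
      and Q = "\<lambda>k z. norm (partial k F z - partial k F a)", OF this norm_ge_zero]
  obtain K \<delta> where K: "K \<ge> 0" and \<delta>: "\<delta> > 0"
    and lip: "\<And>k z. norm (z - a) < \<delta> \<Longrightarrow> norm (partial k F z - partial k F a) \<le> K * norm (z - a)"
    by blast
  let ?K = "real CARD('m) * K"
  have grad: "norm (gradient F z - gradient F a) \<le> ?K * norm (z - a)" if "norm (z - a) < \<delta>" for z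
  proof -
    have "norm (gradient F z - gradient F a) \<le> (\<Sum>k\<in>UNIV. \<bar>(gradient F z - gradient F a) $ k\<bar>)"
      by (rule norm_le_l1_cart)
    also have "\<dots> \<le> (\<Sum>k\<in>(UNIV::'m set). K * norm (z - a))"
      using lip[OF that] by (intro sum_mono) (simp add: gradient_def)
    finally show ?thesis by simp
  qed
  have "\<bar>F z - F z' - gradient F a \<bullet> (z - z')\<bar> \<le> ?K * ((norm (z - a) + norm (z' - a)) * norm (z - z'))"
    if z: "norm (z - a) < \<delta>" and z': "norm (z' - a) < \<delta>" for z z'
  proof -
    let ?m = "norm (z - a) + norm (z' - a)"
    have "norm ((F z - gradient F a \<bullet> z) - (F z' - gradient F a \<bullet> z')) \<le> (?K * ?m) * norm (z - z')"
    proof (rule differentiable_bound[OF convex_closed_segment])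
      fix w assume w: "w \<in> closed_segment z z'"
      have wm: "norm (w - a) \<le> max (norm (z - a)) (norm (z' - a))"
        using segment_furthest_le[OF w, of a] by (auto simp: norm_minus_commute max_def)
      then have w\<delta>: "norm (w - a) < \<delta>" using z z' by simp
      show "((\<lambda>w. F w - gradient F a \<bullet> w) has_derivative
          (\<lambda>v. gradient F w \<bullet> v - gradient F a \<bullet> v)) (at w within closed_segment z z')"
        by (intro has_derivative_diff has_derivative_at_withinI[OF has_derivative_gradient[OF diff(1)]]
            bounded_linear_imp_has_derivative bounded_linear_inner_right)
      show "onorm (\<lambda>v. gradient F w \<bullet> v - gradient F a \<bullet> v) \<le> ?K * ?m"
      proof (rule onorm_bound)
        show "0 \<le> ?K * ?m" using K by simp
        fix v
        have "norm (gradient F w \<bullet> v - gradient F a \<bullet> v) \<le> norm (gradient F w - gradient F a) * norm v"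
          by (metis Cauchy_Schwarz_ineq2 inner_diff_left real_norm_def)
        also have "\<dots> \<le> (?K * ?m) * norm v"
        proof (rule mult_right_mono)
          have "norm (gradient F w - gradient F a) \<le> ?K * norm (w - a)" by (rule grad[OF w\<delta>])
          also have "\<dots> \<le> ?K * ?m"
            using wm K by (intro mult_left_mono) (auto simp: max_def split: if_splits intro: order_trans)
          finally show "norm (gradient F w - gradient F a) \<le> ?K * ?m" .
        qed simp
        finally show "norm (gradient F w \<bullet> v - gradient F a \<bullet> v) \<le> (?K * ?m) * norm v" .
      qed
    qed auto
    then show ?thesis by (simp add: inner_diff_right algebra_simps)
  qed
  moreover have "?K \<ge> 0" using K by simp
  ultimately show ?thesis using \<delta> by blast
qed

section \<open>Locally unique solutions of parametric equations\<close>

text \<open>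
  The chord iteration \<open>y \<mapsto> y - M\<^sup>-\<^sup>1 F p y\<close> is a contraction near the base point, and its fixed
  point stays as close to the starting guess \<open>d p\<close> as the residual there is small.
\<close>

lemma parametric_equation_locally_solvable:
  fixes F :: "real^'m \<Rightarrow> real^'m \<Rightarrow> real^'m"
  assumes M: "\<And>v. M *v v = 0 \<Longrightarrow> v = 0" and K: "K \<ge> 0" and L: "L \<ge> 0" and \<delta>: "\<delta> > 0"
    and strict: "\<And>p y y'. norm (p - ps) < \<delta> \<Longrightarrow> norm (y - ds) < \<delta> \<Longrightarrow> norm (y' - ds) < \<delta> \<Longrightarrow>
      norm (F p y - F p y' - M *v (y - y'))
        \<le> K * ((norm (p - ps) + norm (y - ds) + norm (y' - ds)) * norm (y - y'))"
    and d: "\<And>p. norm (d p - ds) \<le> norm (p - ps)"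
    and guess: "\<And>p. norm (p - ps) < \<delta> \<Longrightarrow> norm (F p (d p)) \<le> L * norm (p - ps)"
  shows "\<exists>C\<ge>0. \<exists>\<epsilon>0>0. \<forall>\<epsilon>. 0 < \<epsilon> \<and> \<epsilon> \<le> \<epsilon>0 \<longrightarrow> (\<exists>\<eta>>0. \<forall>p. norm (p - ps) < \<eta> \<longrightarrow>
    (\<exists>y. norm (y - ds) < \<epsilon> \<and> F p y = 0 \<and> norm (y - d p) \<le> C * norm (p - ps) \<and>
      (\<forall>y'. norm (y' - ds) < \<epsilon> \<and> F p y' = 0 \<longrightarrow> y' = y)))"
proof -
  have lin: "linear ((*v) M)" by simp
  have inj: "inj ((*v) M)" using M by (simp add: linear_injective_0[OF lin])
  obtain g where g: "linear g" "g \<circ> (*v) M = id" using linear_injective_left_inverse[OF lin inj] by blast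
  have gM: "g (M *v v) = v" for v using g(2) by (metis comp_apply id_apply)
  obtain B where B: "B > 0" "\<And>v. norm (g v) \<le> B * norm v" using linear_bounded_pos[OF g(1)] by blast
  have g_zero: "v = 0" if "g v = 0" for v
  proof -
    obtain w where "v = M *v w"
      using linear_injective_imp_surjective[OF lin inj] by (metis surjD)
    then show ?thesis using that gM[of w] by simp
  qed
  define C where "C = 2 * (B * L)"
  have C: "C \<ge> 0" using B(1) L by (simp add: C_def)
  define X where "X p y = y - g (F p y)" for p y
  have X_fix: "X p y = y \<longleftrightarrow> F p y = 0" for p y
    using g_zero[of "F p y"] linear_0[OF g(1)] by (auto simp: X_def)
  \<comment> \<open>the three distances in \<open>strict\<close> are at most \<open>\<epsilon>0\<close> each, so \<open>X\<close> contracts by one half\<close>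
  define \<epsilon>0 where "\<epsilon>0 = min (\<delta> / 2) (1 / (6 * (B * K + 1)))"
  have BK: "B * K + 1 > 0" using B(1) K by (simp add: add_nonneg_pos)
  have \<epsilon>0: "\<epsilon>0 > 0" using \<delta> BK by (simp add: \<epsilon>0_def)
  have X_contr: "norm (X p y - X p y') \<le> 1 / 2 * norm (y - y')"
    if "norm (p - ps) \<le> \<epsilon>0" "norm (y - ds) \<le> \<epsilon>0" "norm (y' - ds) \<le> \<epsilon>0" for p y y'
  proof -
    let ?D = "F p y - F p y' - M *v (y - y')"
    have "X p y - X p y' = - g ?D"
      by (simp add: X_def linear_diff[OF g(1)] gM)
    then have "norm (X p y - X p y') \<le> B * norm ?D" using B(2)[of ?D] by simp
    also have "norm ?D \<le> K * ((norm (p - ps) + norm (y - ds) + norm (y' - ds)) * norm (y - y'))"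
      by (rule strict) (use that \<delta> in \<open>auto simp: \<epsilon>0_def\<close>)
    also have "\<dots> \<le> K * (3 * \<epsilon>0 * norm (y - y'))"
      using that K by (intro mult_left_mono mult_right_mono) auto
    also have "B * (K * (3 * \<epsilon>0 * norm (y - y'))) = (B * K) * (3 * \<epsilon>0) * norm (y - y')" by simp
    also have "\<dots> \<le> 1 / 2 * norm (y - y')"
    proof (rule mult_right_mono)
      have "(B * K) * (3 * \<epsilon>0) \<le> (B * K + 1) * (3 * \<epsilon>0)" using \<epsilon>0 by (intro mult_right_mono) auto
      also have "\<dots> \<le> (B * K + 1) * (3 * (1 / (6 * (B * K + 1))))"
        using BK by (intro mult_left_mono) (auto simp: \<epsilon>0_def)
      also have "\<dots> = 1 / 2" using BK by (simp add: field_simps)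
      finally show "(B * K) * (3 * \<epsilon>0) \<le> 1 / 2" .
    qed simp
    finally show ?thesis using B(1) by simp
  qed
  have "\<exists>\<eta>>0. \<forall>p. norm (p - ps) < \<eta> \<longrightarrow>
    (\<exists>y. norm (y - ds) < \<epsilon> \<and> F p y = 0 \<and> norm (y - d p) \<le> C * norm (p - ps) \<and>
      (\<forall>y'. norm (y' - ds) < \<epsilon> \<and> F p y' = 0 \<longrightarrow> y' = y))" if \<epsilon>: "0 < \<epsilon>" "\<epsilon> \<le> \<epsilon>0" for \<epsilon>
  proof (intro exI[of _ "\<epsilon> / (C + 3)"] conjI allI impI)
    show "\<epsilon> / (C + 3) > 0" using \<epsilon> C by simp
    fix p assume p: "norm (p - ps) < \<epsilon> / (C + 3)"
    have small: "(C + 3) * norm (p - ps) < \<epsilon>" using p C by (simp add: field_simps)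
    have "1 * norm (p - ps) \<le> (C + 3) * norm (p - ps)" using C by (intro mult_right_mono) auto
    then have p\<epsilon>: "norm (p - ps) < \<epsilon>" using small by linarith
    have p\<delta>: "norm (p - ps) < \<delta>" using p\<epsilon> \<epsilon> \<delta> by (auto simp: \<epsilon>0_def)
    have dp: "norm (d p - ds) \<le> \<epsilon>" using d[of p] p\<epsilon> by simp
    have contr: "norm (X p y - X p y') \<le> 1 / 2 * norm (y - y')"
      if "norm (y - ds) \<le> \<epsilon>" "norm (y' - ds) \<le> \<epsilon>" for y y'
      by (rule X_contr) (use that p\<epsilon> \<epsilon> in auto)
    have "norm (g (F p (d p))) \<le> B * (L * norm (p - ps))"
      using B(2)[of "F p (d p)"] mult_left_mono[OF guess[OF p\<delta>], of B] B(1) by linarith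
    then have Xd: "norm (X p (d p) - d p) \<le> C / 2 * norm (p - ps)" by (simp add: X_def C_def)
    have self: "norm (X p y - ds) \<le> \<epsilon>" if y: "norm (y - ds) \<le> \<epsilon>" for y
    proof -
      have "X p y - ds = (X p y - X p (d p)) + (X p (d p) - d p) + (d p - ds)" by simp
      then have "norm (X p y - ds) \<le> norm (X p y - X p (d p)) + norm (X p (d p) - d p) + norm (d p - ds)"
        by (metis norm_triangle_ineq norm_triangle_le add_mono order_refl)
      moreover have "norm (y - d p) \<le> norm (y - ds) + norm (d p - ds)"
        by (metis norm_triangle_sub norm_minus_commute dist_norm dist_triangle2)
      moreover have "(C + 3) * norm (p - ps) = C * norm (p - ps) + 3 * norm (p - ps)"
        by (simp add: algebra_simps)
      ultimately show ?thesis using contr[OF y dp] Xd d[of p] y small by simp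
    qed
    have "\<exists>!y\<in>cball ds \<epsilon>. X p y = y"
    proof (rule Banach_fix)
      show "complete (cball ds \<epsilon>)" by (simp add: complete_eq_closed)
      show "cball ds \<epsilon> \<noteq> {}" using \<epsilon> by simp
      show "X p ` cball ds \<epsilon> \<subseteq> cball ds \<epsilon>"
        using self by (auto simp: dist_norm norm_minus_commute)
      show "dist (X p x) (X p y) \<le> 1 / 2 * dist x y" if "x \<in> cball ds \<epsilon>" "y \<in> cball ds \<epsilon>" for x y
        using contr[of x y] that by (auto simp: dist_norm norm_minus_commute)
    qed auto
    then obtain y where y: "norm (y - ds) \<le> \<epsilon>" "X p y = y"
      and unique: "\<And>y'. norm (y' - ds) \<le> \<epsilon> \<Longrightarrow> X p y' = y' \<Longrightarrow> y' = y"
      by (auto simp: dist_norm norm_minus_commute)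
    have "y - d p = (X p y - X p (d p)) + (X p (d p) - d p)" using y(2) by simp
    then have "norm (y - d p) \<le> norm (X p y - X p (d p)) + norm (X p (d p) - d p)"
      by (metis norm_triangle_ineq)
    then have close: "norm (y - d p) \<le> C * norm (p - ps)" using contr[OF y(1) dp] Xd by simp
    have "norm (y - ds) \<le> norm (y - d p) + norm (d p - ds)"
      by (metis diff_add_cancel add_diff_eq norm_triangle_ineq)
    also have "\<dots> \<le> (C + 1) * norm (p - ps)" using close d[of p] by (simp add: algebra_simps)
    also have "\<dots> \<le> (C + 3) * norm (p - ps)" by (intro mult_right_mono) auto
    finally have "norm (y - ds) < \<epsilon>" using small by simp
    then show "\<exists>y. norm (y - ds) < \<epsilon> \<and> F p y = 0 \<and> norm (y - d p) \<le> C * norm (p - ps) \<and>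
      (\<forall>y'. norm (y' - ds) < \<epsilon> \<and> F p y' = 0 \<longrightarrow> y' = y)"
      using y(2) close unique X_fix by (intro exI[of _ y] conjI) (auto intro: less_imp_le)
  qed
  with C \<epsilon>0 show ?thesis by blast
qed

section \<open>Structure of the local problems\<close>

text \<open>
  At this point the subproblem of agent \<open>i\<close> becomes its original Lagrangian composed with an affine
  map of \<open>y\<close>; for \<open>y = dual_part D p\<close> it is \<open>p\<close> itself.
\<close>

definition trial_point :: "('v, 'm::finite) nlp \<Rightarrow> 'v \<Rightarrow> real^'m \<Rightarrow> real^'m \<Rightarrow> real^'m" where
  "trial_point D i p y = (\<chi> k. if kind_of D k \<noteq> Primal then y $ k
     else if owner D k = i then p $ k + y $ k else p $ k)"

text \<open>
  Rows of the KKT system with the scaling of the update matrix.  The Lagrangian is a parameter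
  since the central and the local systems differ only in it.
\<close>

definition kkt_row ::
    "('v, 'm::finite) nlp \<Rightarrow> real \<Rightarrow> (real^'m \<Rightarrow> real) \<Rightarrow> 'm \<Rightarrow> real^'m \<Rightarrow> real" where
  "kkt_row D \<beta> Lg k p = (case kind_of D k of
     Primal \<Rightarrow> partial k Lg p
   | EqMult \<Rightarrow> - \<beta> * con D k p
   | IneqMult \<Rightarrow> - \<beta> * (p $ k * con D k p))"

definition central_residual :: "('v::finite, 'm::finite) nlp \<Rightarrow> real \<Rightarrow> real^'m \<Rightarrow> real^'m" where
  "central_residual D \<beta> p = (\<chi> k. kkt_row D \<beta> (lagrangian D) k p)"

definition local_row :: "('v, 'm::finite) nlp \<Rightarrow> real \<Rightarrow> 'm \<Rightarrow> real^'m \<Rightarrow> real" where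
  "local_row D \<beta> k = kkt_row D \<beta> (local_lagrangian D (owner D k)) k"

text \<open>
  Near the solution its zeros are the simultaneous solutions of the local KKT systems.  The rows
  are scaled so that the update matrix is its derivative with respect to \<open>y\<close> there.
\<close>

definition local_residual ::
    "('v, 'm::finite) nlp \<Rightarrow> ('v \<Rightarrow> real) \<Rightarrow> real \<Rightarrow> real^'m \<Rightarrow> real^'m \<Rightarrow> real^'m" where
  "local_residual D \<rho> \<beta> p y = (\<chi> k. local_row D \<beta> k (trial_point D (owner D k) p y)
     + (if kind_of D k = Primal then \<rho> (owner D k) * y $ k
          + (\<Sum>j\<in>neighbors D (owner D k). partial k (local_lagrangian D j) p) else 0))"

text \<open>
  Entries of the update matrix, which depend on \<open>p\<close> and \<open>y\<close> through the trial point alone and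
  inherit their smoothness from the model functions in this form.
\<close>

definition local_block ::
    "('v, 'm::finite) nlp \<Rightarrow> ('v \<Rightarrow> real) \<Rightarrow> real \<Rightarrow> 'm \<Rightarrow> 'm \<Rightarrow> real^'m \<Rightarrow> real" where
  "local_block D \<rho> \<beta> k l z = (if owner D k \<noteq> owner D l then 0
     else case (kind_of D k, kind_of D l) of
       (Primal, Primal) \<Rightarrow> partial k (partial l (local_lagrangian D (owner D k))) z
          + (if k = l then \<rho> (owner D k) else 0)
     | (Primal, _) \<Rightarrow> partial k (con D l) z
     | (EqMult, Primal) \<Rightarrow> - \<beta> * partial l (con D k) z
     | (IneqMult, Primal) \<Rightarrow> - \<beta> * (z $ k * partial l (con D k) z)
     | (IneqMult, IneqMult) \<Rightarrow> if k = l then - \<beta> * con D k z else 0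
     | _ \<Rightarrow> 0)"

lemma trial_point_dual_part: "trial_point D i p (dual_part D p) = p"
  by (simp add: trial_point_def dual_part_def vec_eq_iff)

lemma trial_point_diff: "trial_point D i p y - trial_point D i p y' = trial_point D i 0 (y - y')"
  by (simp add: trial_point_def vec_eq_iff)

lemma norm_trial_point_0: "norm (trial_point D i 0 v) \<le> norm v"
  by (rule norm_le_componentwise_cart) (simp add: trial_point_def)

lemma norm_dual_part_diff: "norm (dual_part D p - dual_part D q) \<le> norm (p - q)"
  by (rule norm_le_componentwise_cart) (simp add: dual_part_def)

lemma norm_trial_point_diff:
  "norm (trial_point D i p y - ps) \<le> norm (p - ps) + norm (y - dual_part D ps)"
proof -
  let ?w = "\<chi> k. if kind_of D k = Primal then (p - ps) $ k else 0"
  have "trial_point D i p y - ps = ?w + trial_point D i 0 (y - dual_part D ps)"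
    by (simp add: trial_point_def dual_part_def vec_eq_iff)
  then have "norm (trial_point D i p y - ps) \<le> norm ?w + norm (trial_point D i 0 (y - dual_part D ps))"
    by (simp only: norm_triangle_ineq)
  also have "norm ?w \<le> norm (p - ps)" by (rule norm_le_componentwise_cart) simp
  also have "norm (trial_point D i 0 (y - dual_part D ps)) \<le> norm (y - dual_part D ps)"
    by (rule norm_trial_point_0)
  finally show ?thesis by simp
qed

lemma has_derivative_trial_point:
  "(trial_point D i p has_derivative trial_point D i 0) (at y)"
proof -
  have "bounded_linear (trial_point D i 0)"
    by (rule linear_conv_bounded_linear[THEN iffD1], rule linearI)
      (simp_all add: trial_point_def vec_eq_iff)
  moreover have "trial_point D i p = (\<lambda>y. trial_point D i p 0 + trial_point D i 0 y)"
    by (simp add: trial_point_def vec_eq_iff fun_eq_iff)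
  moreover have "((\<lambda>y. trial_point D i p 0 + trial_point D i 0 y) has_derivative trial_point D i 0) (at y)"
    if "bounded_linear (trial_point D i 0)"
    using has_derivative_add[OF has_derivative_const bounded_linear.has_derivative[OF that has_derivative_ident]]
    by simp
  ultimately show ?thesis by metis
qed

lemma has_derivative_comp_trial_point:
  assumes "F differentiable (at (trial_point D i p y))"
  shows "((\<lambda>y. F (trial_point D i p y)) has_derivative
    (\<lambda>v. gradient F (trial_point D i p y) \<bullet> trial_point D i 0 v)) (at y)"
  by (rule has_derivative_compose[OF has_derivative_trial_point has_derivative_gradient[OF assms]])

lemma trial_point_axis:
  "kind_of D k \<noteq> Primal \<or> owner D k = i \<Longrightarrow> trial_point D i 0 (axis k 1) = axis k 1"
  by (auto simp: trial_point_def vec_eq_iff axis_def)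

lemma partial_comp_trial_point:
  assumes "F differentiable (at (trial_point D i p y))" "kind_of D k \<noteq> Primal \<or> owner D k = i"
  shows "partial k (\<lambda>y. F (trial_point D i p y)) y = partial k F (trial_point D i p y)"
  by (rule partial_eqI[THEN trans, OF has_derivative_comp_trial_point[OF assms(1)]])
    (simp add: trial_point_axis[OF assms(2)] gradient_def inner_axis)

context
  fixes D :: "('v::finite, 'm::finite) nlp"
  assumes valid: "valid_nlp D"
begin

lemma smooth_cost: "times_cont_diff 3 (cost D i)"
  using valid by (simp add: valid_nlp_def)

lemma smooth_con: "kind_of D k \<noteq> Primal \<Longrightarrow> times_cont_diff 3 (con D k)"
  using valid by (simp add: valid_nlp_def)

lemma cost_primal_only:
  "(\<And>k. kind_of D k = Primal \<Longrightarrow> p $ k = p' $ k) \<Longrightarrow> cost D i p = cost D i p'"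
  using valid by (auto simp: valid_nlp_def depends_locally_def coords_of_def)

lemma con_primal_only:
  assumes "kind_of D m \<noteq> Primal" "\<And>k. kind_of D k = Primal \<Longrightarrow> p $ k = p' $ k"
  shows "con D m p = con D m p'"
  using valid assms unfolding valid_nlp_def depends_locally_def coords_of_def by blast

lemma local_lagrangian_eq:
  "local_lagrangian D i p = cost D i p
     + (\<Sum>m | kind_of D m \<noteq> Primal \<and> owner D m = i. p $ m * con D m p)"
proof -
  have "{m. kind_of D m \<noteq> Primal \<and> owner D m = i} = coords_of D EqMult i \<union> coords_of D IneqMult i"
    unfolding coords_of_def by (auto intro: kind.exhaust)
  moreover have "coords_of D EqMult i \<inter> coords_of D IneqMult i = {}" by (auto simp: coords_of_def)
  ultimately show ?thesis by (simp add: local_lagrangian_def sum.union_disjoint)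
qed

lemma smooth_local_lagrangian: "times_cont_diff 3 (local_lagrangian D i)"
proof -
  have "local_lagrangian D i = (\<lambda>p. cost D i p
     + (\<Sum>m | kind_of D m \<noteq> Primal \<and> owner D m = i. p $ m * con D m p))"
    by (rule ext) (rule local_lagrangian_eq)
  then show ?thesis
    by (auto intro!: times_cont_diff_add times_cont_diff_sum times_cont_diff_mult
        times_cont_diff_coordinate smooth_cost smooth_con)
qed

lemma smooth_lagrangian: "times_cont_diff 3 (lagrangian D)"
proof -
  have "lagrangian D = (\<lambda>p. \<Sum>i\<in>UNIV. local_lagrangian D i p)"
    by (rule ext) (rule lagrangian_def)
  then show ?thesis by (auto intro!: times_cont_diff_sum smooth_local_lagrangian)
qed

lemma partial_smooth: "times_cont_diff 3 F \<Longrightarrow> times_cont_diff 2 (partial k F)"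
  by (simp add: eval_nat_numeral)

lemma partial_partial_differentiable:
  "times_cont_diff 3 F \<Longrightarrow> partial l (partial k F) differentiable (at p)"
  by (simp add: eval_nat_numeral)

lemma differentiable3: "times_cont_diff 3 F \<Longrightarrow> F differentiable (at p)"
  by (simp add: eval_nat_numeral)

lemma differentiable2: "times_cont_diff 3 F \<Longrightarrow> partial k F differentiable (at p)"
  by (simp add: eval_nat_numeral)

text \<open>
  The model functions see only primal coordinates, so multipliers enter the Lagrangians linearly.
\<close>

lemma partial_multiplier_zero:
  assumes F: "times_cont_diff 3 F" and l: "kind_of D l \<noteq> Primal"
    and prim: "\<And>p p'. (\<And>k. kind_of D k = Primal \<Longrightarrow> p $ k = p' $ k) \<Longrightarrow> F p = F p'"
  shows "partial l F p = 0" "partial l (partial k F) p = 0"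
proof -
  have inv: "F (p + t *\<^sub>R axis l 1) = F p" for p t
    by (rule prim) (use l in \<open>auto simp: axis_def\<close>)
  show "partial l F p = 0"
    by (rule partial_zero_if_invariant[OF differentiable3[OF F] inv])
  show "partial l (partial k F) p = 0"
    by (rule partial_zero_if_invariant[OF differentiable2[OF F]
          partial_translation_invariant[OF differentiable3[OF F] inv]])
qed

lemmas partial_multiplier_cost = partial_multiplier_zero[OF smooth_cost _ cost_primal_only]
lemmas partial_multiplier_con =
  partial_multiplier_zero[OF smooth_con _ con_primal_only]

lemma partial_local_lagrangian:
  assumes k: "kind_of D k = Primal"
  shows "partial k (local_lagrangian D i) = (\<lambda>p. partial k (cost D i) p
    + (\<Sum>m | kind_of D m \<noteq> Primal \<and> owner D m = i. p $ m * partial k (con D m) p))"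
proof
  fix p
  let ?I = "{m. kind_of D m \<noteq> Primal \<and> owner D m = i}"
  have L: "local_lagrangian D i = (\<lambda>p. cost D i p + (\<Sum>m\<in>?I. p $ m * con D m p))"
    by (rule ext) (rule local_lagrangian_eq)
  have d: "(\<lambda>p. p $ m * con D m p) differentiable (at p)" if "m \<in> ?I" for m
    using that by (intro differentiable3 times_cont_diff_mult times_cont_diff_coordinate smooth_con) auto
  have s: "(\<lambda>p. \<Sum>m\<in>?I. p $ m * con D m p) differentiable (at p)"
    by (intro differentiable_sum ballI d) auto
  have "partial k (\<lambda>p. p $ m * con D m p) p = p $ m * partial k (con D m) p" if "m \<in> ?I" for m
  proof -
    have "partial k (\<lambda>p. p $ m * con D m p) p
        = partial k (\<lambda>p. p $ m) p * con D m p + p $ m * partial k (con D m) p"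
      using that by (intro partial_mult differentiable3 times_cont_diff_coordinate smooth_con) auto
    then show ?thesis using that k by (auto simp: partial_coordinate)
  qed
  then have "partial k (\<lambda>p. \<Sum>m\<in>?I. p $ m * con D m p) p = (\<Sum>m\<in>?I. p $ m * partial k (con D m) p)"
    using d by (subst partial_sum) (auto intro!: sum.cong)
  then show "partial k (local_lagrangian D i) p =
      partial k (cost D i) p + (\<Sum>m\<in>?I. p $ m * partial k (con D m) p)"
    unfolding L by (simp add: partial_add[OF differentiable3[OF smooth_cost] s])
qed

lemma partial_multiplier_local_lagrangian:
  assumes k: "kind_of D k = Primal" and l: "kind_of D l \<noteq> Primal"
  shows "partial l (partial k (local_lagrangian D i)) p
    = (if owner D l = i then partial k (con D l) p else 0)"
proof -
  let ?I = "{m. kind_of D m \<noteq> Primal \<and> owner D m = i}"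
  have d: "(\<lambda>p. p $ m * partial k (con D m) p) differentiable (at p)" if "m \<in> ?I" for m
    using that
    by (intro times_cont_diff_differentiable[of 2] times_cont_diff_mult times_cont_diff_coordinate
        partial_smooth smooth_con) auto
  have s: "(\<lambda>p. \<Sum>m\<in>?I. p $ m * partial k (con D m) p) differentiable (at p)"
    by (intro differentiable_sum ballI d) auto
  have "partial l (\<lambda>p. p $ m * partial k (con D m) p) p
      = (if m = l then partial k (con D l) p else 0)" if "m \<in> ?I" for m
  proof -
    have "partial l (\<lambda>p. p $ m * partial k (con D m) p) p
        = partial l (\<lambda>p. p $ m) p * partial k (con D m) p + p $ m * partial l (partial k (con D m)) p"
      using that by (intro partial_mult differentiable3 differentiable2 times_cont_diff_coordinate smooth_con) auto
    then show ?thesis using that l by (simp add: partial_coordinate partial_multiplier_con)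
  qed
  then have "partial l (\<lambda>p. \<Sum>m\<in>?I. p $ m * partial k (con D m) p) p
      = (\<Sum>m\<in>?I. if m = l then partial k (con D l) p else 0)"
    using d by (subst partial_sum) (auto intro!: sum.cong)
  then have "partial l (partial k (local_lagrangian D i)) p
      = (\<Sum>m\<in>?I. if m = l then partial k (con D l) p else 0)"
    unfolding partial_local_lagrangian[OF k]
    by (simp add: partial_add[OF differentiable2[OF smooth_cost] s] partial_multiplier_cost l)
  then show ?thesis using l by simp
qed

lemma partial_lagrangian: "partial k (lagrangian D) = (\<lambda>p. \<Sum>i\<in>UNIV. partial k (local_lagrangian D i) p)"
proof
  fix p
  have "lagrangian D = (\<lambda>p. \<Sum>i\<in>UNIV. local_lagrangian D i p)" by (rule ext) (rule lagrangian_def)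
  then show "partial k (lagrangian D) p = (\<Sum>i\<in>UNIV. partial k (local_lagrangian D i) p)"
    by (simp add: partial_sum differentiable3[OF smooth_local_lagrangian])
qed

lemma partial_multiplier_lagrangian:
  assumes k: "kind_of D k = Primal" and l: "kind_of D l \<noteq> Primal"
  shows "partial l (partial k (lagrangian D)) p = partial k (con D l) p"
  unfolding partial_lagrangian
  by (subst partial_sum)
    (simp_all add: differentiable2[OF smooth_local_lagrangian] partial_multiplier_local_lagrangian[OF k l])

text \<open>
  Neighborhood is symmetric, so an agent that is no neighbor of the owner of \<open>k\<close> does not see
  coordinate \<open>k\<close>.
\<close>

lemma partial_foreign_lagrangian:
  assumes k: "kind_of D k = Primal" and j: "j \<noteq> owner D k" "j \<notin> neighbors D (owner D k)"
  shows "partial k (local_lagrangian D j) p = 0"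
proof (rule partial_zero_if_invariant[OF differentiable3[OF smooth_local_lagrangian]])
  fix p and t :: real
  have "(j, owner D k) \<notin> edges D"
    using valid j by (auto simp: valid_nlp_def neighbors_def dest: symD)
  then have far: "owner D k \<notin> insert j (neighbors D j)" using j(1) by (auto simp: neighbors_def)
  have same: "F (p + t *\<^sub>R axis k 1) = F p" if "depends_locally D j F" for F
  proof -
    have "(p + t *\<^sub>R axis k 1) $ l = p $ l" if "i \<in> insert j (neighbors D j)" "l \<in> coords_of D Primal i" for i l
      using that far by (auto simp: coords_of_def axis_def)
    with that show ?thesis unfolding depends_locally_def by blast
  qed
  have "cost D j (p + t *\<^sub>R axis k 1) = cost D j p"
    using valid by (intro same) (simp add: valid_nlp_def)
  moreover have "con D m (p + t *\<^sub>R axis k 1) = con D m p"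
    if "kind_of D m \<noteq> Primal" "owner D m = j" for m
    using valid that by (intro same) (auto simp: valid_nlp_def)
  moreover have "(p + t *\<^sub>R axis k 1) $ m = p $ m" if "kind_of D m \<noteq> Primal" for m
    using that k by (auto simp: axis_def)
  ultimately show "local_lagrangian D j (p + t *\<^sub>R axis k 1) = local_lagrangian D j p"
    unfolding local_lagrangian_eq by (auto intro!: sum.cong)
qed

text \<open>
  With zero displacement the gradient of an agent's own Lagrangian and the sensitivities of its
  neighbors add up to the central gradient, all other Lagrangians being independent of the variable.
\<close>

lemma local_residual_at_dual_part:
  "local_residual D \<rho> \<beta> p (dual_part D p) = central_residual D \<beta> p"
proof -
  have "partial k (lagrangian D) p = partial k (local_lagrangian D (owner D k)) p
      + (\<Sum>j\<in>neighbors D (owner D k). partial k (local_lagrangian D j) p)"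
    if k: "kind_of D k = Primal" for k
  proof -
    have "partial k (lagrangian D) p
        = (\<Sum>j\<in>insert (owner D k) (neighbors D (owner D k)). partial k (local_lagrangian D j) p)"
      unfolding partial_lagrangian
      by (rule sum.mono_neutral_right) (auto simp: partial_foreign_lagrangian[OF k])
    then show ?thesis by (simp add: neighbors_def)
  qed
  moreover have "dual_part D p $ k = 0" if "kind_of D k = Primal" for k
    using that by (simp add: dual_part_def)
  ultimately show ?thesis
    by (auto simp: local_residual_def central_residual_def trial_point_dual_part local_row_def
        kkt_row_def vec_eq_iff split: kind.splits)
qed

lemma smooth_kkt_row:
  assumes "times_cont_diff 3 Lg"
  shows "times_cont_diff 2 (kkt_row D \<beta> Lg k)"
proof -
  have c: "times_cont_diff 2 (con D k)" if "kind_of D k \<noteq> Primal"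
    using times_cont_diff_SucD[of 2 "con D k"] smooth_con[OF that] by (simp add: eval_nat_numeral)
  show ?thesis
  proof (cases "kind_of D k")
    case Primal
    then have "kkt_row D \<beta> Lg k = partial k Lg" by (simp add: kkt_row_def fun_eq_iff)
    then show ?thesis using partial_smooth[OF assms] by simp
  next
    case EqMult
    then have row: "kkt_row D \<beta> Lg k = (\<lambda>p. - \<beta> * con D k p)"
      by (simp add: kkt_row_def fun_eq_iff)
    show ?thesis
      unfolding row by (rule times_cont_diff_mult[OF times_cont_diff_const c]) (simp add: EqMult)
  next
    case IneqMult
    then have row: "kkt_row D \<beta> Lg k = (\<lambda>p. - \<beta> * (p $ k * con D k p))"
      by (simp add: kkt_row_def fun_eq_iff)
    show ?thesis
      unfolding row
      by (intro times_cont_diff_mult[OF times_cont_diff_const]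
          times_cont_diff_mult[OF times_cont_diff_coordinate c]) (simp add: IneqMult)
  qed
qed

lemma smooth_local_row: "times_cont_diff 2 (local_row D \<beta> k)"
  unfolding local_row_def by (rule smooth_kkt_row[OF smooth_local_lagrangian])

lemma partial_dual_row:
  assumes k: "kind_of D k \<noteq> Primal"
  shows "partial l (kkt_row D \<beta> Lg k) p = (if kind_of D k = EqMult then - \<beta> * partial l (con D k) p
    else - \<beta> * (p $ k * partial l (con D k) p) + (if l = k then - \<beta> * con D k p else 0))"
proof -
  have d: "con D k differentiable (at p)" by (rule differentiable3[OF smooth_con[OF k]])
  have d1: "(\<lambda>p. p $ k) differentiable (at p)"
    by (rule differentiable3[OF times_cont_diff_coordinate])
  have d2: "(\<lambda>p. p $ k * con D k p) differentiable (at p)"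
    by (rule differentiable_mult[OF d1 d])
  have c: "(\<lambda>p. - \<beta>) differentiable (at p)" by simp
  show ?thesis
  proof (cases "kind_of D k")
    case EqMult
    then have "kkt_row D \<beta> Lg k = (\<lambda>p. - \<beta> * con D k p)" by (simp add: kkt_row_def fun_eq_iff)
    then show ?thesis using EqMult partial_mult[OF c d] by (simp add: partial_const)
  next
    case IneqMult
    then have "kkt_row D \<beta> Lg k = (\<lambda>p. - \<beta> * (p $ k * con D k p))" by (simp add: kkt_row_def fun_eq_iff)
    then show ?thesis using IneqMult partial_mult[OF c d2] partial_mult[OF d1 d]
      by (simp add: partial_const partial_coordinate algebra_simps)
  qed (use k in simp)
qed

lemma bar_con_eq:
  assumes "kind_of D k \<noteq> Primal"
  shows "bar_con D k p = (\<lambda>y. con D k (trial_point D (owner D k) p y))"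
  unfolding bar_con_def
  by (intro ext con_primal_only[OF assms]) (simp add: shift_def trial_point_def coords_of_def)

lemma partial_bar_con:
  assumes k: "kind_of D k \<noteq> Primal" and l: "owner D l = owner D k"
  shows "partial l (bar_con D k p) y = partial l (con D k) (trial_point D (owner D k) p y)"
  unfolding bar_con_eq[OF k]
  by (rule partial_comp_trial_point) (use l in \<open>auto intro: differentiable3 smooth_con[OF k]\<close>)

text \<open>
  The local Lagrangian of the subproblem is the original one, read at the trial point, up to a
  separable quadratic in the displacement.
\<close>

lemma bar_lagrangian_eq:
  "bar_lagrangian D \<rho> i p = (\<lambda>y. local_lagrangian D i (trial_point D i p y)
     + (\<Sum>k\<in>coords_of D Primal i. \<rho> i / 2 * (y $ k * y $ k)
          + (\<Sum>j\<in>neighbors D i. partial k (local_lagrangian D j) p) * y $ k))"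
proof
  fix y
  have "cost D i (shift D i p y) = cost D i (trial_point D i p y)"
    by (rule cost_primal_only) (simp add: shift_def trial_point_def coords_of_def)
  moreover have "bar_con D k p y = con D k (trial_point D i p y)"
    if "k \<in> coords_of D EqMult i \<or> k \<in> coords_of D IneqMult i" for k
    using that bar_con_eq[of k p] by (auto simp: coords_of_def)
  moreover have "trial_point D i p y $ k = y $ k"
    if "k \<in> coords_of D EqMult i \<or> k \<in> coords_of D IneqMult i" for k
    using that by (auto simp: trial_point_def coords_of_def)
  moreover have "(\<Sum>j\<in>neighbors D i. \<Sum>k\<in>coords_of D Primal i. partial k (local_lagrangian D j) p * y $ k)
      = (\<Sum>k\<in>coords_of D Primal i. (\<Sum>j\<in>neighbors D i. partial k (local_lagrangian D j) p) * y $ k)"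
    by (subst sum.swap) (simp add: sum_distrib_right)
  ultimately show "bar_lagrangian D \<rho> i p y = local_lagrangian D i (trial_point D i p y)
     + (\<Sum>k\<in>coords_of D Primal i. \<rho> i / 2 * (y $ k * y $ k)
          + (\<Sum>j\<in>neighbors D i. partial k (local_lagrangian D j) p) * y $ k)"
    by (simp add: bar_lagrangian_def bar_cost_def local_lagrangian_def sum.distrib
        sum_distrib_left power2_eq_square)
qed

lemma partial_bar_lagrangian:
  assumes k: "kind_of D k = Primal"
  shows "partial k (bar_lagrangian D \<rho> (owner D k) p) =
    (\<lambda>y. partial k (local_lagrangian D (owner D k)) (trial_point D (owner D k) p y)
      + (\<rho> (owner D k) * y $ k
         + (\<Sum>j\<in>neighbors D (owner D k). partial k (local_lagrangian D j) p)))"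
proof
  fix y :: "real^'m"
  let ?i = "owner D k" and ?X = "coords_of D Primal (owner D k)"
  define c where "c l = (\<Sum>j\<in>neighbors D ?i. partial l (local_lagrangian D j) p)" for l
  have "((\<lambda>y. \<Sum>l\<in>?X. \<rho> ?i / 2 * (y $ l * y $ l) + c l * y $ l) has_derivative
      (\<lambda>v. \<Sum>l\<in>?X. (\<rho> ?i * y $ l + c l) * v $ l)) (at y)"
    by (intro has_derivative_sum)
      (auto intro!: derivative_eq_intros has_derivative_coordinate simp: algebra_simps)
  note d = has_derivative_add[OF has_derivative_comp_trial_point[OF
        differentiable3[OF smooth_local_lagrangian]] this]
  have "partial k (bar_lagrangian D \<rho> ?i p) y
      = gradient (local_lagrangian D ?i) (trial_point D ?i p y) \<bullet> trial_point D ?i 0 (axis k 1)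
        + (\<Sum>l\<in>?X. (\<rho> ?i * y $ l + c l) * axis k 1 $ l)"
    unfolding bar_lagrangian_eq c_def[symmetric] by (rule partial_eqI[OF d])
  also have "(\<Sum>l\<in>?X. (\<rho> ?i * y $ l + c l) * axis k 1 $ l) = \<rho> ?i * y $ k + c k"
  proof -
    have "(\<Sum>l\<in>?X. (\<rho> ?i * y $ l + c l) * axis k 1 $ l)
        = (\<Sum>l\<in>?X. if l = k then \<rho> ?i * y $ k + c k else 0)"
      by (intro sum.cong) (auto simp: axis_def)
    then show ?thesis using k by (simp add: coords_of_def)
  qed
  finally show "partial k (bar_lagrangian D \<rho> ?i p) y =
      partial k (local_lagrangian D ?i) (trial_point D ?i p y) + (\<rho> ?i * y $ k + c k)"
    by (simp add: trial_point_axis gradient_def inner_axis)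
qed

lemma hessian_bar_lagrangian:
  assumes k: "kind_of D k = Primal" and l: "kind_of D l = Primal" and own: "owner D l = owner D k"
  shows "hessian (bar_lagrangian D \<rho> (owner D k) p) y $ k $ l
    = partial k (partial l (local_lagrangian D (owner D k))) (trial_point D (owner D k) p y)
      + (if k = l then \<rho> (owner D k) else 0)"
proof -
  let ?i = "owner D k"
  define c where "c = (\<Sum>j\<in>neighbors D ?i. partial l (local_lagrangian D j) p)"
  have "((\<lambda>y. \<rho> ?i * y $ l + c) has_derivative (\<lambda>v. \<rho> ?i * v $ l)) (at y)"
    by (auto intro!: derivative_eq_intros has_derivative_coordinate)
  note d = has_derivative_add[OF has_derivative_comp_trial_point[OF
        differentiable2[OF smooth_local_lagrangian]] this]
  have "partial l (bar_lagrangian D \<rho> ?i p) =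
      (\<lambda>y. partial l (local_lagrangian D ?i) (trial_point D ?i p y) + (\<rho> ?i * y $ l + c))"
    using partial_bar_lagrangian[OF l] by (simp add: own c_def)
  then have "partial k (partial l (bar_lagrangian D \<rho> ?i p)) y
      = gradient (partial l (local_lagrangian D ?i)) (trial_point D ?i p y) \<bullet> trial_point D ?i 0 (axis k 1)
        + \<rho> ?i * axis k 1 $ l"
    using partial_eqI[OF d] by simp
  then show ?thesis
    by (simp add: hessian_def trial_point_axis gradient_inner_axis) (simp add: axis_def)
qed

lemma P_matrix_eq:
  "P_matrix D \<rho> \<beta> p y $ k $ l = local_block D \<rho> \<beta> k l (trial_point D (owner D k) p y)"
proof (cases "owner D k = owner D l")
  case True
  note own = True[symmetric]
  have z: "trial_point D (owner D k) p y $ k = y $ k" if "kind_of D k \<noteq> Primal"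
    using that by (simp add: trial_point_def)
  let ?z = "trial_point D (owner D k) p y"
  have h: "hessian (bar_lagrangian D \<rho> (owner D k) p) y $ k $ l
      = partial k (partial l (local_lagrangian D (owner D k))) ?z + (if k = l then \<rho> (owner D k) else 0)"
    if "kind_of D k = Primal" "kind_of D l = Primal"
    by (rule hessian_bar_lagrangian[OF that own])
  have pk: "partial k (bar_con D l p) y = partial k (con D l) ?z" if "kind_of D l \<noteq> Primal"
    using partial_bar_con[OF that True] by (simp only: own)
  have pl: "partial l (bar_con D k p) y = partial l (con D k) ?z" if "kind_of D k \<noteq> Primal"
    by (rule partial_bar_con[OF that own])
  have bc: "bar_con D k p y = con D k ?z" if "kind_of D k \<noteq> Primal"
    using fun_cong[OF bar_con_eq[OF that]] .
  show ?thesis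
    using True h z pk pl bc
    by (cases "k = l") (simp_all add: P_matrix_def local_block_def split: kind.split)
qed (simp add: P_matrix_def local_block_def)

end

section \<open>Linearization at the KKT point\<close>

lemma linearization_error_family:
  fixes R :: "'k::finite \<Rightarrow> real^'m \<Rightarrow> real"
  assumes "\<And>k. times_cont_diff 2 (R k)"
  shows "\<exists>K\<ge>0. \<exists>\<delta>>0. \<forall>k z z'. norm (z - a) < \<delta> \<longrightarrow> norm (z' - a) < \<delta> \<longrightarrow>
    \<bar>R k z - R k z' - gradient (R k) a \<bullet> (z - z')\<bar> \<le> K * ((norm (z - a) + norm (z' - a)) * norm (z - z'))"
proof -
  have "\<exists>K\<ge>0. \<exists>\<delta>>0. \<forall>x. max (norm (fst x - a)) (norm (snd x - a)) < \<delta> \<longrightarrow>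
      \<bar>R k (fst x) - R k (snd x) - gradient (R k) a \<bullet> (fst x - snd x)\<bar>
        \<le> K * ((norm (fst x - a) + norm (snd x - a)) * norm (fst x - snd x))" for k
    using linearization_error[OF assms, of a k] by force
  from uniform_local_constants[where d = "\<lambda>x. max (norm (fst x - a)) (norm (snd x - a))"
      and Q = "\<lambda>k x. \<bar>R k (fst x) - R k (snd x) - gradient (R k) a \<bullet> (fst x - snd x)\<bar>"
      and R = "\<lambda>x. (norm (fst x - a) + norm (snd x - a)) * norm (fst x - snd x)", OF this]
  obtain K \<delta> where "K \<ge> 0" "\<delta> > 0"
    and *: "\<And>k x. max (norm (fst x - a)) (norm (snd x - a)) < \<delta> \<Longrightarrow>
      \<bar>R k (fst x) - R k (snd x) - gradient (R k) a \<bullet> (fst x - snd x)\<bar>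
        \<le> K * ((norm (fst x - a) + norm (snd x - a)) * norm (fst x - snd x))"
    by (metis (no_types, lifting) add_nonneg_nonneg mult_nonneg_nonneg norm_ge_zero)
  have "\<bar>R k z - R k z' - gradient (R k) a \<bullet> (z - z')\<bar>
      \<le> K * ((norm (z - a) + norm (z' - a)) * norm (z - z'))"
    if "norm (z - a) < \<delta>" "norm (z' - a) < \<delta>" for k z z'
    using *[of "(z, z')" k] that by simp
  with \<open>K \<ge> 0\<close> \<open>\<delta> > 0\<close> show ?thesis by blast
qed

lemma norm_le_card_mult_bound:
  fixes x :: "real^'m" and B :: real
  assumes "\<And>k. \<bar>x $ k\<bar> \<le> B"
  shows "norm x \<le> CARD('m) * B"
  using norm_le_l1_cart[of x] sum_mono[of UNIV "\<lambda>k. \<bar>x $ k\<bar>" "\<lambda>_. B"] assms by simp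

context
  fixes D :: "('v::finite, 'm::finite) nlp" and \<rho> :: "'v \<Rightarrow> real" and \<beta> :: real and ps :: "real^'m"
  assumes valid: "valid_nlp D" and \<beta>: "\<beta> > 0"
    and kkt: "kkt_point D ps" and sc: "strict_complementarity D ps"
begin

lemma active_multiplier_pos: "k \<in> active D ps \<Longrightarrow> ps $ k > 0"
  using sc by (simp add: strict_complementarity_def)

lemma inactive_neg:
  assumes "kind_of D k = IneqMult" "k \<notin> active D ps"
  shows "con D k ps < 0" "ps $ k = 0"
proof -
  have "con D k ps \<le> 0" "ps $ k * con D k ps = 0" "con D k ps \<noteq> 0"
    using kkt assms by (auto simp: kkt_point_def active_def coords_def)
  then show "con D k ps < 0" "ps $ k = 0" by auto
qed

text \<open>
  \<open>A\<close> stores second derivatives in the transposed order; the symmetry of the Hessian that is part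
  of the second-order condition reconciles them.
\<close>

lemma A_matrix_row:
  assumes sosc: "uniform_sosc D ps"
  shows "(A_matrix D \<beta> ps *v v) $ k = gradient (kkt_row D \<beta> (lagrangian D) k) ps \<bullet> v"
proof -
  have "A_matrix D \<beta> ps $ k $ l = partial l (kkt_row D \<beta> (lagrangian D) k) ps" for l
  proof (cases "kind_of D k = Primal")
    case True
    then have "kkt_row D \<beta> (lagrangian D) k = partial k (lagrangian D)"
      by (simp add: kkt_row_def fun_eq_iff)
    moreover have "hessian (lagrangian D) ps $ k $ l = hessian (lagrangian D) ps $ l $ k"
      if "kind_of D l = Primal"
      using sosc True that by (simp add: uniform_sosc_def pos_def_on_def coords_def)
    moreover have "partial l (partial k (lagrangian D)) ps = partial k (con D l) ps"
      if "kind_of D l \<noteq> Primal"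
      by (rule partial_multiplier_lagrangian[OF valid True that])
    ultimately show ?thesis
      using True by (simp add: A_matrix_def hessian_def split: kind.split)
  next
    case False
    have "partial l (con D k) ps = 0" if "kind_of D l \<noteq> Primal"
      by (rule partial_multiplier_con[OF valid False that False])
    then show ?thesis
      using False
      by (cases "k = l") (simp_all add: A_matrix_def partial_dual_row[OF valid] split: kind.split)
  qed
  then show ?thesis by (simp add: matrix_vector_mult_def gradient_def inner_vec_def)
qed

text \<open>
  At the solution, the update matrix is the derivative of the local residual with respect to \<open>y\<close>,
  that is, the derivative of each row composed with the linear part of the trial point.
\<close>

lemma P_matrix_row:
  assumes conv: "local_convexity D \<rho> ps"
  shows "(P_matrix D \<rho> \<beta> ps (dual_part D ps) *v v) $ k
    = gradient (local_row D \<beta> k) ps \<bullet> trial_point D (owner D k) 0 v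
      + (if kind_of D k = Primal then \<rho> (owner D k) * v $ k else 0)"
proof -
  let ?i = "owner D k" and ?M = "P_matrix D \<rho> \<beta> ps (dual_part D ps)"
  let ?in = "\<lambda>l. kind_of D l \<noteq> Primal \<or> owner D l = ?i"
  have entry: "?M $ k $ l = (if ?in l then partial l (local_row D \<beta> k) ps else 0)
      + (if k = l \<and> kind_of D k = Primal then \<rho> ?i else 0)" for l
  proof (cases "kind_of D k = Primal")
    case True
    then have row: "local_row D \<beta> k = partial k (local_lagrangian D ?i)"
      by (simp add: local_row_def kkt_row_def fun_eq_iff)
    have "partial k (partial l (local_lagrangian D ?i)) ps = partial l (partial k (local_lagrangian D ?i)) ps"
      if "kind_of D l = Primal" "owner D l = ?i"
    proof (cases "k = l")
      case False
      have "k \<in> coords_of D Primal ?i" "l \<in> coords_of D Primal ?i"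
        using that True by (auto simp: coords_of_def)
      then have "(hessian (local_lagrangian D ?i) ps + \<rho> ?i *\<^sub>R mat 1) $ k $ l
          = (hessian (local_lagrangian D ?i) ps + \<rho> ?i *\<^sub>R mat 1) $ l $ k"
        using conv unfolding local_convexity_def pos_def_on_def by blast
      then show ?thesis using False by (simp add: hessian_def mat_def)
    qed simp
    moreover have "partial l (partial k (local_lagrangian D ?i)) ps
        = (if owner D l = ?i then partial k (con D l) ps else 0)" if "kind_of D l \<noteq> Primal"
      by (rule partial_multiplier_local_lagrangian[OF valid True that])
    ultimately show ?thesis
      unfolding P_matrix_eq[OF valid] trial_point_dual_part row
      using True by (auto simp: local_block_def split: kind.split)
  next
    case False
    have "partial l (con D k) ps = 0" if "kind_of D l \<noteq> Primal"
      by (rule partial_multiplier_con[OF valid False that False])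
    then show ?thesis
      unfolding P_matrix_eq[OF valid] trial_point_dual_part local_row_def
      using False
      by (cases "k = l") (auto simp: local_block_def partial_dual_row[OF valid] split: kind.split)
  qed
  have "?M $ k $ l * v $ l = partial l (local_row D \<beta> k) ps * trial_point D ?i 0 v $ l
      + (if k = l then (if kind_of D k = Primal then \<rho> ?i * v $ k else 0) else 0)" for l
    unfolding entry by (auto simp: trial_point_def algebra_simps)
  then show ?thesis
    by (simp add: matrix_vector_mult_def gradient_def inner_vec_def sum.distrib)
qed

text \<open>
  The second-order condition gives the positive primal block, LICQ the injective coupling, and strict
  complementarity the signs on the active and the inactive multipliers.
\<close>

lemma stability_matrix:
  assumes sosc: "uniform_sosc D ps" and licq: "licq D ps"
  shows "\<exists>W. pos_def W \<and> (\<forall>v. v \<noteq> 0 \<longrightarrow> v \<bullet> (W *v (A_matrix D \<beta> ps *v v)) > 0)"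
proof (rule saddle_matrix_lyapunov[where X = "coords D Primal" and E = "coords D EqMult \<union> active D ps"
      and \<tau> = "\<lambda>k. if kind_of D k = EqMult then \<beta> else \<beta> * ps $ k"])
  let ?A = "A_matrix D \<beta> ps" and ?X = "coords D Primal" and ?E = "coords D EqMult \<union> active D ps"
  show "?X \<inter> ?E = {}" by (auto simp: coords_def active_def)
  show "?A $ k $ l = - (if kind_of D k = EqMult then \<beta> else \<beta> * ps $ k) * ?A $ l $ k"
    if "k \<notin> ?X" "l \<in> ?X" for k l
    using that by (auto simp: A_matrix_def coords_def split: kind.split)
  show "?A $ k $ l = 0" if "k \<notin> ?X" "l \<notin> ?X" "k \<noteq> l" for k l
    using that by (auto simp: A_matrix_def coords_def split: kind.split)
  show "0 < (if kind_of D k = EqMult then \<beta> else \<beta> * ps $ k) \<and> ?A $ k $ k = 0" if "k \<in> ?E" for k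
    using that \<beta> active_multiplier_pos[of k]
    by (auto simp: A_matrix_def coords_def active_def)
  show "(if kind_of D k = EqMult then \<beta> else \<beta> * ps $ k) = 0 \<and> 0 < ?A $ k $ k"
    if "k \<notin> ?X" "k \<notin> ?E" for k
  proof -
    have "kind_of D k = IneqMult" "k \<notin> active D ps"
      using that by (cases "kind_of D k"; auto simp: coords_def)+
    then show ?thesis using inactive_neg[of k] \<beta> by (simp add: A_matrix_def mult_pos_neg)
  qed
  show "v \<bullet> (?A *v v) > 0" if "v \<noteq> 0" "\<And>k. k \<notin> ?X \<Longrightarrow> v $ k = 0" for v
  proof -
    have "v $ k * ?A $ k $ l * v $ l = v $ k * hessian (lagrangian D) ps $ k $ l * v $ l" for k l
      using that(2)[of k] that(2)[of l] by (auto simp: A_matrix_def coords_def split: kind.split)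
    then have "v \<bullet> (?A *v v) = v \<bullet> (hessian (lagrangian D) ps *v v)"
      unfolding inner_matrix_sum by (intro sum.cong refl)
    then show ?thesis using sosc that by (simp add: uniform_sosc_def pos_def_on_def)
  qed
  show "v = 0" if v: "\<And>k. k \<notin> ?E \<Longrightarrow> v $ k = 0" and Av: "\<And>k. k \<in> ?X \<Longrightarrow> (?A *v v) $ k = 0" for v
  proof (rule full_column_rank_injective)
    let ?C = "constraint_gradients D ps ?X ?E"
    show "rank ?C = card ?E" using licq by (simp add: licq_def Let_def)
    show "?C *v v = 0"
    proof (subst vec_eq_iff, intro allI)
      fix l
      have "?C $ l $ k * v $ k = (if l \<in> ?X then ?A $ l $ k * v $ k else 0)" for k
        using v[of k] by (auto simp: constraint_gradients_def A_matrix_def coords_def active_def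
            split: kind.split)
      then have "(?C *v v) $ l = (if l \<in> ?X then (?A *v v) $ l else 0)"
        by (simp add: matrix_vector_mult_def)
      then show "(?C *v v) $ l = 0 $ l" using Av by simp
    qed
  qed (use v in \<open>auto simp: constraint_gradients_def\<close>)
qed

text \<open>
  The same structure as for the central matrix, agent by agent: the primal block is a direct sum of
  the convexified local Hessians, and the coupling only joins coordinates of the same owner.
\<close>

lemma local_matrix_injective:
  assumes conv: "local_convexity D \<rho> ps" and comp: "constraint_compatible D ps"
    and zero: "P_matrix D \<rho> \<beta> ps (dual_part D ps) *v v = 0"
  shows "v = 0"
proof -
  let ?P = "P_matrix D \<rho> \<beta> ps (dual_part D ps)"
  let ?X = "coords D Primal" and ?E = "coords D EqMult \<union> active D ps"
  have P: "?P $ k $ l = local_block D \<rho> \<beta> k l ps" for k l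
    unfolding P_matrix_eq[OF valid] trial_point_dual_part by simp
  have "\<exists>W. pos_def W \<and> (\<forall>v. v \<noteq> 0 \<longrightarrow> v \<bullet> (W *v (?P *v v)) > 0)"
  proof (rule saddle_matrix_lyapunov[where X = ?X and E = ?E
        and \<tau> = "\<lambda>k. if kind_of D k = EqMult then \<beta> else \<beta> * ps $ k"])
    show "?X \<inter> ?E = {}" by (auto simp: coords_def active_def)
    show "?P $ k $ l = - (if kind_of D k = EqMult then \<beta> else \<beta> * ps $ k) * ?P $ l $ k"
      if "k \<notin> ?X" "l \<in> ?X" for k l
      using that by (auto simp: P local_block_def coords_def split: kind.split)
    show "?P $ k $ l = 0" if "k \<notin> ?X" "l \<notin> ?X" "k \<noteq> l" for k l
      using that by (auto simp: P local_block_def coords_def split: kind.split)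
    show "0 < (if kind_of D k = EqMult then \<beta> else \<beta> * ps $ k) \<and> ?P $ k $ k = 0" if "k \<in> ?E" for k
      using that \<beta> active_multiplier_pos[of k]
      by (auto simp: P local_block_def coords_def active_def)
    show "(if kind_of D k = EqMult then \<beta> else \<beta> * ps $ k) = 0 \<and> 0 < ?P $ k $ k"
      if "k \<notin> ?X" "k \<notin> ?E" for k
    proof -
      have "kind_of D k = IneqMult" "k \<notin> active D ps"
        using that by (cases "kind_of D k"; auto simp: coords_def)+
      then show ?thesis using inactive_neg[of k] \<beta> by (simp add: P local_block_def mult_pos_neg)
    qed
    show "v \<bullet> (?P *v v) > 0" if v: "v \<noteq> 0" "\<And>k. k \<notin> ?X \<Longrightarrow> v $ k = 0" for v
    proof -
      define vi where "vi i = (\<chi> k. if owner D k = i then v $ k else 0)" for i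
      define H where "H i = hessian (local_lagrangian D i) ps + \<rho> i *\<^sub>R mat 1" for i
      have H_pos: "vi i \<bullet> (H i *v vi i) > 0" if "vi i \<noteq> 0" for i
      proof -
        have "\<forall>k. k \<notin> coords_of D Primal i \<longrightarrow> vi i $ k = 0"
          using v(2) by (auto simp: vi_def coords_of_def coords_def)
        then show ?thesis using conv that unfolding H_def local_convexity_def pos_def_on_def by blast
      qed
      have H_nonneg: "vi i \<bullet> (H i *v vi i) \<ge> 0" for i
        using H_pos[of i] by (cases "vi i = 0") auto
      have "(\<Sum>i\<in>UNIV. vi i $ k * H i $ k $ l * vi i $ l) = v $ k * ?P $ k $ l * v $ l" for k l
      proof -
        have "(\<Sum>i\<in>UNIV. vi i $ k * H i $ k $ l * vi i $ l)
            = (\<Sum>i\<in>UNIV. if i = owner D k then (if owner D l = owner D k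
                then v $ k * H (owner D k) $ k $ l * v $ l else 0) else 0)"
          by (intro sum.cong) (auto simp: vi_def)
        also have "\<dots> = v $ k * ?P $ k $ l * v $ l"
          using v(2)[of k] v(2)[of l]
          by (auto simp: P local_block_def H_def hessian_def mat_def coords_def split: kind.split)
        finally show ?thesis .
      qed
      then have "v \<bullet> (?P *v v) = (\<Sum>k\<in>UNIV. \<Sum>l\<in>UNIV. \<Sum>i\<in>UNIV. vi i $ k * H i $ k $ l * vi i $ l)"
        unfolding inner_matrix_sum by (intro sum.cong refl) (rule sym)
      also have "\<dots> = (\<Sum>k\<in>UNIV. \<Sum>i\<in>UNIV. \<Sum>l\<in>UNIV. vi i $ k * H i $ k $ l * vi i $ l)"
        by (intro sum.cong refl sum.swap)
      also have "\<dots> = (\<Sum>i\<in>UNIV. vi i \<bullet> (H i *v vi i))"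
        unfolding inner_matrix_sum by (rule sum.swap)
      also have "\<dots> > 0"
      proof -
        obtain k where k: "v $ k \<noteq> 0" using v(1) by (auto simp: vec_eq_iff)
        then have "vi (owner D k) $ k \<noteq> 0" by (simp add: vi_def)
        then have "vi (owner D k) \<noteq> 0" by (metis zero_index)
        then show ?thesis
          by (intro sum_pos2[where i = "owner D k"] H_pos H_nonneg) simp_all
      qed
      finally show ?thesis .
    qed
    show "v = 0" if v: "\<And>k. k \<notin> ?E \<Longrightarrow> v $ k = 0" and Pv: "\<And>k. k \<in> ?X \<Longrightarrow> (?P *v v) $ k = 0" for v
    proof -
      have "(\<chi> k. if owner D k = i then v $ k else 0) = 0" for i
      proof (rule full_column_rank_injective)
        let ?v = "\<chi> k. if owner D k = i then v $ k else 0"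
        let ?Xi = "coords_of D Primal i"
        let ?S = "coords_of D EqMult i \<union> (coords_of D IneqMult i \<inter> active D ps)"
        let ?C = "constraint_gradients D ps ?Xi ?S"
        show "rank ?C = card ?S" using comp by (simp add: constraint_compatible_def Let_def)
        show "?C $ l $ k = 0" if "k \<notin> ?S" for l k
          using that by (auto simp: constraint_gradients_def)
        show "?v $ k = 0" if "k \<notin> ?S" for k
          using that v[of k] by (auto simp: coords_of_def coords_def active_def)
        show "?C *v ?v = 0"
        proof (subst vec_eq_iff, intro allI)
          fix l
          have "?C $ l $ k * ?v $ k = (if l \<in> ?Xi then ?P $ l $ k * v $ k else 0)" for k
            using v[of k] by (auto simp: constraint_gradients_def P local_block_def coords_of_def
                coords_def active_def split: kind.split)
          then have "(?C *v ?v) $ l = (if l \<in> ?Xi then (?P *v v) $ l else 0)"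
            by (simp add: matrix_vector_mult_def)
          then show "(?C *v ?v) $ l = 0 $ l" using Pv[of l] by (simp add: coords_of_def coords_def)
        qed
      qed
      then have "(\<chi> k. if owner D k = i then v $ k else 0) $ k = 0" for i k by (metis zero_index)
      from this[of "owner D k" k for k] show ?thesis by (simp add: vec_eq_iff)
    qed
  qed
  then show ?thesis using zero by (metis inner_zero_right less_irrefl matrix_vector_mult_0_right)
qed

section \<open>Local KKT systems as equations\<close>

text \<open>
  Under strict complementarity the signs of the active multipliers and of the inactive constraints
  persist near the solution, so there the inequalities of the local KKT systems are automatic and
  the systems reduce to equations.
\<close>

lemma local_kkt_iff_residual_zero:
  assumes signs: "\<And>k. kind_of D k = IneqMult \<Longrightarrow>
      if k \<in> active D ps then y $ k > 0 else con D k (trial_point D (owner D k) p y) < 0"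
  shows "(\<forall>i. local_kkt D \<rho> i p y) \<longleftrightarrow> local_residual D \<rho> \<beta> p y = 0"
proof -
  have "(\<forall>i. local_kkt D \<rho> i p y) \<longleftrightarrow>
    (\<forall>k. (kind_of D k = Primal \<longrightarrow> partial k (bar_lagrangian D \<rho> (owner D k) p) y = 0) \<and>
      (kind_of D k = EqMult \<longrightarrow> bar_con D k p y = 0) \<and>
      (kind_of D k = IneqMult \<longrightarrow>
        bar_con D k p y \<le> 0 \<and> y $ k \<ge> 0 \<and> y $ k * bar_con D k p y = 0))"
    unfolding local_kkt_def coords_of_def by auto
  also have "\<dots> \<longleftrightarrow> (\<forall>k. local_residual D \<rho> \<beta> p y $ k = 0)"
  proof (rule all_cong1)
    fix k
    show "((kind_of D k = Primal \<longrightarrow> partial k (bar_lagrangian D \<rho> (owner D k) p) y = 0) \<and>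
      (kind_of D k = EqMult \<longrightarrow> bar_con D k p y = 0) \<and>
      (kind_of D k = IneqMult \<longrightarrow>
        bar_con D k p y \<le> 0 \<and> y $ k \<ge> 0 \<and> y $ k * bar_con D k p y = 0))
      \<longleftrightarrow> local_residual D \<rho> \<beta> p y $ k = 0"
    proof (cases "kind_of D k")
      case Primal
      then show ?thesis
        by (simp add: local_residual_def local_row_def kkt_row_def partial_bar_lagrangian[OF valid])
    next
      case EqMult
      then show ?thesis using \<beta>
        by (simp add: local_residual_def local_row_def kkt_row_def fun_cong[OF bar_con_eq[OF valid]])
    next
      case IneqMult
      have "trial_point D (owner D k) p y $ k = y $ k" using IneqMult by (simp add: trial_point_def)
      moreover have "bar_con D k p y = con D k (trial_point D (owner D k) p y)"
        using fun_cong[OF bar_con_eq[OF valid]] IneqMult by simp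
      ultimately show ?thesis using IneqMult \<beta> signs[OF IneqMult]
        by (auto simp: local_residual_def local_row_def kkt_row_def split: if_splits)
    qed
  qed
  finally show ?thesis by (simp add: vec_eq_iff)
qed

lemma signs_persist:
  "\<exists>\<delta>>0. \<forall>p y k. norm (p - ps) < \<delta> \<longrightarrow> norm (y - dual_part D ps) < \<delta> \<longrightarrow> kind_of D k = IneqMult \<longrightarrow>
    (if k \<in> active D ps then y $ k > 0 else con D k (trial_point D (owner D k) p y) < 0)"
proof -
  have "\<forall>\<^sub>F z in nhds ps. kind_of D k = IneqMult \<longrightarrow>
      (if k \<in> active D ps then z $ k > 0 else con D k z < 0)" for k
  proof (cases "kind_of D k = IneqMult")
    case True
    have lim1: "((\<lambda>z. z $ k) \<longlongrightarrow> ps $ k) (nhds ps)" by (intro tendsto_intros filterlim_ident)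
    have "isCont (con D k) ps"
      by (rule differentiable_imp_continuous_within[OF differentiable3[OF valid smooth_con[OF valid]]])
        (simp add: True)
    then have lim2: "(con D k \<longlongrightarrow> con D k ps) (nhds ps)"
      by (simp add: continuous_at tendsto_nhds_iff)
    show ?thesis
      using order_tendstoD(1)[OF lim1 active_multiplier_pos] order_tendstoD(2)[OF lim2 inactive_neg(1)] True
      by (cases "k \<in> active D ps") auto
  qed simp
  then have "\<forall>\<^sub>F z in nhds ps. \<forall>k. kind_of D k = IneqMult \<longrightarrow>
      (if k \<in> active D ps then z $ k > 0 else con D k z < 0)"
    by (rule eventually_all_finite)
  then obtain d where d: "d > 0" "\<And>z k. dist z ps < d \<Longrightarrow> kind_of D k = IneqMult \<Longrightarrow>
      if k \<in> active D ps then z $ k > 0 else con D k z < 0"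
    unfolding eventually_nhds_metric by blast
  have "if k \<in> active D ps then y $ k > 0 else con D k (trial_point D (owner D k) p y) < 0"
    if "norm (p - ps) < d / 2" "norm (y - dual_part D ps) < d / 2" "kind_of D k = IneqMult" for p y k
  proof -
    have "dist (trial_point D (owner D k) p y) ps < d"
      using norm_trial_point_diff[of D "owner D k" p y ps] that(1,2) by (simp add: dist_norm)
    from d(2)[OF this that(3)] show ?thesis
      using that(3) by (auto simp: trial_point_def split: if_splits)
  qed
  with d(1) show ?thesis by (metis half_gt_zero)
qed

text \<open>
  Each row depends on \<open>y\<close> through its trial point only, apart from a proximal term that is linear
  in \<open>y\<close> and so is reproduced exactly.
\<close>

lemma local_residual_strictly_differentiable:
  assumes conv: "local_convexity D \<rho> ps"
  shows "\<exists>K\<ge>0. \<exists>\<delta>>0. \<forall>p y y'. norm (p - ps) < \<delta> \<longrightarrow> norm (y - dual_part D ps) < \<delta> \<longrightarrow>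
    norm (y' - dual_part D ps) < \<delta> \<longrightarrow>
    norm (local_residual D \<rho> \<beta> p y - local_residual D \<rho> \<beta> p y'
        - P_matrix D \<rho> \<beta> ps (dual_part D ps) *v (y - y'))
      \<le> K * ((norm (p - ps) + norm (y - dual_part D ps) + norm (y' - dual_part D ps)) * norm (y - y'))"
proof -
  let ?ds = "dual_part D ps"
  obtain K \<delta> where K: "K \<ge> 0" and \<delta>: "\<delta> > 0" and
    lin: "\<And>k z z'. norm (z - ps) < \<delta> \<Longrightarrow> norm (z' - ps) < \<delta> \<Longrightarrow>
      \<bar>local_row D \<beta> k z - local_row D \<beta> k z' - gradient (local_row D \<beta> k) ps \<bullet> (z - z')\<bar>
        \<le> K * ((norm (z - ps) + norm (z' - ps)) * norm (z - z'))"
    using linearization_error_family[of "local_row D \<beta>" ps] smooth_local_row[OF valid] by metis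
  have "norm (local_residual D \<rho> \<beta> p y - local_residual D \<rho> \<beta> p y'
        - P_matrix D \<rho> \<beta> ps ?ds *v (y - y'))
      \<le> CARD('m) * (K * (2 * (norm (p - ps) + norm (y - ?ds) + norm (y' - ?ds)) * norm (y - y')))"
    if p: "norm (p - ps) < \<delta> / 2" and y: "norm (y - ?ds) < \<delta> / 2" and y': "norm (y' - ?ds) < \<delta> / 2"
    for p y y'
  proof (rule norm_le_card_mult_bound)
    fix k
    let ?z = "trial_point D (owner D k) p y" and ?z' = "trial_point D (owner D k) p y'"
    have z: "norm (?z - ps) \<le> norm (p - ps) + norm (y - ?ds)"
      and z': "norm (?z' - ps) \<le> norm (p - ps) + norm (y' - ?ds)"
      by (rule norm_trial_point_diff)+
    have zz': "norm (?z - ?z') \<le> norm (y - y')"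
      unfolding trial_point_diff by (rule norm_trial_point_0)
    have "\<bar>(local_residual D \<rho> \<beta> p y - local_residual D \<rho> \<beta> p y'
        - P_matrix D \<rho> \<beta> ps ?ds *v (y - y')) $ k\<bar>
      = \<bar>local_row D \<beta> k ?z - local_row D \<beta> k ?z' - gradient (local_row D \<beta> k) ps \<bullet> (?z - ?z')\<bar>"
      unfolding trial_point_diff
      by (rule arg_cong[where f = abs])
        (simp add: local_residual_def P_matrix_row[OF conv] right_diff_distrib)
    also have "\<dots> \<le> K * ((norm (?z - ps) + norm (?z' - ps)) * norm (?z - ?z'))"
      by (rule lin) (use z z' p y y' in linarith)+
    also have "\<dots> \<le> K * (2 * (norm (p - ps) + norm (y - ?ds) + norm (y' - ?ds)) * norm (y - y'))"
    proof -
      have "norm (?z - ps) + norm (?z' - ps) \<le> 2 * (norm (p - ps) + norm (y - ?ds) + norm (y' - ?ds))"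
        using z z' norm_ge_zero[of "y - ?ds"] norm_ge_zero[of "y' - ?ds"]
        unfolding distrib_left by linarith
      then show ?thesis using zz' K by (intro mult_left_mono mult_mono) auto
    qed
    finally show "\<bar>(local_residual D \<rho> \<beta> p y - local_residual D \<rho> \<beta> p y'
        - P_matrix D \<rho> \<beta> ps ?ds *v (y - y')) $ k\<bar>
      \<le> K * (2 * (norm (p - ps) + norm (y - ?ds) + norm (y' - ?ds)) * norm (y - y'))" .
  qed
  then have "norm (local_residual D \<rho> \<beta> p y - local_residual D \<rho> \<beta> p y'
        - P_matrix D \<rho> \<beta> ps ?ds *v (y - y'))
      \<le> (CARD('m) * K * 2) * ((norm (p - ps) + norm (y - ?ds) + norm (y' - ?ds)) * norm (y - y'))"
    if "norm (p - ps) < \<delta> / 2" "norm (y - ?ds) < \<delta> / 2" "norm (y' - ?ds) < \<delta> / 2" for p y y'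
    using that by (simp only: mult.assoc)
  then show ?thesis
    using K \<delta> by - (rule exI[of _ "CARD('m) * K * 2"], rule conjI, simp,
        rule exI[of _ "\<delta> / 2"], blast intro: half_gt_zero)
qed

lemma central_residual_linearization:
  assumes sosc: "uniform_sosc D ps"
  shows "\<exists>K\<ge>0. \<exists>\<delta>>0. \<forall>p. norm (p - ps) < \<delta> \<longrightarrow>
    norm (central_residual D \<beta> p - A_matrix D \<beta> ps *v (p - ps)) \<le> K * (norm (p - ps))\<^sup>2"
proof -
  let ?R = "kkt_row D \<beta> (lagrangian D)"
  obtain K \<delta> where K: "K \<ge> 0" and \<delta>: "\<delta> > 0" and
    lin: "\<And>k z z'. norm (z - ps) < \<delta> \<Longrightarrow> norm (z' - ps) < \<delta> \<Longrightarrow>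
      \<bar>?R k z - ?R k z' - gradient (?R k) ps \<bullet> (z - z')\<bar>
        \<le> K * ((norm (z - ps) + norm (z' - ps)) * norm (z - z'))"
    using linearization_error_family[of ?R ps] smooth_kkt_row[OF valid smooth_lagrangian[OF valid]] by metis
  have R0: "?R k ps = 0" for k
    using kkt by (auto simp: kkt_row_def kkt_point_def coords_def split: kind.split)
  have "norm (central_residual D \<beta> p - A_matrix D \<beta> ps *v (p - ps)) \<le> CARD('m) * (K * (norm (p - ps))\<^sup>2)"
    if "norm (p - ps) < \<delta>" for p
  proof (rule norm_le_card_mult_bound)
    fix k
    show "\<bar>(central_residual D \<beta> p - A_matrix D \<beta> ps *v (p - ps)) $ k\<bar> \<le> K * (norm (p - ps))\<^sup>2"
      using lin[of p ps k] that \<delta>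
      by (simp add: central_residual_def A_matrix_row[OF sosc] R0 power2_eq_square)
  qed
  with K \<delta> show ?thesis
    by - (rule exI[of _ "CARD('m) * K"], rule conjI, simp, rule exI[of _ \<delta>], simp add: mult.assoc)
qed

lemma local_block_differentiable: "local_block D \<rho> \<beta> k l differentiable (at z)"
proof -
  have c: "con D m differentiable (at z)" "partial j (con D m) differentiable (at z)"
    if "kind_of D m \<noteq> Primal" for m j
    using smooth_con[OF valid that] by (auto intro: differentiable3[OF valid] differentiable2[OF valid])
  have e: "(\<lambda>z. z $ k) differentiable (at z)"
    by (rule differentiable3[OF valid times_cont_diff_coordinate])
  have h: "partial j (partial m (local_lagrangian D i)) differentiable (at z)" for i j m
    by (rule partial_partial_differentiable[OF valid smooth_local_lagrangian[OF valid]])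
  show ?thesis
  proof (cases "owner D k = owner D l")
    case True
    then show ?thesis
      unfolding local_block_def[abs_def]
      by (cases "kind_of D k"; cases "kind_of D l"; cases "k = l") (simp_all add: c e h)
  next
    case False
    then show ?thesis unfolding local_block_def[abs_def] by simp
  qed
qed

text \<open>
  Replacing the update matrix by its value at the solution costs only second order, as it acts on a
  vector of first order.
\<close>

lemma P_matrix_Lipschitz:
  "\<exists>K\<ge>0. \<exists>\<delta>>0. \<forall>p y v. norm (p - ps) < \<delta> \<longrightarrow> norm (y - dual_part D ps) < \<delta> \<longrightarrow>
    norm ((P_matrix D \<rho> \<beta> p y - P_matrix D \<rho> \<beta> ps (dual_part D ps)) *v v)
      \<le> K * ((norm (p - ps) + norm (y - dual_part D ps)) * norm v)"
proof -
  let ?ds = "dual_part D ps"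
  have "\<exists>K\<ge>0. \<exists>\<delta>>0. \<forall>z. norm (z - ps) < \<delta> \<longrightarrow>
      norm (local_block D \<rho> \<beta> (fst kl) (snd kl) z - local_block D \<rho> \<beta> (fst kl) (snd kl) ps)
        \<le> K * norm (z - ps)" for kl
    by (rule differentiable_imp_Lipschitz_at[OF local_block_differentiable])
  from uniform_local_constants[where d = "\<lambda>z. norm (z - ps)" and R = "\<lambda>z. norm (z - ps)"
      and Q = "\<lambda>kl z. norm (local_block D \<rho> \<beta> (fst kl) (snd kl) z
        - local_block D \<rho> \<beta> (fst kl) (snd kl) ps)", OF this norm_ge_zero]
  obtain K \<delta> where K: "K \<ge> 0" and \<delta>: "\<delta> > 0" and
    lip: "\<And>kl z. norm (z - ps) < \<delta> \<Longrightarrow>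
      norm (local_block D \<rho> \<beta> (fst kl) (snd kl) z - local_block D \<rho> \<beta> (fst kl) (snd kl) ps)
        \<le> K * norm (z - ps)"
    by blast
  have "norm ((P_matrix D \<rho> \<beta> p y - P_matrix D \<rho> \<beta> ps ?ds) *v v)
      \<le> CARD('m) * (CARD('m) * (K * (norm (p - ps) + norm (y - ?ds)) * norm v))"
    if p: "norm (p - ps) < \<delta> / 2" and y: "norm (y - ?ds) < \<delta> / 2" for p y v
  proof (rule norm_le_card_mult_bound)
    fix k
    let ?s = "norm (p - ps) + norm (y - ?ds)" and ?M = "P_matrix D \<rho> \<beta> p y - P_matrix D \<rho> \<beta> ps ?ds"
    have entry: "\<bar>?M $ k $ l * v $ l\<bar> \<le> K * ?s * norm v" for l
    proof -
      let ?z = "trial_point D (owner D k) p y"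
      have z: "norm (?z - ps) \<le> ?s" by (rule norm_trial_point_diff)
      then have "norm (?z - ps) < \<delta>" using p y by linarith
      from lip[OF this, of "(k, l)"] have "\<bar>?M $ k $ l\<bar> \<le> K * norm (?z - ps)"
        by (simp add: P_matrix_eq[OF valid] trial_point_dual_part)
      also have "\<dots> \<le> K * ?s" using z K by (rule mult_left_mono)
      finally show ?thesis
        unfolding abs_mult using component_le_norm_cart[of v l] by (intro mult_mono) auto
    qed
    have "\<bar>(?M *v v) $ k\<bar> \<le> (\<Sum>l\<in>UNIV. \<bar>?M $ k $ l * v $ l\<bar>)"
      unfolding matrix_vector_mult_def by (simp only: vec_lambda_beta sum_abs)
    also have "\<dots> \<le> (\<Sum>l\<in>(UNIV::'m set). K * ?s * norm v)" by (intro sum_mono entry)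
    finally show "\<bar>(?M *v v) $ k\<bar> \<le> CARD('m) * (K * ?s * norm v)" by simp
  qed
  with K \<delta> show ?thesis
    by - (rule exI[of _ "CARD('m) * (CARD('m) * K)"], rule conjI, simp,
        rule exI[of _ "\<delta> / 2"], simp add: mult.assoc)
qed

section \<open>The solution map and the step of the algorithm\<close>

text \<open>
  Any two locally unique solution maps agree near \<open>ps\<close>, so the chosen one inherits the estimate
  from the solutions found by the chord iteration.
\<close>

lemma solution_map_estimate:
  assumes conv: "local_convexity D \<rho> ps" and comp: "constraint_compatible D ps"
    and sosc: "uniform_sosc D ps"
  shows "\<exists>C\<ge>0. \<exists>\<delta>>0. \<forall>p. norm (p - ps) < \<delta> \<longrightarrow>
    local_residual D \<rho> \<beta> p (solution_map D \<rho> ps p) = 0 \<and>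
    norm (solution_map D \<rho> ps p - dual_part D p) \<le> C * norm (p - ps)"
proof -
  let ?ds = "dual_part D ps" and ?F = "local_residual D \<rho> \<beta>"
  obtain K \<delta>1 where K: "K \<ge> 0" and \<delta>1: "\<delta>1 > 0" and
    strict: "\<And>p y y'. norm (p - ps) < \<delta>1 \<Longrightarrow> norm (y - ?ds) < \<delta>1 \<Longrightarrow> norm (y' - ?ds) < \<delta>1 \<Longrightarrow>
      norm (?F p y - ?F p y' - P_matrix D \<rho> \<beta> ps ?ds *v (y - y'))
        \<le> K * ((norm (p - ps) + norm (y - ?ds) + norm (y' - ?ds)) * norm (y - y'))"
    using local_residual_strictly_differentiable[OF conv] by metis
  obtain KG \<delta>2 where KG: "KG \<ge> 0" and \<delta>2: "\<delta>2 > 0" and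
    central: "\<And>p. norm (p - ps) < \<delta>2 \<Longrightarrow>
      norm (central_residual D \<beta> p - A_matrix D \<beta> ps *v (p - ps)) \<le> KG * (norm (p - ps))\<^sup>2"
    using central_residual_linearization[OF sosc] by metis
  obtain KA where KA: "KA > 0" "\<And>v. norm (A_matrix D \<beta> ps *v v) \<le> norm v * KA"
    using bounded_linear.pos_bounded[OF matrix_vector_mul_bounded_linear[of "A_matrix D \<beta> ps"]] by blast
  obtain \<delta>3 where \<delta>3: "\<delta>3 > 0" and
    signs: "\<And>p y k. norm (p - ps) < \<delta>3 \<Longrightarrow> norm (y - ?ds) < \<delta>3 \<Longrightarrow> kind_of D k = IneqMult \<Longrightarrow>
      if k \<in> active D ps then y $ k > 0 else con D k (trial_point D (owner D k) p y) < 0"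
    using signs_persist by metis
  have equiv: "(\<forall>i. local_kkt D \<rho> i p y) \<longleftrightarrow> ?F p y = 0"
    if "norm (p - ps) < \<delta>3" "norm (y - ?ds) < \<delta>3" for p y
    by (rule local_kkt_iff_residual_zero) (rule signs[OF that])
  define \<delta> where "\<delta> = min \<delta>1 (min \<delta>2 1)"
  have \<delta>: "\<delta> > 0" "\<delta> \<le> \<delta>1" "\<delta> \<le> \<delta>2" "\<delta> \<le> 1" using \<delta>1 \<delta>2 by (auto simp: \<delta>_def)
  have guess: "norm (?F p (dual_part D p)) \<le> (KG + KA) * norm (p - ps)" if "norm (p - ps) < \<delta>" for p
  proof -
    let ?n = "norm (p - ps)"
    have "norm (central_residual D \<beta> p)
        \<le> norm (central_residual D \<beta> p - A_matrix D \<beta> ps *v (p - ps)) + norm (A_matrix D \<beta> ps *v (p - ps))"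
      by (metis diff_add_cancel norm_triangle_ineq)
    also have "\<dots> \<le> KG * ?n\<^sup>2 + ?n * KA"
      using central[of p] KA(2)[of "p - ps"] that \<delta> by (intro add_mono) auto
    also have "?n\<^sup>2 \<le> 1 * ?n"
      unfolding power2_eq_square using that \<delta>(4) by (intro mult_right_mono) auto
    then have "KG * ?n\<^sup>2 \<le> KG * ?n" using KG by (intro mult_left_mono) auto
    finally show ?thesis unfolding local_residual_at_dual_part[OF valid] by (simp add: algebra_simps)
  qed
  have "\<exists>C\<ge>0. \<exists>\<epsilon>0>0. \<forall>\<epsilon>. 0 < \<epsilon> \<and> \<epsilon> \<le> \<epsilon>0 \<longrightarrow> (\<exists>\<eta>>0. \<forall>p. norm (p - ps) < \<eta> \<longrightarrow>
    (\<exists>y. norm (y - ?ds) < \<epsilon> \<and> ?F p y = 0 \<and> norm (y - dual_part D p) \<le> C * norm (p - ps) \<and>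
      (\<forall>y'. norm (y' - ?ds) < \<epsilon> \<and> ?F p y' = 0 \<longrightarrow> y' = y)))"
  proof (rule parametric_equation_locally_solvable[OF local_matrix_injective[OF conv comp] K _ \<delta>(1)])
    show "0 \<le> KG + KA" using KG KA(1) by simp
    show "norm (?F p y - ?F p y' - P_matrix D \<rho> \<beta> ps ?ds *v (y - y'))
        \<le> K * ((norm (p - ps) + norm (y - ?ds) + norm (y' - ?ds)) * norm (y - y'))"
      if "norm (p - ps) < \<delta>" "norm (y - ?ds) < \<delta>" "norm (y' - ?ds) < \<delta>" for p y y'
      by (rule strict) (use that \<delta>(2) in linarith)+
  qed (use norm_dual_part_diff guess in auto)
  then obtain C \<epsilon>0 where C: "C \<ge> 0" and \<epsilon>0: "\<epsilon>0 > 0" and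
    solve: "\<And>\<epsilon>. 0 < \<epsilon> \<Longrightarrow> \<epsilon> \<le> \<epsilon>0 \<Longrightarrow> \<exists>\<eta>>0. \<forall>p. norm (p - ps) < \<eta> \<longrightarrow>
    (\<exists>y. norm (y - ?ds) < \<epsilon> \<and> ?F p y = 0 \<and> norm (y - dual_part D p) \<le> C * norm (p - ps) \<and>
      (\<forall>y'. norm (y' - ?ds) < \<epsilon> \<and> ?F p y' = 0 \<longrightarrow> y' = y))"
    by blast
  have in_ball: "x \<in> ball c e \<longleftrightarrow> norm (x - c) < e" for x c :: "real^'m" and e
    by (simp add: dist_norm norm_minus_commute)
  have "\<exists>\<Phi>. locally_unique_solution_map D \<rho> ps \<Phi>"
  proof -
    define \<epsilon> where "\<epsilon> = min \<epsilon>0 \<delta>3"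
    have \<epsilon>: "0 < \<epsilon>" "\<epsilon> \<le> \<epsilon>0" "\<epsilon> \<le> \<delta>3" using \<epsilon>0 \<delta>3 by (auto simp: \<epsilon>_def)
    obtain \<eta> where \<eta>: "\<eta> > 0" and ex: "\<And>p. norm (p - ps) < \<eta> \<Longrightarrow>
      \<exists>y. norm (y - ?ds) < \<epsilon> \<and> ?F p y = 0 \<and> norm (y - dual_part D p) \<le> C * norm (p - ps) \<and>
        (\<forall>y'. norm (y' - ?ds) < \<epsilon> \<and> ?F p y' = 0 \<longrightarrow> y' = y)"
      using solve[OF \<epsilon>(1,2)] by blast
    obtain \<Phi> where \<Phi>: "\<And>p. norm (p - ps) < \<eta> \<Longrightarrow> norm (\<Phi> p - ?ds) < \<epsilon> \<and> ?F p (\<Phi> p) = 0 \<and>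
        norm (\<Phi> p - dual_part D p) \<le> C * norm (p - ps) \<and>
        (\<forall>y'. norm (y' - ?ds) < \<epsilon> \<and> ?F p y' = 0 \<longrightarrow> y' = \<Phi> p)"
      using ex by metis
    have start: "\<Phi> ps = ?ds" using \<Phi>[of ps] \<eta> by simp
    have "\<Phi> p \<in> ball ?ds \<epsilon> \<and> (\<forall>i. local_kkt D \<rho> i p (\<Phi> p)) \<and>
        (\<forall>y\<in>ball ?ds \<epsilon>. (\<forall>i. local_kkt D \<rho> i p y) \<longrightarrow> y = \<Phi> p)" if "p \<in> ball ps (min \<eta> \<delta>3)" for p
    proof -
      have p: "norm (p - ps) < \<eta>" "norm (p - ps) < \<delta>3" using that unfolding in_ball by auto
      have eq: "(\<forall>i. local_kkt D \<rho> i p y) \<longleftrightarrow> ?F p y = 0" if "norm (y - ?ds) < \<epsilon>" for y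
        by (rule equiv[OF p(2)]) (use that \<epsilon>(3) in linarith)
      show ?thesis unfolding in_ball Ball_def using \<Phi>[OF p(1)] eq by blast
    qed
    then show ?thesis
      unfolding locally_unique_solution_map_def using start \<eta> \<delta>3 \<epsilon>(1) by (metis min_less_iff_conj)
  qed
  then have "locally_unique_solution_map D \<rho> ps (solution_map D \<rho> ps)"
    unfolding solution_map_def by (rule someI_ex)
  then obtain d e where d: "d > 0" and e: "e > 0" and
    unique: "\<And>p y. p \<in> ball ps d \<Longrightarrow> y \<in> ball ?ds e \<Longrightarrow> (\<forall>i. local_kkt D \<rho> i p y)
      \<Longrightarrow> y = solution_map D \<rho> ps p"
    unfolding locally_unique_solution_map_def by blast
  define \<epsilon> where "\<epsilon> = min \<epsilon>0 (min \<delta>3 e)"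
  have \<epsilon>: "0 < \<epsilon>" "\<epsilon> \<le> \<epsilon>0" "\<epsilon> \<le> \<delta>3" "\<epsilon> \<le> e" using \<epsilon>0 \<delta>3 e by (auto simp: \<epsilon>_def)
  obtain \<eta> where \<eta>: "\<eta> > 0" and ex: "\<And>p. norm (p - ps) < \<eta> \<Longrightarrow>
    \<exists>y. norm (y - ?ds) < \<epsilon> \<and> ?F p y = 0 \<and> norm (y - dual_part D p) \<le> C * norm (p - ps)"
    using solve[OF \<epsilon>(1,2)] by blast
  have "?F p (solution_map D \<rho> ps p) = 0 \<and> norm (solution_map D \<rho> ps p - dual_part D p) \<le> C * norm (p - ps)"
    if p: "norm (p - ps) < min \<eta> (min d \<delta>3)" for p
  proof -
    obtain y where y: "norm (y - ?ds) < \<epsilon>" "?F p y = 0" "norm (y - dual_part D p) \<le> C * norm (p - ps)"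
      using ex[of p] p by auto
    have "\<forall>i. local_kkt D \<rho> i p y" using equiv[of p y] p y \<epsilon>(3) by simp
    then have "y = solution_map D \<rho> ps p"
      by (intro unique) (use p y(1) \<epsilon>(4) in \<open>auto simp: in_ball simp del: mem_ball\<close>)
    with y show ?thesis by simp
  qed
  moreover have "min \<eta> (min d \<delta>3) > 0" using \<eta> d \<delta>3 by simp
  ultimately show ?thesis using C by blast
qed

text \<open>
  Expanding the local systems at \<open>dual_part D p\<close>, where their residual is the central one, gives
  \<open>P (y - dual_part D p) = - central_residual D \<beta> p\<close> up to second order, and the central residual
  has derivative \<open>A\<close> at \<open>ps\<close>.
\<close>

lemma sbdp_step_linearization:
  assumes conv: "local_convexity D \<rho> ps" and comp: "constraint_compatible D ps"
    and sosc: "uniform_sosc D ps"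
  shows "\<exists>K\<ge>0. \<exists>\<delta>>0. \<forall>\<alpha> p. 0 < \<alpha> \<longrightarrow> p \<in> ball ps \<delta> \<longrightarrow>
    norm (sbdp_step D \<rho> \<beta> \<alpha> ps p - ps - (mat 1 - \<alpha> *\<^sub>R A_matrix D \<beta> ps) *v (p - ps))
      \<le> \<alpha> * K * (norm (p - ps))\<^sup>2"
proof -
  let ?ds = "dual_part D ps" and ?F = "local_residual D \<rho> \<beta>" and ?A = "A_matrix D \<beta> ps"
  let ?P0 = "P_matrix D \<rho> \<beta> ps ?ds"
  obtain K1 \<delta>1 where K1: "K1 \<ge> 0" and \<delta>1: "\<delta>1 > 0" and
    strict: "\<And>p y y'. norm (p - ps) < \<delta>1 \<Longrightarrow> norm (y - ?ds) < \<delta>1 \<Longrightarrow> norm (y' - ?ds) < \<delta>1 \<Longrightarrow>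
      norm (?F p y - ?F p y' - ?P0 *v (y - y'))
        \<le> K1 * ((norm (p - ps) + norm (y - ?ds) + norm (y' - ?ds)) * norm (y - y'))"
    using local_residual_strictly_differentiable[OF conv] by metis
  obtain K2 \<delta>2 where K2: "K2 \<ge> 0" and \<delta>2: "\<delta>2 > 0" and
    central: "\<And>p. norm (p - ps) < \<delta>2 \<Longrightarrow>
      norm (central_residual D \<beta> p - ?A *v (p - ps)) \<le> K2 * (norm (p - ps))\<^sup>2"
    using central_residual_linearization[OF sosc] by metis
  obtain K3 \<delta>3 where K3: "K3 \<ge> 0" and \<delta>3: "\<delta>3 > 0" and
    P_lip: "\<And>p y v. norm (p - ps) < \<delta>3 \<Longrightarrow> norm (y - ?ds) < \<delta>3 \<Longrightarrow>
      norm ((P_matrix D \<rho> \<beta> p y - ?P0) *v v) \<le> K3 * ((norm (p - ps) + norm (y - ?ds)) * norm v)"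
    using P_matrix_Lipschitz by metis
  obtain C \<delta>4 where C: "C \<ge> 0" and \<delta>4: "\<delta>4 > 0" and
    sol: "\<And>p. norm (p - ps) < \<delta>4 \<Longrightarrow> ?F p (solution_map D \<rho> ps p) = 0"
      "\<And>p. norm (p - ps) < \<delta>4 \<Longrightarrow> norm (solution_map D \<rho> ps p - dual_part D p) \<le> C * norm (p - ps)"
    using solution_map_estimate[OF conv comp sosc] by metis
  define \<delta> where "\<delta> = Min {\<delta>1 / (C + 1), \<delta>2, \<delta>3 / (C + 1), \<delta>4}"
  have \<delta>: "\<delta> > 0" using \<delta>1 \<delta>2 \<delta>3 \<delta>4 C by (simp add: \<delta>_def)
  define K where "K = K3 * ((C + 2) * C) + K1 * ((C + 3) * C) + K2"
  have K: "K \<ge> 0" using K1 K2 K3 C by (simp add: K_def)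
  have "norm (sbdp_step D \<rho> \<beta> \<alpha> ps p - ps - (mat 1 - \<alpha> *\<^sub>R ?A) *v (p - ps)) \<le> \<alpha> * K * (norm (p - ps))\<^sup>2"
    if \<alpha>: "0 < \<alpha>" and p: "p \<in> ball ps \<delta>" for \<alpha> p
  proof -
    define n where "n = norm (p - ps)"
    define y where "y = solution_map D \<rho> ps p"
    define d where "d = dual_part D p"
    have n: "n \<ge> 0" "n < \<delta>" using p by (auto simp: n_def dist_norm norm_minus_commute)
    have n_small: "(C + 1) * n < \<delta>1" "n < \<delta>2" "(C + 1) * n < \<delta>3" "n < \<delta>4"
      using n(2) C by (auto simp: \<delta>_def field_simps)
    have "1 * n \<le> (C + 1) * n" using C n(1) by (intro mult_right_mono) auto
    then have n_le: "n < \<delta>1" "n < \<delta>3" using n_small by linarith+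
    have Fy: "?F p y = 0" and yd: "norm (y - d) \<le> C * n"
      using sol[of p] n_small(4) by (auto simp: y_def d_def n_def)
    have dn: "norm (d - ?ds) \<le> n" unfolding d_def n_def by (rule norm_dual_part_diff)
    have "norm (y - ?ds) \<le> norm (y - d) + norm (d - ?ds)"
      by (metis diff_add_cancel add_diff_eq norm_triangle_ineq)
    then have yn: "norm (y - ?ds) \<le> (C + 1) * n" using yd dn by (simp add: algebra_simps)
    have e1: "norm ((P_matrix D \<rho> \<beta> p y - ?P0) *v (y - d)) \<le> K3 * ((C + 2) * C) * n\<^sup>2"
    proof -
      have "norm ((P_matrix D \<rho> \<beta> p y - ?P0) *v (y - d)) \<le> K3 * ((n + norm (y - ?ds)) * norm (y - d))"
        unfolding n_def by (rule P_lip) (use n_le n_small yn in \<open>auto simp: n_def\<close>)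
      also have "\<dots> \<le> K3 * (((C + 2) * n) * (C * n))"
        using yn yd n(1) K3 C by (intro mult_left_mono mult_mono) (auto simp: algebra_simps)
      finally show ?thesis by (simp add: power2_eq_square ac_simps)
    qed
    have e2: "norm (?F p y - ?F p d - ?P0 *v (y - d)) \<le> K1 * ((C + 3) * C) * n\<^sup>2"
    proof -
      have "norm (?F p y - ?F p d - ?P0 *v (y - d))
          \<le> K1 * ((n + norm (y - ?ds) + norm (d - ?ds)) * norm (y - d))"
        unfolding n_def by (rule strict) (use n_le n_small yn dn in \<open>auto simp: n_def\<close>)
      also have "\<dots> \<le> K1 * (((C + 3) * n) * (C * n))"
        using yn yd dn n(1) K1 C by (intro mult_left_mono mult_mono) (auto simp: algebra_simps)
      finally show ?thesis by (simp add: power2_eq_square ac_simps)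
    qed
    have e3: "norm (?F p d - ?A *v (p - ps)) \<le> K2 * n\<^sup>2"
      using central[of p] n_small(2) unfolding d_def local_residual_at_dual_part[OF valid] n_def by simp
    have "sbdp_step D \<rho> \<beta> \<alpha> ps p - ps - (mat 1 - \<alpha> *\<^sub>R ?A) *v (p - ps)
        = \<alpha> *\<^sub>R (P_matrix D \<rho> \<beta> p y *v (y - d) + ?A *v (p - ps))"
      by (simp add: sbdp_step_def Let_def y_def d_def matrix_vector_mult_diff_rdistrib
          scaleR_add_right flip: scaleR_matrix_vector_assoc)
    also have "P_matrix D \<rho> \<beta> p y *v (y - d) + ?A *v (p - ps)
        = (P_matrix D \<rho> \<beta> p y - ?P0) *v (y - d) - (?F p y - ?F p d - ?P0 *v (y - d))
          - (?F p d - ?A *v (p - ps))"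
      by (simp add: Fy matrix_vector_mult_diff_rdistrib)
    finally have "norm (sbdp_step D \<rho> \<beta> \<alpha> ps p - ps - (mat 1 - \<alpha> *\<^sub>R ?A) *v (p - ps))
        = \<alpha> * norm ((P_matrix D \<rho> \<beta> p y - ?P0) *v (y - d) - (?F p y - ?F p d - ?P0 *v (y - d))
          - (?F p d - ?A *v (p - ps)))" using \<alpha> by simp
    also have "\<dots> \<le> \<alpha> * (K3 * ((C + 2) * C) * n\<^sup>2 + K1 * ((C + 3) * C) * n\<^sup>2 + K2 * n\<^sup>2)"
      using \<alpha> by (intro mult_left_mono order_trans[OF norm_triangle_ineq4] add_mono e1 e2 e3) auto
    also have "\<dots> = \<alpha> * K * (norm (p - ps))\<^sup>2" by (simp add: K_def n_def algebra_simps)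
    finally show ?thesis .
  qed
  with K \<delta> show ?thesis by blast
qed

end

theorem theorem1:
  fixes D :: "('v::finite, 'm::finite) nlp"
    and \<rho> :: "'v \<Rightarrow> real" and \<beta> :: real and ps :: "real^'m"
  assumes "valid_nlp D"
    and "kkt_point D ps"
    and "strict_complementarity D ps" and "licq D ps"
    and "uniform_sosc D ps"
    and "local_convexity D \<rho> ps"
    and "constraint_compatible D ps"
    and "\<beta> > 0"
  shows "\<exists>\<alpha>max>0. \<exists>r>0. \<forall>\<alpha>. 0 < \<alpha> \<and> \<alpha> < 1 \<and> \<alpha> < \<alpha>max \<longrightarrow>
    (let T = sbdp_step D \<rho> \<beta> \<alpha> ps; N = mat 1 - \<alpha> *\<^sub>R A_matrix D \<beta> ps in
      (\<forall>p0\<in>ball ps r. bounded (range (\<lambda>q. (T ^^ q) p0)) \<and> (\<lambda>q. (T ^^ q) p0) \<longlonglongrightarrow> ps) \<and>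
      (\<forall>Q. pos_def Q \<longrightarrow>
        (\<exists>P. pos_def P \<and> transpose N ** P ** N - P = - Q \<and>
          (let C = wmatnorm P N in
            0 < C \<and> C < 1 \<and>
            (\<exists>K\<ge>0. \<forall>p0\<in>ball ps r. \<forall>q\<ge>1.
               wnorm P ((T ^^ q) p0 - ps) \<le>
                 C * wnorm P ((T ^^ (q - 1)) p0 - ps) + K * (wnorm P ((T ^^ (q - 1)) p0 - ps))\<^sup>2) \<and>
            (\<forall>c. C < c \<and> c < 1 \<longrightarrow>
              (\<exists>r'>0. r' \<le> r \<and> (\<forall>p0\<in>ball ps r'. \<forall>q\<ge>1.
                 wnorm P ((T ^^ q) p0 - ps) \<le> c * wnorm P ((T ^^ (q - 1)) p0 - ps))))))) \<and>
      (\<exists>C0>0. \<exists>C1>0. C1 < 1 \<and> (\<forall>p0\<in>ball ps r. \<forall>q.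
         norm ((T ^^ q) p0 - ps) \<le> C0 * C1 ^ q * norm (p0 - ps))))"
proof -
  obtain W where W: "pos_def W" "\<And>v. v \<noteq> 0 \<Longrightarrow> v \<bullet> (W *v (A_matrix D \<beta> ps *v v)) > 0"
    using stability_matrix[OF assms(1,8,2,3,5,4)] by metis
  obtain K \<delta> where "K \<ge> 0" "\<delta> > 0" and
    approx: "\<And>\<alpha> p. 0 < \<alpha> \<Longrightarrow> p \<in> ball ps \<delta> \<Longrightarrow>
      norm (sbdp_step D \<rho> \<beta> \<alpha> ps p - ps - (mat 1 - \<alpha> *\<^sub>R A_matrix D \<beta> ps) *v (p - ps))
        \<le> \<alpha> * K * (norm (p - ps))\<^sup>2"
    using sbdp_step_linearization[OF assms(1,8,2,3,6,7,5)] by metis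
  from locally_linear_iteration_converges[where T = "\<lambda>\<alpha>. sbdp_step D \<rho> \<beta> \<alpha> ps", OF W this]
  show ?thesis unfolding Let_def .
qed
end
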